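(* Let $V$ be a finite-dimensional vector space over a field $K$, let $q\in K\setminus\{0\}$ be not a root of unity, let $\hat R$ be a Yang-Baxter matrix of Hecke type on $V\otimes V$ with eigenvalues $q$ and $-q^{-1}$, and let $\hat F$ be a Yang-Baxter matrix on $V\otimes V$ such that there is a unique operator $D(F)$ on $V$ with $\mathrm{Tr}_2(\hat FD(F)_2)=I$. Assume that $\hat R$ and $\hat F$ are compatible, i.e. on $V^{\otimes 3}$ $$\hat R_1\hat F_2\hat F_1=\hat F_2\hat F_1\hat R_2,\qquad \hat R_2\hat F_1\hat F_2=\hat F_1\hat F_2\hat R_1.$$ Let $M=(M^i_j)$ be the matrix of generators of the algebra $\mathcal M(\hat R,\hat F)$. Put $M_{\overline1}:=M_1$, $M_{\overline{k+1}}:=\hat F_kM_{\overline k}\hat F_k^{-1}$, and, for $k\ge1$, $$M^{\overline k}:=\mathrm{Tr}_{F(2\dots k)}(\hat R_1\hat R_2\cdots\hat R_{k-1}M_{\overline1}M_{\overline2}\cdots M_{\overline k}),\qquad M^{\overline{[k]}}:=\mathrm{Tr}_{F(2\dots k)}(A_kM_{\overline1}\cdots M_{\overline k}),$$ $$\sigma_k(M):=\mathrm{Tr}_F(M^{\overline{[k]}}),\qquad\sigma_0(M):=1.$$ Then for all integers $k\ge1$ $$(-1)^{k-1}k_q\,M^{\overline{[k]}}=\sum_{j=0}^{k-1}(-q)^j\,M^{\overline{k-j}}\,\sigma_j(M).$$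
   Context: A Yang-Baxter matrix is an invertible operator $\hat R$ on $V\otimes V$ with $\hat R_1\hat R_2\hat R_1=\hat R_2\hat R_1\hat R_2$ on $V^{\otimes3}$, where for an operator $\hat Y$ on $V\otimes V$, $\hat Y_i$ denotes $\hat Y$ acting in the $i$-th and $(i+1)$-st copies of $V$. It is of Hecke type (with parameter $q$) if $(\hat R-q)(\hat R+q^{-1})=0$; no condition is imposed on the ranks of the two spectral projectors. $q$-numbers: $k_q:=(q^k-q^{-k})/(q-q^{-1})$. Antisymmetrizers $A_k$ on $V^{\otimes k}$ are built from $\hat R$ inductively by $A_1:=I$ and $$A_k:=\frac1{k_q}A_{k-1}\bigl(q^{k-1}-(k-1)_q\hat R_{k-1}\bigr)A_{k-1},$$ where $A_{k-1}$ acts in the copies $1,\dots,k-1$. Twisting: for a compatible pair, $\hat R^F:=\hat F\hat R\hat F^{-1}$ is again a Yang-Baxter matrix compatible with $\hat F$, and $\hat R^{FF}:=\hat F\hat R^F\hat F^{-1}=\hat F^2\hat R\hat F^{-2}$. The algebra $\mathcal M(\hat R,\hat F)$ is the unital associative $K$-algebra generated by the entries $M^i_j$ ($1\le i,j\le\dim V$) of a matrix $M$ subject to $$\hat RM_{\overline1}M_{\overline2}=M_{\overline1}M_{\overline2}\hat R^{FF},$$ where $M_{\overline1}=M_1$ is $M$ acting in the first copy of $V$ and $M_{\overline2}=\hat FM_{\overline1}\hat F^{-1}$. The operator $D(F)$ on $V$ is defined by $\mathrm{Tr}_2(\hat FD(F)_2)=I$ (partial trace over the second copy, $D(F)_2$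 acting in the second copy). The quantum trace of a matrix $Z$ is $\mathrm{Tr}_F(Z):=\mathrm{Tr}(D(F)Z)$, and $\mathrm{Tr}_{F(a\dots b)}(Z):=\mathrm{Tr}_{(a\dots b)}(D(F)_a\cdots D(F)_bZ)$ is the partial quantum trace over copies $a,\dots,b$ of $V$ (no trace when $a>b$, so $M^{\overline1}=M^{\overline{[1]}}=M$). *)

theory Defs
  imports
    Jordan_Normal_Form.Matrix
    "HOL-Algebra.QuotRing"
    "HOL-Library.Poly_Mapping"
begin

text \<open>A finite-dimensional space \<open>V\<close> of dimension \<open>n\<close> is taken with a fixed basis (the generators
  \<open>M^i_j\<close> are matrix entries anyway), so \<open>V\<close> is \<open>K^n\<close> and operators on \<open>V^{\<otimes>m}\<close> are matrices of
  size \<open>n^m\<close>.  A multi-index \<open>(i_1,...,i_m)\<close> with \<open>0 \<le> i_s < n\<close> is the number with base-\<open>n\<close>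
  digits \<open>i_1 ... i_m\<close>, \<open>i_1\<close> being the most significant one.  Upper indices are row indices.\<close>

section \<open>Operators on tensor powers\<close>

definition kron :: "'a::times mat \<Rightarrow> 'a mat \<Rightarrow> 'a mat" where
  "kron A B = mat (dim_row A * dim_row B) (dim_col A * dim_col B)
     (\<lambda>(i, j). A $$ (i div dim_row B, j div dim_col B) * B $$ (i mod dim_row B, j mod dim_col B))"

text \<open>\<open>act n m i r Y\<close>: the operator \<open>Y\<close> on \<open>V^{\<otimes>r}\<close>, acting in the copies \<open>i, ..., i+r-1\<close> of
  \<open>V^{\<otimes>m}\<close>.  Meaningful for \<open>1 \<le> i\<close> and \<open>i + r \<le> m + 1\<close>.\<close>

definition act :: "nat \<Rightarrow> nat \<Rightarrow> nat \<Rightarrow> nat \<Rightarrow> 'a::semiring_1 mat \<Rightarrow> 'a mat" where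
  "act n m i r Y = kron (kron (1\<^sub>m (n ^ (i - 1))) Y) (1\<^sub>m (n ^ (m + 1 - i - r)))"

text \<open>\<open>op_prod N f a b = f a * f (a+1) * ... * f b\<close>, the identity of size \<open>N\<close> if \<open>a > b\<close>.\<close>

definition op_prod :: "nat \<Rightarrow> (nat \<Rightarrow> 'a::semiring_1 mat) \<Rightarrow> nat \<Rightarrow> nat \<Rightarrow> 'a mat" where
  "op_prod N f a b = foldr (\<lambda>i X. f i * X) [a..<Suc b] (1\<^sub>m N)"

definition mat_trace :: "'a::comm_monoid_add mat \<Rightarrow> 'a" where
  "mat_trace X = (\<Sum>i<dim_row X. X $$ (i, i))"

text \<open>Partial trace over the second factor of \<open>K^d \<otimes> K^e\<close>.\<close>

definition ptrace2 :: "nat \<Rightarrow> nat \<Rightarrow> 'a::comm_monoid_add mat \<Rightarrow> 'a mat" where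
  "ptrace2 d e X = mat d d (\<lambda>(i, j). \<Sum>l<e. X $$ (i * e + l, j * e + l))"

definition mat_inv :: "'a::semiring_1 mat \<Rightarrow> 'a mat" where
  "mat_inv A = (THE B. inverts_mat A B \<and> inverts_mat B A)"

section \<open>Yang-Baxter matrices\<close>

definition yang_baxter :: "nat \<Rightarrow> 'k::field mat \<Rightarrow> bool" where
  "yang_baxter n R \<longleftrightarrow> R \<in> carrier_mat (n ^ 2) (n ^ 2) \<and> invertible_mat R \<and>
     act n 3 1 2 R * act n 3 2 2 R * act n 3 1 2 R = act n 3 2 2 R * act n 3 1 2 R * act n 3 2 2 R"

definition hecke_type :: "nat \<Rightarrow> 'k::field \<Rightarrow> 'k mat \<Rightarrow> bool" where
  "hecke_type n q R \<longleftrightarrow>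
     (R - q \<cdot>\<^sub>m 1\<^sub>m (n ^ 2)) * (R + inverse q \<cdot>\<^sub>m 1\<^sub>m (n ^ 2)) = 0\<^sub>m (n ^ 2) (n ^ 2)"

definition compatible_pair :: "nat \<Rightarrow> 'k::field mat \<Rightarrow> 'k mat \<Rightarrow> bool" where
  "compatible_pair n R F \<longleftrightarrow>
     act n 3 1 2 R * act n 3 2 2 F * act n 3 1 2 F = act n 3 2 2 F * act n 3 1 2 F * act n 3 2 2 R \<and>
     act n 3 2 2 R * act n 3 1 2 F * act n 3 2 2 F = act n 3 1 2 F * act n 3 2 2 F * act n 3 1 2 R"

definition twist :: "'k::field mat \<Rightarrow> 'k mat \<Rightarrow> 'k mat" where
  "twist F R = F * R * mat_inv F"

definition is_D :: "nat \<Rightarrow> 'k::field mat \<Rightarrow> 'k mat \<Rightarrow> bool" where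
  "is_D n F D \<longleftrightarrow> D \<in> carrier_mat n n \<and> ptrace2 n n (F * act n 2 2 1 D) = 1\<^sub>m n"

definition D_op :: "nat \<Rightarrow> 'k::field mat \<Rightarrow> 'k mat" where
  "D_op n F = (THE D. is_D n F D)"

definition qnum :: "'k::field \<Rightarrow> nat \<Rightarrow> 'k" where
  "qnum q k = (q ^ k - inverse q ^ k) / (q - inverse q)"

text \<open>\<open>antisym n q R k\<close> is \<open>A_k\<close> on \<open>V^{\<otimes>k}\<close>; the value at \<open>k = 0\<close> is never used.\<close>

fun antisym :: "nat \<Rightarrow> 'k::field \<Rightarrow> 'k mat \<Rightarrow> nat \<Rightarrow> 'k mat" where
  "antisym n q R 0 = 1\<^sub>m 1"
| "antisym n q R (Suc 0) = 1\<^sub>m n"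
| "antisym n q R (Suc (Suc m)) =
     (let k = m + 2; A = act n k 1 (k - 1) (antisym n q R (Suc m)) in
      (1 / qnum q k) \<cdot>\<^sub>m
        (A * (q ^ (k - 1) \<cdot>\<^sub>m 1\<^sub>m (n ^ k) - qnum q (k - 1) \<cdot>\<^sub>m act n k (k - 1) 2 R) * A))"

section \<open>The free algebra on the entries of \<open>M\<close>\<close>

text \<open>Words form a monoid under concatenation, so \<open>'g list \<Rightarrow>\<^sub>0 'k\<close> with the convolution product
  of the library is the free algebra over \<open>'k\<close> on \<open>'g\<close>.\<close>

instantiation list :: (type) monoid_add
begin
definition zero_list :: "'a list" where "zero_list = []"
definition plus_list :: "'a list \<Rightarrow> 'a list \<Rightarrow> 'a list" where "plus_list = (@)"
instance by standard (simp_all add: zero_list_def plus_list_def)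
end

type_synonym 'k free_alg = "(nat \<times> nat) list \<Rightarrow>\<^sub>0 'k"

definition scal :: "'k::field \<Rightarrow> 'k free_alg" where
  "scal c = Poly_Mapping.single [] c"

definition gen_mat :: "nat \<Rightarrow> 'k::field free_alg mat" where
  "gen_mat n = mat n n (\<lambda>(i, j). Poly_Mapping.single [(i, j)] 1)"

abbreviation lift_op :: "'k::field mat \<Rightarrow> 'k free_alg mat" where
  "lift_op \<equiv> map_mat scal"

text \<open>Only the \<open>n^2\<close> generators \<open>M^i_j\<close> with \<open>i, j < n\<close> are allowed.\<close>

definition free_algebra :: "nat \<Rightarrow> 'k::field free_alg ring" where
  "free_algebra n = \<lparr>
     carrier = {p. \<forall>w \<in> Poly_Mapping.keys p. set w \<subseteq> {..<n} \<times> {..<n}},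
     mult = (*), one = 1, zero = 0, add = (+)\<rparr>"

section \<open>The algebra \<open>M(R,F)\<close>\<close>

text \<open>\<open>M_bar n F m k\<close> is the matrix \<open>M\<close> with overlined index \<open>k\<close>, acting on \<open>V^{\<otimes>m}\<close>, for
  \<open>1 \<le> k \<le> m\<close>; the value at \<open>k = 0\<close> is never used.\<close>

fun M_bar :: "nat \<Rightarrow> 'k::field mat \<Rightarrow> nat \<Rightarrow> nat \<Rightarrow> 'k free_alg mat" where
  "M_bar n F m 0 = 1\<^sub>m (n ^ m)"
| "M_bar n F m (Suc 0) = act n m 1 1 (gen_mat n)"
| "M_bar n F m (Suc (Suc i)) =
     lift_op (act n m (Suc i) 2 F) * M_bar n F m (Suc i) * lift_op (act n m (Suc i) 2 (mat_inv F))"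

definition qm_relations :: "nat \<Rightarrow> 'k::field mat \<Rightarrow> 'k mat \<Rightarrow> 'k free_alg set" where
  "qm_relations n R F =
     elements_mat (lift_op R * M_bar n F 2 1 * M_bar n F 2 2
       - M_bar n F 2 1 * M_bar n F 2 2 * lift_op (twist F (twist F R)))"

definition qm_ideal :: "nat \<Rightarrow> 'k::field mat \<Rightarrow> 'k mat \<Rightarrow> 'k free_alg set" where
  "qm_ideal n R F = Idl\<^bsub>free_algebra n\<^esub> (qm_relations n R F)"

definition qm_algebra :: "nat \<Rightarrow> 'k::field mat \<Rightarrow> 'k mat \<Rightarrow> 'k free_alg set ring" where
  "qm_algebra n R F = free_algebra n Quot qm_ideal n R F"

definition qm_class :: "nat \<Rightarrow> 'k::field mat \<Rightarrow> 'k mat \<Rightarrow> 'k free_alg \<Rightarrow> 'k free_alg set" where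
  "qm_class n R F p = qm_ideal n R F +>\<^bsub>free_algebra n\<^esub> p"

section \<open>Powers and wedge powers of \<open>M\<close>\<close>

text \<open>These are written with representatives in the free algebra.  As \<open>qm_class\<close> is a ring
  homomorphism onto \<open>qm_algebra\<close> (lemma \<open>qm_class_ring_hom\<close> below), applying it to the entries gives
  the matrices and elements of the quotient algebra.\<close>

text \<open>Quantum trace over the copies \<open>2, ..., k\<close> of \<open>V^{\<otimes>k}\<close>, for \<open>k \<ge> 1\<close>.\<close>

definition qtrace_from2 :: "nat \<Rightarrow> 'k::field mat \<Rightarrow> nat \<Rightarrow> 'k free_alg mat \<Rightarrow> 'k free_alg mat" where
  "qtrace_from2 n F k Z =
     ptrace2 n (n ^ (k - 1)) (lift_op (op_prod (n ^ k) (\<lambda>a. act n k a 1 (D_op n F)) 2 k) * Z)"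

definition qtrace :: "nat \<Rightarrow> 'k::field mat \<Rightarrow> 'k free_alg mat \<Rightarrow> 'k free_alg" where
  "qtrace n F Z = mat_trace (lift_op (D_op n F) * Z)"

definition M_pow :: "nat \<Rightarrow> 'k::field mat \<Rightarrow> 'k mat \<Rightarrow> nat \<Rightarrow> 'k free_alg mat" where
  "M_pow n R F k = qtrace_from2 n F k
     (lift_op (op_prod (n ^ k) (\<lambda>i. act n k i 2 R) 1 (k - 1)) * op_prod (n ^ k) (M_bar n F k) 1 k)"

definition M_wedge :: "nat \<Rightarrow> 'k::field \<Rightarrow> 'k mat \<Rightarrow> 'k mat \<Rightarrow> nat \<Rightarrow> 'k free_alg mat" where
  "M_wedge n q R F k = qtrace_from2 n F k
     (lift_op (antisym n q R k) * op_prod (n ^ k) (M_bar n F k) 1 k)"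

definition sigma :: "nat \<Rightarrow> 'k::field \<Rightarrow> 'k mat \<Rightarrow> 'k mat \<Rightarrow> nat \<Rightarrow> 'k free_alg" where
  "sigma n q R F k = (if k = 0 then 1 else qtrace n F (M_wedge n q R F k))"

section \<open>The quotient map\<close>

lemma free_carrier_simps:
  fixes p r :: "'k::field free_alg"
  shows "0 \<in> carrier (free_algebra n :: 'k free_alg ring)"
    "1 \<in> carrier (free_algebra n :: 'k free_alg ring)"
    "p \<in> carrier (free_algebra n) \<Longrightarrow> r \<in> carrier (free_algebra n) \<Longrightarrow> p + r \<in> carrier (free_algebra n)"
    "p \<in> carrier (free_algebra n) \<Longrightarrow> r \<in> carrier (free_algebra n) \<Longrightarrow> p * r \<in> carrier (free_algebra n)"
    "p \<in> carrier (free_algebra n) \<Longrightarrow> - p \<in> carrier (free_algebra n)"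
    "p \<in> carrier (free_algebra n) \<Longrightarrow> r \<in> carrier (free_algebra n) \<Longrightarrow> p - r \<in> carrier (free_algebra n)"
proof -
  show "0 \<in> carrier (free_algebra n :: 'k free_alg ring)"
    "1 \<in> carrier (free_algebra n :: 'k free_alg ring)"
    by (simp_all add: free_algebra_def zero_list_def)
  show add: "p + r \<in> carrier (free_algebra n)"
    if "p \<in> carrier (free_algebra n)" "r \<in> carrier (free_algebra n)" for p r :: "'k free_alg"
    using that Poly_Mapping.keys_add[of p r] unfolding free_algebra_def
    by (simp only: partial_object.simps mem_Collect_eq) blast
  show neg: "- p \<in> carrier (free_algebra n)"
    if "p \<in> carrier (free_algebra n)" for p :: "'k free_alg"
    using that by (simp add: free_algebra_def)
  show "p - r \<in> carrier (free_algebra n)"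
    if "p \<in> carrier (free_algebra n)" "r \<in> carrier (free_algebra n)"
    using add[OF that(1) neg[OF that(2)]] by simp
  show "p * r \<in> carrier (free_algebra n)"
    if p: "p \<in> carrier (free_algebra n)" and r: "r \<in> carrier (free_algebra n)"
    unfolding free_algebra_def
  proof (simp only: partial_object.simps mem_Collect_eq, rule ballI)
    fix w assume "w \<in> Poly_Mapping.keys (p * r)"
    then obtain u v where uv: "w = u @ v" "u \<in> Poly_Mapping.keys p" "v \<in> Poly_Mapping.keys r"
      using subsetD[OF keys_mult[of p r]] unfolding plus_list_def by blast
    then have "set u \<subseteq> {..<n} \<times> {..<n}" "set v \<subseteq> {..<n} \<times> {..<n}"
      using p r unfolding free_algebra_def by simp_all
    then show "set w \<subseteq> {..<n} \<times> {..<n}" using uv(1) by simp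
  qed
qed

lemma free_algebra_ops:
  "monoid.mult (free_algebra n) = (*)" "one (free_algebra n) = 1"
  "ring.zero (free_algebra n) = 0" "ring.add (free_algebra n) = (+)"
  by (simp_all add: free_algebra_def)

lemma ring_free_algebra: "ring (free_algebra n :: 'k::field free_alg ring)"
proof (intro ringI abelian_groupI monoidI, unfold free_algebra_ops)
  fix p r s :: "'k free_alg"
  show "(p + r) * s = p * s + r * s" "s * (p + r) = s * p + s * r" "p + r = r + p"
    "p + r + s = p + (r + s)" "p * r * s = p * (r * s)" "1 * p = p" "p * 1 = p" "0 + p = p"
    by (rule distrib_right distrib_left add.commute add.assoc mult.assoc mult_1_left mult_1_right
      add_0_left)+
  show "\<exists>s \<in> carrier (free_algebra n). s + p = 0" if "p \<in> carrier (free_algebra n)"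
    by (rule bexI[of _ "- p"]) (simp_all add: free_carrier_simps that)
qed (fact free_carrier_simps)+

lemma ring_hom_scal:
  "scal 0 = 0" "scal 1 = 1" "scal (a + b) = scal a + scal b" "scal (a * b) = scal a * scal b"
  by (simp_all add: scal_def mult_single single_add plus_list_def)
    (simp flip: zero_list_def)

lemma scal_central:
  fixes p :: "'k::field free_alg"
  shows "scal c * p = p * scal c"
proof (induction p rule: update_induct)
  case const
  show ?case by simp
next
  case (update f a b)
  have "Poly_Mapping.update a b f = f + Poly_Mapping.single a b"
    using update(1) by (intro poly_mapping_eqI)
      (auto simp: lookup_update lookup_add lookup_single when_def in_keys_iff)
  then show ?case using update
    by (simp add: scal_def mult_single distrib_left distrib_right plus_list_def mult.commute)
qed

lemma scal_carrier: "scal c \<in> carrier (free_algebra n)"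
  by (simp add: scal_def free_algebra_def)

lemma gen_mat_carrier: "elements_mat (gen_mat n) \<subseteq> carrier (free_algebra n)"
  by (auto simp: gen_mat_def free_algebra_def elements_mat_def)

text \<open>The relations lie in the free algebra on the \<open>n^2\<close> generators (otherwise the generated ideal
  would be an intersection over the empty family).\<close>

definition free_mat :: "nat \<Rightarrow> nat \<Rightarrow> 'k::field free_alg mat \<Rightarrow> bool" where
  "free_mat n d X \<longleftrightarrow> X \<in> carrier_mat d d \<and>
     (\<forall>i<d. \<forall>j<d. X $$ (i, j) \<in> carrier (free_algebra n))"

lemma free_mat_mult:
  assumes "free_mat n d X" "free_mat n d Y"
  shows "free_mat n d (X * Y)"
  unfolding free_mat_def
proof (intro conjI allI impI)
  have X: "X \<in> carrier_mat d d" and Y: "Y \<in> carrier_mat d d"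
    using assms unfolding free_mat_def by blast+
  then show "X * Y \<in> carrier_mat d d" by (rule mult_carrier_mat)
  fix i j assume ij: "i < d" "j < d"
  have "(\<Sum>l\<in>{..<m}. X $$ (i, l) * Y $$ (l, j)) \<in> carrier (free_algebra n)" if "m \<le> d" for m
    using that
  proof (induction m)
    case 0
    show ?case by (simp add: free_carrier_simps)
  next
    case (Suc m)
    have "X $$ (i, m) * Y $$ (m, j) \<in> carrier (free_algebra n)"
      using assms ij Suc.prems unfolding free_mat_def by (intro free_carrier_simps(4)) simp_all
    then show ?case using Suc by (simp add: free_carrier_simps(3))
  qed
  from this[of d] show "(X * Y) $$ (i, j) \<in> carrier (free_algebra n)"
    using X Y ij by (simp add: scalar_prod_def lessThan_atLeast0)
qed

lemma free_mat_minus: "free_mat n d X \<Longrightarrow> free_mat n d Y \<Longrightarrow> free_mat n d (X - Y)"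
  by (auto simp: free_mat_def free_carrier_simps)

lemma free_mat_elements: "free_mat n d X \<Longrightarrow> elements_mat X \<subseteq> carrier (free_algebra n)"
  by (auto simp: free_mat_def elements_mat_def)

lemma free_mat_lift: "X \<in> carrier_mat d d \<Longrightarrow> free_mat n d (lift_op X)"
  by (auto simp: free_mat_def scal_carrier)

lemma free_mat_one: "free_mat n d (1\<^sub>m d)"
  by (auto simp: free_mat_def free_carrier_simps)

lemma free_mat_kron:
  assumes "free_mat n d X" "free_mat n e Y"
  shows "free_mat n (d * e) (kron X Y)"
proof -
  have *: "i div e < d" "i mod e < e" if "i < d * e" for i
  proof -
    have "e > 0" using that by (cases e) auto
    then show "i div e < d" "i mod e < e" using that by (simp_all add: less_mult_imp_div_less)
  qed
  have d: "dim_row X = d" "dim_col X = d" "dim_row Y = e" "dim_col Y = e"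
    using assms by (auto simp: free_mat_def)
  have "X $$ (i div e, j div e) * Y $$ (i mod e, j mod e) \<in> carrier (free_algebra n)"
    if "i < d * e" "j < d * e" for i j
    using assms *[OF that(1)] *[OF that(2)] unfolding free_mat_def
    by (intro free_carrier_simps(4)) blast+
  then show ?thesis
    unfolding free_mat_def kron_def d by simp
qed

lemma carrier_mat_mat_inv:
  fixes F :: "'k::field mat"
  assumes F: "F \<in> carrier_mat d d" and "invertible_mat F"
  shows "mat_inv F \<in> carrier_mat d d" "inverts_mat F (mat_inv F)" "inverts_mat (mat_inv F) F"
proof -
  have car: "B \<in> carrier_mat d d" if B: "inverts_mat F B" "inverts_mat B F" for B
  proof (rule carrier_matI)
    have "dim_col (F * B) = dim_row F" "dim_col (B * F) = dim_row B"
      by (simp_all only: B[unfolded inverts_mat_def] index_one_mat)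
    then show "dim_row B = d" "dim_col B = d" using F by simp_all
  qed
  obtain B where B: "inverts_mat F B" "inverts_mat B F"
    using assms(2) unfolding invertible_mat_def by blast
  have "C = B" if C: "inverts_mat F C \<and> inverts_mat C F" for C
  proof -
    have cc: "C \<in> carrier_mat d d" "B \<in> carrier_mat d d" using car C B by blast+
    have *: "F * B = 1\<^sub>m d" "C * F = 1\<^sub>m d"
      using B(1) C carrier_matD(1)[OF F] carrier_matD(1)[OF cc(1)] by (simp_all only: inverts_mat_def)
    have "C = C * (F * B)" unfolding * using cc by (simp only: right_mult_one_mat)
    also have "\<dots> = (C * F) * B" by (rule assoc_mult_mat[OF cc(1) F cc(2), symmetric])
    also have "\<dots> = B" unfolding * using cc by (simp only: left_mult_one_mat)
    finally show ?thesis .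
  qed
  then have "mat_inv F = B"
    unfolding mat_inv_def using B by (intro the_equality conjI)
  then show "inverts_mat F (mat_inv F)" "inverts_mat (mat_inv F) F" "mat_inv F \<in> carrier_mat d d"
    using B car[OF B] by (simp_all only:)
qed

lemma qm_relations_carrier:
  assumes R: "R \<in> carrier_mat (n ^ 2) (n ^ 2)"
    and F: "F \<in> carrier_mat (n ^ 2) (n ^ 2)" "invertible_mat F"
  shows "qm_relations n R F \<subseteq> carrier (free_algebra n)"
proof -
  have G: "mat_inv F \<in> carrier_mat (n ^ 2) (n ^ 2)" by (rule carrier_mat_mat_inv[OF F])
  have "free_mat n n (gen_mat n :: 'a free_alg mat)"
    by (auto simp: free_mat_def gen_mat_def free_algebra_def)
  then have "free_mat n (n ^ 2) (M_bar n F 2 1)"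
    using free_mat_kron[OF free_mat_kron[OF free_mat_one[of n 1]] free_mat_one[of n n]]
    by (simp add: act_def power2_eq_square)
  moreover have act: "act n 2 1 2 Y \<in> carrier_mat (n ^ 2) (n ^ 2)"
    if "Y \<in> carrier_mat (n ^ 2) (n ^ 2)" for Y :: "'a mat"
    using that by (auto simp: act_def kron_def)
  ultimately have M: "free_mat n (n ^ 2) (M_bar n F 2 1)" "free_mat n (n ^ 2) (M_bar n F 2 2)"
    using F G by (simp_all add: numeral_2_eq_2 free_mat_mult free_mat_lift)
  have "twist F (twist F R) \<in> carrier_mat (n ^ 2) (n ^ 2)"
    using R F G unfolding twist_def by (intro mult_carrier_mat)
  then have "free_mat n (n ^ 2) (lift_op R * M_bar n F 2 1 * M_bar n F 2 2
      - M_bar n F 2 1 * M_bar n F 2 2 * lift_op (twist F (twist F R)))"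
    using M R by (intro free_mat_minus free_mat_mult free_mat_lift)
  then show ?thesis
    unfolding qm_relations_def by (rule free_mat_elements)
qed

lemma qm_class_ring_hom:
  assumes "yang_baxter n R" "yang_baxter n F"
  shows "ideal (qm_ideal n R F) (free_algebra n)" "ring (qm_algebra n R F)"
    "qm_class n R F \<in> ring_hom (free_algebra n) (qm_algebra n R F)"
    "qm_class n R F ` carrier (free_algebra n) = carrier (qm_algebra n R F)"
proof -
  interpret ring "free_algebra n :: 'a free_alg ring" by (rule ring_free_algebra)
  show I: "ideal (qm_ideal n R F) (free_algebra n)"
    unfolding qm_ideal_def
    by (rule genideal_ideal, rule qm_relations_carrier) (use assms in \<open>auto simp: yang_baxter_def\<close>)
  then interpret I: ideal "qm_ideal n R F" "free_algebra n" .
  have "qm_class n R F = (+>\<^bsub>free_algebra n\<^esub>) (qm_ideal n R F)" by (simp add: qm_class_def fun_eq_iff)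
  then show "qm_class n R F \<in> ring_hom (free_algebra n) (qm_algebra n R F)"
    using I.rcos_ring_hom by (simp add: qm_algebra_def)
  show "ring (qm_algebra n R F)" unfolding qm_algebra_def by (rule I.quotient_is_ring)
  show "qm_class n R F ` carrier (free_algebra n) = carrier (qm_algebra n R F)"
    unfolding qm_class_def[abs_def] qm_algebra_def FactRing_def A_RCOSETS_def' by auto
qed

end

(* Quantum traces over copies 2, ..., k define a functional phi on the algebra generated by the R_i,
   phi(Y) = Tr_{F(2..k)} (Y M_1 ... M_k) with overlined M's. Two facts drive the proof.

   (1) The relations give R_i M_1 ... M_k = M_1 ... M_k R^FF_i, while D_i D_{i+1} R_i = R^FF_i D_i D_{i+1};
   hence phi(Y R_i) = phi(R_i Y) for 2 <= i < k.

   (2) Tr_{F(2)} (F X_1 F^-1) = Tr_F(X) I, so a quantum trace can be moved along the chain of copies and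
   phi(R_1 ... R_{k-j-1} A_j) = M^(k-j) sigma_j =: t_j when A_j acts in the last j copies.

   Put u_j = phi(R_1 ... R_{k-j} A_j), again with A_j in the last j copies. Writing
   (j+1)_q A_{j+1} = A_j (q^j - j_q R_{k-j}) A_j with A_{j+1} extending A_j to the left, (1) and the
   idempotence of A_j give (j+1)_q u_{j+1} = q^j t_j - j_q u_j, and this recursion is solved by the
   asserted sum. Both (1) and (2) need the skew invertibility of F, which is what the uniqueness
   of D(F) amounts to. *)
theory Submission
  imports Defs
begin

section \<open>Antisymmetrizers in a Hecke algebra\<close>

text \<open>The entries of M do not commute, so a trace is cyclic only for numerical operators on
  the traced copies. The operator R_i therefore makes a round trip: behind M_1 ... M_k it stands as
  its double twist, which is cycled to the front and becomes R_i again on crossing the D's. The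
  obstacle is this last crossing, and likewise (2): both are identities for D, and D is known only
  as the unique solution of a linear equation. Uniqueness says exactly that X -> Tr_2(F X_2) is
  injective on operators. No inverse of this map is constructed; instead an injective contraction
  with copies of F is applied to both sides of the wanted identity, and the braid relation together
  with Tr_2(F D_2) = I evaluates the result.

  Only the passage of R_i through the M's uses the relations. The formula for t_j already holds in
  the free algebra, so that the ideal enters the recursion through cyclicity alone. The sigma_j
  stand on the right because their copies of M come last in the product.\<close>

locale scaled_ring =
  fixes sc :: "'k::field \<Rightarrow> 'a::ring_1 \<Rightarrow> 'a" (infixr "\<odot>" 75)
  assumes sc_add: "c \<odot> (x + y) = c \<odot> x + c \<odot> y"
    and sc_add_left: "(c + d) \<odot> x = c \<odot> x + d \<odot> x"
    and sc_sc: "c \<odot> d \<odot> x = (c * d) \<odot> x"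
    and sc_one: "1 \<odot> x = x"
    and sc_mult_left: "(c \<odot> x) * y = c \<odot> (x * y)"
    and sc_mult_right: "x * (c \<odot> y) = c \<odot> (x * y)"
begin

lemma sc_zero: "0 \<odot> x = 0" "c \<odot> 0 = 0"
  using sc_add_left[of 0 0 x] sc_add[of c 0 0] by simp_all

lemma sc_minus: "c \<odot> (- x) = - (c \<odot> x)" "(- c) \<odot> x = - (c \<odot> x)"
  using sc_add[of c x "- x"] sc_add_left[of c "- c" x]
  by (simp_all add: sc_zero eq_neg_iff_add_eq_0 add.commute)

lemma sc_diff: "c \<odot> (x - y) = c \<odot> x - c \<odot> y" "(c - d) \<odot> x = c \<odot> x - d \<odot> x"
  using sc_add[of c x "- y"] sc_add_left[of c "- d" x] by (simp_all add: sc_minus)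

lemmas sc_simps = sc_add sc_sc sc_mult_left sc_mult_right sc_minus sc_diff(1) sc_zero sc_one

lemma sc_cancel: "c \<odot> x = c \<odot> y \<Longrightarrow> c \<noteq> 0 \<Longrightarrow> x = y"
  by (metis left_inverse sc_one sc_sc)

text \<open>The antisymmetrizer of m copies in abstract generators \<open>r 1\<close>, ...,
  \<open>r (m - 1)\<close>. The recursion starts one step early, at 0: since 0_q = 0, the generator
  \<open>r 0\<close> enters with coefficient zero, and the value at 1 is 1 as soon as 1_q =
  1.\<close>

primrec asym :: "'k \<Rightarrow> (nat \<Rightarrow> 'a) \<Rightarrow> nat \<Rightarrow> 'a" where
  "asym q r 0 = 1"
| "asym q r (Suc m) =
     (1 / qnum q (Suc m)) \<odot> (asym q r m * (q ^ m \<odot> 1 - qnum q m \<odot> r m) * asym q r m)"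

lemma asym_cong: "(\<And>i. 1 \<le> i \<Longrightarrow> i < m \<Longrightarrow> r i = r' i) \<Longrightarrow> asym q r m = asym q r' m"
proof (induction m)
  case (Suc m)
  have "qnum q m \<odot> r m = qnum q m \<odot> r' m"
    using Suc.prems[of m] by (cases "m = 0") (simp_all add: qnum_def sc_zero)
  then show ?case using Suc by simp
qed simp

text \<open>An antisymmetrizer is a noncommutative polynomial in its generators, so u crosses it
  once u crosses each of them. With r' = r this yields commutation; with r' a shift of r it moves
  the antisymmetrizer to other copies.\<close>

lemma asym_intertwine:
  assumes "\<And>i. 1 \<le> i \<Longrightarrow> i < m \<Longrightarrow> u * r i = r' i * u"
  shows "u * asym q r m = asym q r' m * u"
  using assms
proof (induction m)
  case (Suc m)
  then have IH: "u * asym q r m = asym q r' m * u" by simp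
  have m: "u * (q ^ m \<odot> 1 - qnum q m \<odot> r m) = (q ^ m \<odot> 1 - qnum q m \<odot> r' m) * u"
    using Suc.prems[of m]
    by (cases "m = 0") (simp_all add: qnum_def sc_simps right_diff_distrib left_diff_distrib)
  have "u * (asym q r m * (q ^ m \<odot> 1 - qnum q m \<odot> r m) * asym q r m)
      = (u * asym q r m) * (q ^ m \<odot> 1 - qnum q m \<odot> r m) * asym q r m"
    by (simp only: mult.assoc)
  also have "\<dots> = asym q r' m * (u * (q ^ m \<odot> 1 - qnum q m \<odot> r m)) * asym q r m"
    by (simp only: IH mult.assoc)
  also have "\<dots> = asym q r' m * (q ^ m \<odot> 1 - qnum q m \<odot> r' m) * (u * asym q r m)"
    by (simp only: m mult.assoc)
  also have "\<dots> = (asym q r' m * (q ^ m \<odot> 1 - qnum q m \<odot> r' m) * asym q r' m) * u"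
    by (simp only: IH mult.assoc)
  finally show ?case by (simp add: sc_mult_left sc_mult_right)
qed simp

end

section \<open>The antisymmetrizers as sign projectors of the Hecke algebra\<close>

locale hecke_scalars = scaled_ring sc for sc :: "'k::field \<Rightarrow> 'a::ring_1 \<Rightarrow> 'a" (infixr "\<odot>" 75) +
  fixes q :: 'k
  assumes q0: "q \<noteq> 0" and q_root: "m > 0 \<Longrightarrow> q ^ m \<noteq> 1"
begin

lemma q_diff: "q - inverse q \<noteq> 0"
  using q_root[of 2] q0 by (metis power2_eq_square right_inverse zero_less_numeral eq_iff_diff_eq_0)

lemma qnum_nz: "m > 0 \<Longrightarrow> qnum q m \<noteq> 0"
proof
  assume m: "m > 0" and "qnum q m = 0"
  then have "q ^ m = inverse q ^ m" using q_diff by (auto simp: qnum_def)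
  then have "q ^ (2 * m) = 1" using q0 by (simp add: field_simps power_add mult_2_right)
  then show False using q_root[of "2 * m"] m by auto
qed

lemma qnum_1: "qnum q (Suc 0) = 1"
  using q_diff by (simp add: qnum_def)

text \<open>The right-hand side is the value of q^m - m_q r where r acts as -1/q, so on such
  elements the factor of the recursion is cancelled by its normalization.\<close>

lemma qnum_Suc: "qnum q (Suc m) = q ^ m + inverse q * qnum q m"
proof -
  define d where "d = q - inverse q"
  have d: "d \<noteq> 0" "qnum q k * d = q ^ k - inverse q ^ k" for k
    using q_diff by (simp_all add: qnum_def d_def)
  have "(q ^ m + inverse q * qnum q m) * d = q ^ m * d + inverse q * (qnum q m * d)"
    by (simp add: algebra_simps)
  also have "\<dots> = qnum q (Suc m) * d"
    unfolding d(2) using q0 by (simp add: d_def algebra_simps)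
  finally show ?thesis using d(1) by simp
qed

text \<open>K counts strands: these are the relations of the Hecke algebra H_K, whose generators are
  numbered 1, ..., K - 1, with the quadratic relation solved for the square.\<close>

definition hecke_gens :: "(nat \<Rightarrow> 'a) \<Rightarrow> nat \<Rightarrow> bool" where
  "hecke_gens r K \<longleftrightarrow>
     (\<forall>i. 1 \<le> i \<and> i < K \<longrightarrow> r i * r i = (q - inverse q) \<odot> r i + 1) \<and>
     (\<forall>i. 1 \<le> i \<and> Suc i < K \<longrightarrow> r i * r (Suc i) * r i = r (Suc i) * r i * r (Suc i)) \<and>
     (\<forall>i j. 1 \<le> i \<and> Suc i < j \<and> j < K \<longrightarrow> r i * r j = r j * r i)"

text \<open>The Yang--Baxter equation for the baxterized generators \<open>q^a - a_q r\<close>, with spectral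
  parameters \<open>1\<close>, \<open>m + 1\<close>, \<open>m\<close>.\<close>

lemma baxterized:
  assumes x: "x * x = (q - inverse q) \<odot> x + 1" and y: "y * y = (q - inverse q) \<odot> y + 1"
    and br: "x * y * x = y * x * y"
  shows "(q \<odot> 1 - y) * (q ^ Suc m \<odot> 1 - qnum q (Suc m) \<odot> x) * (q ^ m \<odot> 1 - qnum q m \<odot> y)
    = (q ^ m \<odot> 1 - qnum q m \<odot> x) * (q ^ Suc m \<odot> 1 - qnum q (Suc m) \<odot> y) * (q \<odot> 1 - x)"
proof -
  define z where "z = q - inverse q"
  define a \<alpha> Q P where "a = q ^ m" and "\<alpha> = qnum q m" and "Q = q ^ Suc m" and "P = qnum q (Suc m)"
  have L: "(q \<odot> 1 - y) * (Q \<odot> 1 - P \<odot> x) * (a \<odot> 1 - \<alpha> \<odot> y)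
     = (q*Q*a) \<odot> 1 - (q*Q*\<alpha>) \<odot> y - (q*P*a) \<odot> x + (q*P*\<alpha>) \<odot> (x*y) - (Q*a) \<odot> y + (Q*\<alpha>) \<odot> (y*y)
       + (P*a) \<odot> (y*x) - (P*\<alpha>) \<odot> (y*x*y)"
    by (simp add: sc_simps algebra_simps)
  have R: "(a \<odot> 1 - \<alpha> \<odot> x) * (Q \<odot> 1 - P \<odot> y) * (q \<odot> 1 - x)
     = (q*Q*a) \<odot> 1 - (q*Q*\<alpha>) \<odot> x - (q*P*a) \<odot> y + (q*P*\<alpha>) \<odot> (x*y) - (Q*a) \<odot> x + (Q*\<alpha>) \<odot> (x*x)
       + (P*a) \<odot> (y*x) - (P*\<alpha>) \<odot> (x*y*x)"
    by (simp add: sc_simps algebra_simps)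
  \<comment> \<open>Once the squares are reduced, the constant, quadratic and cubic terms of the two
    sides agree. What is left is a multiple of \<open>x - y\<close>, and this identity says that its
    coefficient vanishes.\<close>
  have c: "q*Q*\<alpha> + Q*a = q*P*a + Q*\<alpha>*z"
    using q0 by (simp add: z_def Q_def P_def a_def \<alpha>_def qnum_Suc field_simps)
  have "(q*Q*\<alpha>) \<odot> v + (Q*a) \<odot> v = (q*P*a) \<odot> v + (Q*\<alpha>*z) \<odot> v" for v
    by (simp only: c flip: sc_add_left)
  from this[of x] this[of y] have "(q*Q*\<alpha>) \<odot> x + (Q*a) \<odot> x + (q*P*a) \<odot> y + (Q*\<alpha>*z) \<odot> y
     = (q*Q*\<alpha>) \<odot> y + (Q*a) \<odot> y + (q*P*a) \<odot> x + (Q*\<alpha>*z) \<odot> x" by (simp add: algebra_simps)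
  then show ?thesis
    unfolding L[unfolded a_def \<alpha>_def Q_def P_def] R[unfolded a_def \<alpha>_def Q_def P_def]
      x y br
    unfolding z_def[symmetric] a_def[symmetric] \<alpha>_def[symmetric] Q_def[symmetric] P_def[symmetric]
    by (simp add: sc_simps algebra_simps)
qed

lemma hecke_gens_mono: "hecke_gens r K \<Longrightarrow> K' \<le> K \<Longrightarrow> hecke_gens r K'"
  unfolding hecke_gens_def by (meson less_le_trans)

lemma factor_sign:
  "(q ^ m \<odot> 1 - qnum q m \<odot> r) * x = qnum q (Suc m) \<odot> x" if "r * x = - inverse q \<odot> x"
  using that by (simp add: left_diff_distrib sc_mult_left sc_sc sc_minus qnum_Suc sc_add_left
      mult.commute)

lemma factor_sign':
  "x * (q ^ m \<odot> 1 - qnum q m \<odot> r) = qnum q (Suc m) \<odot> x" if "x * r = - inverse q \<odot> x"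
  using that by (simp add: right_diff_distrib sc_mult_right sc_sc sc_minus qnum_Suc sc_add_left
      mult.commute)

text \<open>On x each factor q^m - m_q r_m is the scalar (m+1)_q, which the prefactor 1 / (m+1)_q
  cancels.\<close>

lemma asym_absorb:
  assumes "\<And>i. 1 \<le> i \<Longrightarrow> i < m \<Longrightarrow> r i * x = - inverse q \<odot> x"
  shows "asym q r m * x = x"
  using assms
proof (induction m)
  case (Suc m)
  have IH: "asym q r m * x = x" using Suc by simp
  have "(q ^ m \<odot> 1 - qnum q m \<odot> r m) * x = qnum q (Suc m) \<odot> x"
  \<comment> \<open>The assumption says nothing about \<open>r 0\<close>, but its coefficient is 0_q
    = 0.\<close>
  proof (cases "m = 0")
    case True
    then show ?thesis by (simp add: qnum_1) (simp add: qnum_def sc_simps)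
  qed (use Suc.prems in \<open>simp add: factor_sign\<close>)
  then have "asym q r m * (q ^ m \<odot> 1 - qnum q m \<odot> r m) * asym q r m * x = qnum q (Suc m) \<odot> x"
    by (simp only: mult.assoc IH sc_mult_right)
  then show ?case using qnum_nz[of "Suc m"] by (simp add: sc_mult_left sc_sc sc_one)
qed simp

lemma asym_absorb':
  assumes "\<And>i. 1 \<le> i \<Longrightarrow> i < m \<Longrightarrow> x * r i = - inverse q \<odot> x"
  shows "x * asym q r m = x"
  using assms
proof (induction m)
  case (Suc m)
  have IH: "x * asym q r m = x" using Suc by simp
  have "x * (q ^ m \<odot> 1 - qnum q m \<odot> r m) = qnum q (Suc m) \<odot> x"
  proof (cases "m = 0")
    case True
    then show ?thesis by (simp add: qnum_1) (simp add: qnum_def sc_simps)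
  qed (use Suc.prems in \<open>simp add: factor_sign'\<close>)
  then have "x * (asym q r m * (q ^ m \<odot> 1 - qnum q m \<odot> r m) * asym q r m) = qnum q (Suc m) \<odot> x"
    by (simp only: mult.assoc[symmetric] IH sc_mult_left)
  then show ?case using qnum_nz[of "Suc m"] by (simp add: sc_mult_right sc_sc sc_one)
qed simp

lemma hecke_factor: "r * r = (q - inverse q) \<odot> r + 1 \<Longrightarrow> (r + inverse q \<odot> 1) * (q \<odot> 1 - r) = 0"
  "r * r = (q - inverse q) \<odot> r + 1 \<Longrightarrow> (q \<odot> 1 - r) * (r + inverse q \<odot> 1) = 0"
  using q0 by (simp_all add: distrib_left distrib_right left_diff_distrib right_diff_distrib
      sc_simps sc_diff sc_add_left)

text \<open>The generators already present in the shorter antisymmetrizer act at its outer ends; the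
  new case is the last generator. On the shorter antisymmetrizer the previous generator r_p makes q
  - r_p the nonzero scalar q + 1/q, so this factor may be inserted for free. The Yang-Baxter
  equation turns it into a factor q - r_m next to r_m + 1/q, and their product is zero by the Hecke
  relation.\<close>

lemma asym_sign:
  assumes "hecke_gens r m" "1 \<le> i" "i < m"
  shows "r i * asym q r m = - inverse q \<odot> asym q r m \<and> asym q r m * r i = - inverse q \<odot> asym q r m"
  using assms
proof (induction m arbitrary: i)
  case (Suc m)
  let ?A = "asym q r" and ?f = "\<lambda>m i. q ^ m \<odot> 1 - qnum q m \<odot> r i"
  have gens: "hecke_gens r m" using Suc.prems(1) by (rule hecke_gens_mono) simp
  note IH = Suc.IH[OF gens]
  show ?case
  proof (cases "i < m")
    case True
    then have *: "r i * ?A m = - inverse q \<odot> ?A m" "?A m * r i = - inverse q \<odot> ?A m"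
      using IH Suc.prems by auto
    have "r i * (?A m * ?f m m * ?A m) = - inverse q \<odot> (?A m * ?f m m * ?A m)"
      by (simp only: mult.assoc[symmetric] * sc_mult_left)
    moreover have "?A m * ?f m m * ?A m * r i = - inverse q \<odot> (?A m * ?f m m * ?A m)"
      by (simp only: mult.assoc * sc_mult_right)
    ultimately show ?thesis by (simp add: sc_simps mult.commute)
  next
    case False
    then have im: "i = m" "1 \<le> m" using Suc.prems by auto
    have hm: "r m * r m = (q - inverse q) \<odot> r m + 1"
      using Suc.prems(1) im unfolding hecke_gens_def by auto
    have "(r m + inverse q \<odot> 1) * (?A m * ?f m m * ?A m) = 0 \<and>
      (?A m * ?f m m * ?A m) * (r m + inverse q \<odot> 1) = 0"
    \<comment> \<open>For m = 1 there is no previous generator: the product in question is q - r_1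
      itself.\<close>
    proof (cases "m = 1")
      case True
      have A1: "?A 1 = 1" using qnum_1 by (simp add: qnum_def sc_simps)
      show ?thesis unfolding True A1 using hecke_factor[OF hm] True qnum_1 by (simp add: sc_one)
    next
      case False
      then obtain p where p: "m = Suc p" "1 \<le> p" using im by (cases m) auto
      have hp: "r p * r p = (q - inverse q) \<odot> r p + 1"
        and br: "r m * r p * r m = r p * r m * r p"
        using Suc.prems(1) im p unfolding hecke_gens_def by auto
      have comm: "r m * ?A p = ?A p * r m"
      proof (rule asym_intertwine)
        fix i assume "1 \<le> i" "i < p"
        then show "r m * r i = r i * r m"
          using Suc.prems(1) p unfolding hecke_gens_def by (metis Suc_less_eq lessI)
      qed
      have Apm: "?A p * ?A m = ?A m" "?A m * ?A p = ?A m"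
        by (rule asym_absorb asym_absorb'; use IH p in simp)+
      have fcomm: "?f m m * ?A p = ?A p * ?f m m"
        by (simp add: comm left_diff_distrib right_diff_distrib sc_mult_left sc_mult_right)
      have gcomm: "(r m + inverse q \<odot> 1) * ?A p = ?A p * (r m + inverse q \<odot> 1)"
        by (simp add: comm distrib_left distrib_right sc_mult_left sc_mult_right)
      have Am: "qnum q m \<odot> ?A m = ?A p * ?f p p * ?A p"
        using qnum_nz[of m] p by (simp add: sc_sc sc_one)
      have q2: "q + inverse q \<noteq> 0"
      proof
        assume "q + inverse q = 0"
        then have "q * q = -1" using q0 by (simp add: field_simps eq_neg_iff_add_eq_0)
        then have "q ^ 4 = 1" by (simp add: power4_eq_xxxx)
        then show False using q_root[of 4] by simp
      qed
      have qA: "(q \<odot> 1 - r p) * ?A m = (q + inverse q) \<odot> ?A m"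
        "?A m * (q \<odot> 1 - r p) = (q + inverse q) \<odot> ?A m"
        using IH[of p] p(2) unfolding left_diff_distrib right_diff_distrib sc_mult_left sc_mult_right
        by (simp_all add: p(1) sc_minus sc_add_left del: asym.simps)
      \<comment> \<open>Both are the baxterized equation with spectral parameters 1, m, p, where m =
        p + 1; the two generators exchange their roles.\<close>
      have bax: "(q \<odot> 1 - r m) * ?f m p * ?f p m = ?f p p * ?f m m * (q \<odot> 1 - r p)"
        "(q \<odot> 1 - r p) * ?f m m * ?f p p = ?f p m * ?f m p * (q \<odot> 1 - r m)"
        unfolding p(1) using baxterized[of "r p" "r m" p] baxterized[of "r m" "r p" p] hp hm br p(1)
        by simp_all
      have Z1: "(r m + inverse q \<odot> 1) * ?f p p * ?f m m * ?A m = 0"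
      proof -
        have "(q + inverse q) \<odot> ((r m + inverse q \<odot> 1) * ?f p p * ?f m m * ?A m)
           = (r m + inverse q \<odot> 1) * (?f p p * ?f m m * (q \<odot> 1 - r p)) * ?A m"
          by (simp only: mult.assoc qA sc_mult_right)
        also have "\<dots> = 0"
          unfolding bax(1)[symmetric] by (simp only: mult.assoc[symmetric] hecke_factor[OF hm] mult_zero_left)
        finally show ?thesis using q2 by (metis sc_cancel sc_zero(2))
      qed
      have Z2: "?A m * (?f m m * (?f p p * (r m + inverse q \<odot> 1))) = 0"
      proof -
        have "(q + inverse q) \<odot> (?A m * (?f m m * (?f p p * (r m + inverse q \<odot> 1))))
           = ?A m * ((q \<odot> 1 - r p) * ?f m m * ?f p p) * (r m + inverse q \<odot> 1)"
          by (simp only: mult.assoc[symmetric] qA sc_mult_left)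
        also have "\<dots> = 0"
          unfolding bax(2) by (simp only: mult.assoc hecke_factor[OF hm] mult_zero_right)
        finally show ?thesis using q2 by (metis sc_cancel sc_zero(2))
      qed
      have "qnum q m \<odot> ((r m + inverse q \<odot> 1) * (?A m * ?f m m * ?A m))
        = (r m + inverse q \<odot> 1) * ((?A p * ?f p p * ?A p) * ?f m m * ?A m)"
        by (simp only: Am[symmetric] sc_mult_left sc_mult_right)
      also have "\<dots> = ((r m + inverse q \<odot> 1) * ?A p) * ?f p p * (?A p * ?f m m) * ?A m"
        by (simp only: mult.assoc)
      also have "\<dots> = ?A p * ((r m + inverse q \<odot> 1) * ?f p p * ?f m m * (?A p * ?A m))"
        unfolding fcomm[symmetric] gcomm by (simp only: mult.assoc)
      also have "\<dots> = 0" unfolding Apm Z1 by simp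
      finally have L: "(r m + inverse q \<odot> 1) * (?A m * ?f m m * ?A m) = 0"
        using qnum_nz[of m] im by (metis sc_cancel sc_zero(2) less_eq_Suc_le One_nat_def)
      have "qnum q m \<odot> ((?A m * ?f m m * ?A m) * (r m + inverse q \<odot> 1))
        = (?A m * ?f m m * (?A p * ?f p p * ?A p)) * (r m + inverse q \<odot> 1)"
        by (simp only: Am[symmetric] sc_mult_left sc_mult_right)
      also have "\<dots> = ?A m * (?f m m * ?A p) * ?f p p * (?A p * (r m + inverse q \<odot> 1))"
        by (simp only: mult.assoc)
      also have "\<dots> = (?A m * ?A p) * (?f m m * (?f p p * (r m + inverse q \<odot> 1))) * ?A p"
        unfolding fcomm gcomm[symmetric] by (simp only: mult.assoc)
      also have "\<dots> = 0" unfolding Apm Z2 by simp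
      finally have R: "(?A m * ?f m m * ?A m) * (r m + inverse q \<odot> 1) = 0"
        using qnum_nz[of m] im by (metis sc_cancel sc_zero(2) less_eq_Suc_le One_nat_def)
      show ?thesis using L R by simp
    qed
    then have "r m * (?A m * ?f m m * ?A m) = - inverse q \<odot> (?A m * ?f m m * ?A m)"
      "(?A m * ?f m m * ?A m) * r m = - inverse q \<odot> (?A m * ?f m m * ?A m)"
      unfolding distrib_left distrib_right
      by (simp_all add: sc_mult_left sc_mult_right sc_minus eq_neg_iff_add_eq_0)
    then show ?thesis unfolding im by (simp add: sc_simps mult.commute)
  qed
qed simp

lemma asym_idem: "hecke_gens r m \<Longrightarrow> asym q r m * asym q r m = asym q r m"
  using asym_absorb asym_sign by metis

lemma hecke_gens_reverse:
  assumes "hecke_gens r m"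
  shows "hecke_gens (\<lambda>i. r (m - i)) m"
  unfolding hecke_gens_def
proof (intro conjI allI impI)
  fix i assume i: "1 \<le> i \<and> Suc i < m"
  define p where "p = m - Suc i"
  have "m - i = Suc p" "1 \<le> p" "Suc p < m" using i by (auto simp: p_def)
  then show "r (m - i) * r (m - Suc i) * r (m - i) = r (m - Suc i) * r (m - i) * r (m - Suc i)"
    using assms unfolding p_def[symmetric] hecke_gens_def by auto
next
  fix i j assume "1 \<le> i \<and> Suc i < j \<and> j < m"
  then have "1 \<le> m - j" "Suc (m - j) < m - i" "m - i < m" by auto
  then show "r (m - i) * r (m - j) = r (m - j) * r (m - i)"
    using assms unfolding hecke_gens_def by metis
qed (use assms in \<open>auto simp: hecke_gens_def\<close>)

text \<open>Both elements satisfy the sign rule for all the generators, in whichever order these are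
  numbered. Hence each absorbs the other, and their product equals either of them.\<close>

lemma asym_reverse:
  assumes "hecke_gens r m"
  shows "asym q (\<lambda>i. r (m - i)) m = asym q r m"
proof -
  have r: "r i * asym q r m = - inverse q \<odot> asym q r m" if "1 \<le> i" "i < m" for i
    using asym_sign[OF assms] that by blast
  have "asym q (\<lambda>i. r (m - i)) m * r i = - inverse q \<odot> asym q (\<lambda>i. r (m - i)) m"
    if "1 \<le> i" "i < m" for i
    using asym_sign[OF hecke_gens_reverse[OF assms], of "m - i"] that by auto
  then show ?thesis
    using asym_absorb[of m "\<lambda>i. r (m - i)" "asym q r m"] asym_absorb'[of m "asym q (\<lambda>i. r (m - i)) m" r] r
    by simp
qed

text \<open>By the reversal symmetry the chain of generators may as well be extended at its lower end.\<close>

lemma asym_Suc_left: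
  assumes "hecke_gens r (Suc m)"
  shows "qnum q (Suc m) \<odot> asym q r (Suc m) =
    asym q (\<lambda>i. r (Suc i)) m * (q ^ m \<odot> 1 - qnum q m \<odot> r 1) * asym q (\<lambda>i. r (Suc i)) m"
proof -
  have h: "hecke_gens (\<lambda>i. r (Suc i)) m"
    using assms unfolding hecke_gens_def by (metis Suc_less_eq le_SucI)
  \<comment> \<open>Without its last generator the reversed chain consists of the shifted generators
    in reverse order, so the reversal symmetry applies a second time.\<close>
  have "asym q (\<lambda>i. r (Suc m - i)) m = asym q (\<lambda>i. r (Suc (m - i))) m"
    by (rule asym_cong) (simp add: Suc_diff_le)
  also have "\<dots> = asym q (\<lambda>i. r (Suc i)) m" using asym_reverse[OF h] .
  finally have "asym q (\<lambda>i. r (Suc m - i)) (Suc m) = (1 / qnum q (Suc m)) \<odot>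
      (asym q (\<lambda>i. r (Suc i)) m * (q ^ m \<odot> 1 - qnum q m \<odot> r 1) * asym q (\<lambda>i. r (Suc i)) m)"
    by simp
  then show ?thesis
    unfolding asym_reverse[OF assms] using qnum_nz[of "Suc m"]
    by (simp add: sc_sc sc_one del: asym.simps)
qed

end

section \<open>Chains of twisted copies\<close>

definition chain_prod :: "(nat \<Rightarrow> 'a::monoid_mult) \<Rightarrow> nat \<Rightarrow> nat \<Rightarrow> 'a" where
  "chain_prod f a b = prod_list (map f [a..<Suc b])"

lemma chain_prod_split: "a \<le> Suc c \<Longrightarrow> c \<le> b \<Longrightarrow> chain_prod f a b = chain_prod f a c * chain_prod f (Suc c) b"
proof -
  assume "a \<le> Suc c" "c \<le> b"
  then have "[a..<Suc b] = [a..<Suc c] @ [Suc c..<Suc b]"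
    by (metis Suc_le_mono le_Suc_ex upt_add_eq_append)
  then show ?thesis by (simp add: chain_prod_def)
qed

lemma chain_prod_empty: "b < a \<Longrightarrow> chain_prod f a b = 1"
  by (simp add: chain_prod_def)

lemma chain_prod_single: "chain_prod f a a = f a"
  by (simp add: chain_prod_def)

lemma chain_prod_Suc: "a \<le> Suc b \<Longrightarrow> chain_prod f a (Suc b) = chain_prod f a b * f (Suc b)"
  using chain_prod_split[of a b "Suc b" f] by (simp add: chain_prod_single)

lemma chain_prod_commute:
  assumes "\<And>i. a \<le> i \<Longrightarrow> i \<le> b \<Longrightarrow> x * f i = f i * x"
  shows "x * chain_prod f a b = chain_prod f a b * x"
proof (cases "a \<le> Suc b")
  case True
  then show ?thesis using assms
  proof (induction b)
    case 0
    then show ?case by (cases a) (auto simp: chain_prod_def)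
  next
    case (Suc b)
    show ?case
    proof (cases "a \<le> Suc b")
      case True
      have "x * chain_prod f a b = chain_prod f a b * x" using Suc True by simp
      moreover have "x * f (Suc b) = f (Suc b) * x" using Suc.prems True by simp
      ultimately show ?thesis by (simp add: chain_prod_Suc True) (metis mult.assoc)
    qed (simp add: chain_prod_empty)
  qed
qed (simp add: chain_prod_empty)

lemma chain_prod_intertwine:
  assumes "\<And>i. a \<le> i \<Longrightarrow> i \<le> b \<Longrightarrow> u * f i = g (Suc i) * u"
  shows "u * chain_prod f a b = chain_prod g (Suc a) (Suc b) * u"
proof (cases "a \<le> Suc b")
  case True
  then show ?thesis using assms
  proof (induction b)
    case 0
    then show ?case by (cases a) (auto simp: chain_prod_def)
  next
    case (Suc b)
    show ?case
    proof (cases "a \<le> Suc b")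
      case True
      have "u * chain_prod f a b = chain_prod g (Suc a) (Suc b) * u" using Suc True by simp
      moreover have "u * f (Suc b) = g (Suc (Suc b)) * u" using Suc.prems True by simp
      ultimately show ?thesis by (simp add: chain_prod_Suc True) (metis mult.assoc)
    qed (simp add: chain_prod_empty)
  qed
qed (simp add: chain_prod_empty)

text \<open>The pattern behind all moves through F on N copies: f is F_i, g its inverse, r any
  operator compatible with F, and \<open>\<mu>\<close> the chain of overlined matrices. It is kept
  abstract because r is taken to be F, R and the double twist of R, over the field as well as over
  the free algebra.\<close>

locale twist_chain =
  fixes f g r \<mu> :: "nat \<Rightarrow> 'a::monoid_mult" and N :: nat
  assumes fg: "1 \<le> i \<Longrightarrow> i < N \<Longrightarrow> f i * g i = 1" "1 \<le> i \<Longrightarrow> i < N \<Longrightarrow> g i * f i = 1"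
    and far: "1 \<le> i \<Longrightarrow> Suc i < j \<Longrightarrow> j < N \<Longrightarrow> r i * f j = f j * r i"
      "1 \<le> i \<Longrightarrow> Suc i < j \<Longrightarrow> j < N \<Longrightarrow> r j * f i = f i * r j"
    and near: "1 \<le> i \<Longrightarrow> Suc i < N \<Longrightarrow> r i * f (Suc i) * f i = f (Suc i) * f i * r (Suc i)"
      "1 \<le> i \<Longrightarrow> Suc i < N \<Longrightarrow> r (Suc i) * f i * f (Suc i) = f i * f (Suc i) * r i"
    and \<mu>_Suc: "1 \<le> i \<Longrightarrow> i < N \<Longrightarrow> \<mu> (Suc i) = f i * \<mu> i * g i"
    and \<mu>_1: "2 \<le> i \<Longrightarrow> i < N \<Longrightarrow> r i * \<mu> 1 = \<mu> 1 * r i"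
begin

lemma inverse_commute: "1 \<le> i \<Longrightarrow> i < N \<Longrightarrow> x * f i = f i * x \<Longrightarrow> x * g i = g i * x"
proof -
  assume i: "1 \<le> i" "i < N" and "x * f i = f i * x"
  then have "g i * (x * f i) * g i = g i * (f i * x) * g i" by simp
  then have "g i * x * (f i * g i) = (g i * f i) * x * g i" by (simp only: mult.assoc)
  then show ?thesis using fg[OF i] by simp
qed

lemma conj_commute:
  assumes "1 \<le> i" "i < N" "x * f i = f i * x" "x * y = y * x"
  shows "x * (f i * y * g i) = (f i * y * g i) * x"
proof -
  have "x * (f i * y * g i) = (x * f i) * y * g i" by (simp only: mult.assoc)
  also have "\<dots> = f i * (x * y) * g i" unfolding assms(3) by (simp only: mult.assoc)
  also have "\<dots> = f i * y * (x * g i)" unfolding assms(4) by (simp only: mult.assoc)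
  also have "\<dots> = (f i * y * g i) * x"
    unfolding inverse_commute[OF assms(1-3)] by (simp only: mult.assoc)
  finally show ?thesis .
qed

text \<open>\<open>\<mu> j\<close> is built from \<open>\<mu> 1\<close> by conjugation with f_1,
  ..., f_{j-1}, all of which are out of reach of r_i.\<close>

lemma r_\<mu>_above: "1 \<le> j \<Longrightarrow> j < i \<Longrightarrow> i < N \<Longrightarrow> r i * \<mu> j = \<mu> j * r i"
proof (induction j)
  case (Suc j)
  show ?case
  proof (cases "j = 0")
    case True
    then show ?thesis using \<mu>_1[of i] Suc.prems by simp
  next
    case False
    then have j: "1 \<le> j" "j < N" using Suc.prems by auto
    have "r i * f j = f j * r i" using Suc.prems j far by blast
    moreover have "r i * \<mu> j = \<mu> j * r i" using Suc j by auto
    ultimately show ?thesis unfolding \<mu>_Suc[OF j] using conj_commute j by blast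
  qed
qed simp

text \<open>This is not a matter of disjoint copies, since \<open>\<mu> j\<close> acts in all of the
  first j. The point is the case j = i + 2: crossing f_{i+1} f_i turns r_i into r_{i+1}, which
  commutes with \<open>\<mu> i\<close>, and crossing the inverses turns it back.\<close>

lemma r_\<mu>_below: "1 \<le> i \<Longrightarrow> Suc i < j \<Longrightarrow> j \<le> N \<Longrightarrow> r i * \<mu> j = \<mu> j * r i"
proof (induction j)
  case (Suc j)
  then have j: "1 \<le> j" "j < N" by auto
  note \<mu> = \<mu>_Suc[OF j]
  show ?case
  proof (cases "Suc i < j")
    case True
    have "r i * f j = f j * r i" using True Suc.prems j far by blast
    moreover have "r i * \<mu> j = \<mu> j * r i" using True Suc j by auto
    ultimately show ?thesis unfolding \<mu> using conj_commute j by blast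
  next
    case False
    then have ji: "j = Suc i" using Suc.prems by auto
    have i: "1 \<le> i" "i < N" "Suc i < N" using Suc.prems by auto
    have c: "r j * \<mu> i = \<mu> i * r j" using r_\<mu>_above[of i j] i ji by simp
    have n: "r i * f j * f i = f j * f i * r j" using near(1) i ji by simp
    have inv: "f j * f i * (g i * g j) = 1" "g i * g j * (f j * f i) = 1"
      using fg[OF i(1,2)] fg[OF j] mult.assoc[of "f j" "f i" "g i * g j"] mult.assoc[of "f i" "g i" "g j"]
        mult.assoc[of "g i" "g j" "f j * f i"] mult.assoc[of "g j" "f j" "f i"] by simp_all
    \<comment> \<open>The compatibility relation, multiplied on both sides by the inverse of
      \<open>f j * f i\<close>.\<close>
    have "g i * g j * r i = g i * g j * (r i * (f j * f i * (g i * g j)))"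
      by (simp only: inv mult_1_right)
    also have "\<dots> = g i * g j * (r i * f j * f i) * (g i * g j)" by (simp only: mult.assoc)
    also have "\<dots> = (g i * g j * (f j * f i)) * (r j * (g i * g j))" unfolding n by (simp only: mult.assoc)
    finally have gg: "g i * g j * r i = r j * (g i * g j)" unfolding inv by simp
    have "r i * \<mu> (Suc j) = (r i * f j * f i) * \<mu> i * (g i * g j)"
      unfolding \<mu> unfolding ji \<mu>_Suc[OF i(1,2)] by (simp only: mult.assoc)
    also have "\<dots> = f j * f i * (r j * \<mu> i) * (g i * g j)"
      unfolding n by (simp only: mult.assoc)
    also have "\<dots> = f j * f i * \<mu> i * (r j * (g i * g j))" by (simp only: c mult.assoc)
    also have "\<dots> = \<mu> (Suc j) * r i"
      unfolding gg[symmetric] \<mu> unfolding ji \<mu>_Suc[OF i(1,2)] by (simp only: mult.assoc)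
    finally show ?thesis .
  qed
qed simp

text \<open>Only the two factors f_l f_{l+1} see the operator and raise its index, by compatibility;
  the factors before and after them commute with it.\<close>

lemma r_shift:
  assumes "1 \<le> a" "a \<le> l" "l < b" "b < N"
  shows "chain_prod f a b * r l = r (Suc l) * chain_prod f a b"
proof -
  let ?P = "chain_prod f a (l - 1)" and ?Q = "chain_prod f (Suc (Suc l)) b"
  have "chain_prod f a b = ?P * chain_prod f l b"
    using chain_prod_split[of a "l - 1" b f] assms by simp
  also have "chain_prod f l b = f l * chain_prod f (Suc l) b"
    using chain_prod_split[of l l b f] assms by (simp add: chain_prod_single)
  also have "chain_prod f (Suc l) b = f (Suc l) * ?Q"
    using chain_prod_split[of "Suc l" "Suc l" b f] assms by (simp add: chain_prod_single)
  finally have U: "chain_prod f a b = ?P * (f l * (f (Suc l) * ?Q))" .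
  have P: "r (Suc l) * ?P = ?P * r (Suc l)"
    using assms by (intro chain_prod_commute far(2)) auto
  have Q: "r l * ?Q = ?Q * r l"
    using assms by (intro chain_prod_commute far(1)) auto
  have n: "r (Suc l) * f l * f (Suc l) = f l * f (Suc l) * r l" using near(2) assms by simp
  have "chain_prod f a b * r l = ?P * (f l * f (Suc l) * r l) * ?Q"
    unfolding U by (simp only: mult.assoc Q[symmetric])
  also have "\<dots> = (?P * r (Suc l)) * (f l * (f (Suc l) * ?Q))"
    unfolding n[symmetric] by (simp only: mult.assoc)
  also have "\<dots> = r (Suc l) * chain_prod f a b"
    unfolding U P[symmetric] by (simp only: mult.assoc)
  finally show ?thesis .
qed

end

text \<open>The case r = f: by the Yang-Baxter equation F is compatible with itself.\<close>

locale braided_chain = twist_chain f g f \<mu> N for f g \<mu> :: "nat \<Rightarrow> 'a::monoid_mult" and N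
begin

text \<open>The factor f_l raises the index by the definition of the chain. The factors after f_l
  commute with \<open>\<mu> l\<close> by \<open>r_\<mu>_above\<close>, those before it with
  \<open>\<mu> (Suc l)\<close> by \<open>r_\<mu>_below\<close>.\<close>

lemma \<mu>_shift:
  assumes "1 \<le> a" "a \<le> l" "l \<le> b" "b < N"
  shows "chain_prod f a b * \<mu> l = \<mu> (Suc l) * chain_prod f a b"
proof -
  let ?P = "chain_prod f a (l - 1)" and ?Q = "chain_prod f (Suc l) b"
  have "chain_prod f a b = ?P * chain_prod f l b"
    using chain_prod_split[of a "l - 1" b f] assms by simp
  also have "chain_prod f l b = f l * ?Q"
    using chain_prod_split[of l l b f] assms by (simp add: chain_prod_single)
  finally have U: "chain_prod f a b = ?P * (f l * ?Q)" .
  have P: "\<mu> (Suc l) * ?P = ?P * \<mu> (Suc l)"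
    using assms by (intro chain_prod_commute r_\<mu>_below[symmetric]) auto
  have Q: "\<mu> l * ?Q = ?Q * \<mu> l"
    using assms by (intro chain_prod_commute r_\<mu>_above[symmetric]) auto
  have n: "f l * \<mu> l = \<mu> (Suc l) * f l"
    using \<mu>_Suc[of l] fg(2)[of l] assms by (simp add: mult.assoc)
  have "chain_prod f a b * \<mu> l = ?P * (f l * \<mu> l) * ?Q"
    unfolding U by (simp only: mult.assoc Q[symmetric])
  also have "\<dots> = (?P * \<mu> (Suc l)) * (f l * ?Q)"
    unfolding n by (simp only: mult.assoc)
  also have "\<dots> = \<mu> (Suc l) * chain_prod f a b"
    unfolding U P[symmetric] by (simp only: mult.assoc)
  finally show ?thesis .
qed

end

section \<open>Matrices as elements of a ring\<close>

text \<open>Square matrices of a given size do not form a type. They are embedded, unitally and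
  injectively, in the right-linear endomorphisms of the space of sequences, as block diagonal
  operators; polynomial identities proved in a type of class \<open>ring_1\<close> thus transfer to matrices.\<close>

typedef (overloaded) 'a seq_endo =
  "{f :: (nat \<Rightarrow> 'a::ring_1) \<Rightarrow> nat \<Rightarrow> 'a. (\<forall>u v. f (\<lambda>i. u i + v i) = (\<lambda>i. f u i + f v i))
     \<and> (\<forall>v a. f (\<lambda>i. v i * a) = (\<lambda>i. f v i * a))}"
  by (rule exI[of _ id]) simp

setup_lifting type_definition_seq_endo

instantiation seq_endo :: (ring_1) ring_1
begin
lift_definition zero_seq_endo :: "'a seq_endo" is "\<lambda>v i. 0" by simp
lift_definition one_seq_endo :: "'a seq_endo" is "\<lambda>v. v" by simp
lift_definition plus_seq_endo :: "'a seq_endo \<Rightarrow> 'a seq_endo \<Rightarrow> 'a seq_endo" is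
  "\<lambda>f g v i. f v i + g v i" by (simp add: algebra_simps)
lift_definition minus_seq_endo :: "'a seq_endo \<Rightarrow> 'a seq_endo \<Rightarrow> 'a seq_endo" is
  "\<lambda>f g v i. f v i - g v i" by (simp add: algebra_simps)
lift_definition uminus_seq_endo :: "'a seq_endo \<Rightarrow> 'a seq_endo" is
  "\<lambda>f v i. - f v i" by (simp add: algebra_simps)
lift_definition times_seq_endo :: "'a seq_endo \<Rightarrow> 'a seq_endo \<Rightarrow> 'a seq_endo" is
  "\<lambda>f g v. f (g v)" by simp
instance
proof
  show "(0::'a seq_endo) \<noteq> 1"
    by transfer (auto simp: fun_eq_iff intro!: exI[of _ "\<lambda>_. 1"])
qed (transfer; simp add: algebra_simps)+
end

lift_definition endo_scale :: "'k::field \<Rightarrow> 'k seq_endo \<Rightarrow> 'k seq_endo" is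
  "\<lambda>c f v i. c * f v i" by (simp add: algebra_simps)

lemma scaled_ring_endo: "scaled_ring (endo_scale :: 'k::field \<Rightarrow> 'k seq_endo \<Rightarrow> 'k seq_endo)"
proof
  fix c :: 'k and x y :: "'k seq_endo"
  show "x * endo_scale c y = endo_scale c (x * y)"
  proof (transfer, elim conjE)
    fix c :: 'k and f g :: "(nat \<Rightarrow> 'k) \<Rightarrow> nat \<Rightarrow> 'k"
    assume "\<forall>v a. f (\<lambda>i. v i * a) = (\<lambda>i. f v i * a)"
    then have "f (\<lambda>i. c * v i) = (\<lambda>i. c * f v i)" for v by (simp add: mult.commute)
    then show "(\<lambda>v. f (\<lambda>i. c * g v i)) = (\<lambda>v i. c * f (g v) i)" by simp
  qed
qed (transfer; simp add: algebra_simps)+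

text \<open>The matrix acts on every block of d consecutive terms of a sequence. For d = 0 the
  result is the zero operator rather than the identity, which is why dimension zero is treated
  separately in the end.\<close>

lift_definition embed :: "nat \<Rightarrow> 'a::ring_1 mat \<Rightarrow> 'a seq_endo" is
  "\<lambda>d X v i. \<Sum>j<d. X $$ (i mod d, j) * v (i div d * d + j)"
  by (simp add: algebra_simps sum.distrib sum_distrib_left sum_distrib_right)

lemma index_mult_sum:
  assumes "X \<in> carrier_mat d e" "Y \<in> carrier_mat e f" "i < d" "j < f"
  shows "(X * Y) $$ (i, j) = (\<Sum>l<e. X $$ (i, l) * Y $$ (l, j))"
  using assms by (simp add: scalar_prod_def lessThan_atLeast0)

lemma seq_endo_eqI: "(\<And>v i. Rep_seq_endo f v i = Rep_seq_endo g v i) \<Longrightarrow> f = g"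
  by (rule Rep_seq_endo_inject[THEN iffD1]) (intro ext)

lemma embed_one: "d > 0 \<Longrightarrow> embed d (1\<^sub>m d) = 1"
proof (rule seq_endo_eqI)
  fix i :: nat and v :: "nat \<Rightarrow> 'a" assume d: "d > 0"
  have "(\<Sum>j<d. 1\<^sub>m d $$ (i mod d, j) * v (i div d * d + j))
      = (\<Sum>j<d. if j = i mod d then v (i div d * d + j) else 0)"
    using d by (intro sum.cong) auto
  also have "\<dots> = v i" using d by simp
  finally show "Rep_seq_endo (embed d (1\<^sub>m d)) v i = Rep_seq_endo 1 v i"
    by (simp add: embed.rep_eq one_seq_endo.rep_eq)
qed

lemma embed_add:
  assumes "X \<in> carrier_mat d d" "Y \<in> carrier_mat d d"
  shows "embed d (X + Y) = embed d X + embed d Y"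
proof (rule seq_endo_eqI, cases "d = 0")
  fix v :: "nat \<Rightarrow> 'a" and i assume "d \<noteq> 0"
  then show "Rep_seq_endo (embed d (X + Y)) v i = Rep_seq_endo (embed d X + embed d Y) v i"
    using assms by (simp add: embed.rep_eq plus_seq_endo.rep_eq distrib_right sum.distrib)
qed (simp add: embed.rep_eq plus_seq_endo.rep_eq)

lemma embed_diff:
  assumes "X \<in> carrier_mat d d" "Y \<in> carrier_mat d d"
  shows "embed d (X - Y) = embed d X - embed d Y"
proof (rule seq_endo_eqI, cases "d = 0")
  fix v :: "nat \<Rightarrow> 'a" and i assume "d \<noteq> 0"
  then show "Rep_seq_endo (embed d (X - Y)) v i = Rep_seq_endo (embed d X - embed d Y) v i"
    using assms by (simp add: embed.rep_eq minus_seq_endo.rep_eq left_diff_distrib sum_subtractf)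
qed (simp add: embed.rep_eq minus_seq_endo.rep_eq)

lemma embed_smult:
  assumes "X \<in> carrier_mat d d"
  shows "embed d (c \<cdot>\<^sub>m X) = endo_scale c (embed d X)"
proof (rule seq_endo_eqI, cases "d = 0")
  fix v :: "nat \<Rightarrow> 'a" and i assume "d \<noteq> 0"
  then show "Rep_seq_endo (embed d (c \<cdot>\<^sub>m X)) v i = Rep_seq_endo (endo_scale c (embed d X)) v i"
    using assms by (simp add: embed.rep_eq endo_scale.rep_eq sum_distrib_left mult.assoc)
qed (simp add: embed.rep_eq endo_scale.rep_eq)

lemma embed_mult:
  assumes X: "X \<in> carrier_mat d d" and Y: "Y \<in> carrier_mat d d"
  shows "embed d (X * Y) = embed d X * embed d Y"
proof (rule seq_endo_eqI, cases "d = 0")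
  fix v :: "nat \<Rightarrow> 'a" and i assume d: "d \<noteq> 0"
  have "(\<Sum>j<d. (X * Y) $$ (i mod d, j) * v (i div d * d + j))
    = (\<Sum>j<d. \<Sum>l<d. X $$ (i mod d, l) * (Y $$ (l, j) * v (i div d * d + j)))"
  proof (intro sum.cong refl)
    fix j assume "j \<in> {..<d}"
    then have "(X * Y) $$ (i mod d, j) = (\<Sum>l<d. X $$ (i mod d, l) * Y $$ (l, j))"
      using d by (intro index_mult_sum[OF X Y]) auto
    then show "(X * Y) $$ (i mod d, j) * v (i div d * d + j)
        = (\<Sum>l<d. X $$ (i mod d, l) * (Y $$ (l, j) * v (i div d * d + j)))"
      by (simp add: sum_distrib_right mult.assoc)
  qed
  also have "\<dots> = (\<Sum>l<d. X $$ (i mod d, l) * (\<Sum>j<d. Y $$ (l, j) * v (i div d * d + j)))"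
    by (subst sum.swap) (simp only: sum_distrib_left)
  also have "\<dots> = (\<Sum>l<d. X $$ (i mod d, l) * (\<Sum>j<d. Y $$ ((i div d * d + l) mod d, j) *
      v ((i div d * d + l) div d * d + j)))"
  proof (intro sum.cong refl)
    fix l assume "l \<in> {..<d}"
    then have "(i div d * d + l) mod d = l" "(i div d * d + l) div d = i div d" by auto
    then show "X $$ (i mod d, l) * (\<Sum>j<d. Y $$ (l, j) * v (i div d * d + j)) =
      X $$ (i mod d, l) * (\<Sum>j<d. Y $$ ((i div d * d + l) mod d, j) *
        v ((i div d * d + l) div d * d + j))" by (simp only:)
  qed
  finally show "Rep_seq_endo (embed d (X * Y)) v i = Rep_seq_endo (embed d X * embed d Y) v i"
    by (simp only: embed.rep_eq times_seq_endo.rep_eq)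
qed (simp add: embed.rep_eq times_seq_endo.rep_eq)

lemma embed_eq_iff:
  assumes "X \<in> carrier_mat d d" "Y \<in> carrier_mat d d"
  shows "embed d X = embed d Y \<longleftrightarrow> X = Y"
proof
  assume eq: "embed d X = embed d Y"
  show "X = Y"
  proof (rule eq_matI)
    fix i j assume "i < dim_row Y" "j < dim_col Y"
    then have ij: "i < d" "j < d" using assms by auto
    \<comment> \<open>The unit sequence at \<open>j < d\<close> lies in the first block and reads
      off column j.\<close>
    have *: "Rep_seq_endo (embed d Z) (\<lambda>l. if l = j then 1 else 0) i = Z $$ (i, j)" for Z :: "'a mat"
    proof -
      have "Rep_seq_endo (embed d Z) (\<lambda>l. if l = j then 1 else 0) i
        = (\<Sum>l<d. if l = j then Z $$ (i, l) else 0)"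
        using ij unfolding embed.rep_eq by (intro sum.cong) auto
      then show ?thesis using ij by simp
    qed
    show "X $$ (i, j) = Y $$ (i, j)" using *[of X] *[of Y] eq by simp
  qed (use assms in auto)
qed simp

section \<open>Kronecker products and partial traces\<close>

lemma pair_less: "i < d \<Longrightarrow> k < e \<Longrightarrow> i * e + k < d * (e::nat)"
  by (metis add.commute add_less_mono1 less_le_trans mult_Suc mult_le_mono1 Suc_leI)

lemma pair_less_assoc: "i < d \<Longrightarrow> j < e \<Longrightarrow> k < f \<Longrightarrow> (i * e + j) * f + k < d * e * (f::nat)"
  by (intro pair_less)

lemma sum_pairs: "(\<Sum>x<d * e. h x) = (\<Sum>i<d. \<Sum>k<e. h (i * e + k :: nat))"
proof -
  have "(\<Sum>x<d * e. h x) = (\<Sum>i<d. sum h {i * e ..< i * e + e})"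
    by (rule sum.nat_group[symmetric])
  also have "\<dots> = (\<Sum>i<d. \<Sum>k<e. h (i * e + k))"
  proof (rule sum.cong[OF refl])
    fix i
    show "sum h {i * e ..< i * e + e} = (\<Sum>k<e. h (i * e + k))"
      by (rule sum.reindex_bij_witness[of _ "\<lambda>k. i * e + k" "\<lambda>x. x - i * e"]) auto
  qed
  finally show ?thesis .
qed

lemma mat_pair_eqI:
  assumes "X \<in> carrier_mat (d * e) (d * e)" "Y \<in> carrier_mat (d * e) (d * e)"
    and "\<And>i k j l. i < d \<Longrightarrow> k < e \<Longrightarrow> j < d \<Longrightarrow> l < e \<Longrightarrow>
      X $$ (i * e + k, j * e + l) = Y $$ (i * e + k, j * e + l)"
  shows "X = Y"
proof (rule eq_matI)
  fix x y assume "x < dim_row Y" "y < dim_col Y"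
  then have xy: "x < d * e" "y < d * e" using assms(2) by auto
  then have "e > 0" by (cases e) auto
  then show "X $$ (x, y) = Y $$ (x, y)"
    using assms(3)[of "x div e" "x mod e" "y div e" "y mod e"] xy
    by (simp add: less_mult_imp_div_less)
qed (use assms in auto)

lemma kron_carrier [simp]: "A \<in> carrier_mat d d \<Longrightarrow> B \<in> carrier_mat e e \<Longrightarrow> kron A B \<in> carrier_mat (d * e) (d * e)"
  by (simp add: kron_def)

lemma kron_index:
  assumes "A \<in> carrier_mat d d" "B \<in> carrier_mat e e" "i < d" "j < d" "k < e" "l < e"
  shows "kron A B $$ (i * e + k, j * e + l) = A $$ (i, j) * B $$ (k, l)"
  using assms by (simp add: kron_def pair_less)

lemma pair_eq_iff:
  fixes i j k l e :: nat
  assumes "k < e" "l < e"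
  shows "i * e + k = j * e + l \<longleftrightarrow> i = j \<and> k = l"
proof
  have div: "(x * e + y) div e = x" if "y < e" for x y :: nat
    using that by simp
  assume eq: "i * e + k = j * e + l"
  then have "i = j" using div[OF assms(1), of i] div[OF assms(2), of j] by (simp only:)
  then show "i = j \<and> k = l" using eq by simp
qed simp

lemma kron_one_one: "kron (1\<^sub>m d) (1\<^sub>m e) = (1\<^sub>m (d * e) :: 'a::semiring_1 mat)"
proof (rule mat_pair_eqI)
  fix i k j l assume "i < d" "k < e" "j < d" "l < e"
  then show "kron (1\<^sub>m d) (1\<^sub>m e) $$ (i * e + k, j * e + l)
      = (1\<^sub>m (d * e) :: 'a mat) $$ (i * e + k, j * e + l)"
    by (simp add: kron_index[of _ d _ e] pair_less pair_eq_iff)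
qed simp_all

lemma kron_assoc:
  fixes A B C :: "'a::semiring_1 mat"
  assumes A: "A \<in> carrier_mat d d" and B: "B \<in> carrier_mat e e" and C: "C \<in> carrier_mat f f"
  shows "kron (kron A B) C = kron A (kron B C)"
proof (rule mat_pair_eqI[of _ "d * e" f])
  show "kron A (kron B C) \<in> carrier_mat (d * e * f) (d * e * f)"
    using kron_carrier[OF A kron_carrier[OF B C]] by (simp add: mult.assoc)
  fix x k y l assume "x < d * e" "k < f" "y < d * e" "l < f"
  moreover from this have e: "e > 0" by (cases e) auto
  ultimately have x: "x div e < d" "x mod e < e" "y div e < d" "y mod e < e" "k < f" "l < f"
    by (auto simp: less_mult_imp_div_less)
  have "kron (kron A B) C $$ (x * f + k, y * f + l)
      = kron A B $$ (x div e * e + x mod e, y div e * e + y mod e) * C $$ (k, l)"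
    using \<open>x < d * e\<close> \<open>y < d * e\<close> x by (simp add: kron_index[OF kron_carrier[OF A B] C])
  also have "\<dots> = A $$ (x div e, y div e) * (B $$ (x mod e, y mod e) * C $$ (k, l))"
    by (simp only: kron_index[OF A B x(1,3,2,4)] mult.assoc)
  also have "\<dots> = A $$ (x div e, y div e) * kron B C $$ (x mod e * f + k, y mod e * f + l)"
    by (simp add: kron_index[OF B C] x)
  also have "\<dots> = kron A (kron B C) $$ (x div e * (e * f) + (x mod e * f + k), y div e * (e * f) + (y mod e * f + l))"
    by (intro kron_index[OF A kron_carrier[OF B C], symmetric] x pair_less)
  also have "x div e * (e * f) + (x mod e * f + k) = x * f + k"
    by (simp only: add.assoc[symmetric] mult.assoc[symmetric] distrib_right[symmetric] div_mult_mod_eq)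
  also have "y div e * (e * f) + (y mod e * f + l) = y * f + l"
    by (simp only: add.assoc[symmetric] mult.assoc[symmetric] distrib_right[symmetric] div_mult_mod_eq)
  finally show "kron (kron A B) C $$ (x * f + k, y * f + l) = kron A (kron B C) $$ (x * f + k, y * f + l)" .
qed (use assms in simp)

text \<open>What survives of commutativity over the free algebra: numerical operators lifted by
  \<open>scal\<close> have this property, the matrix of generators does not. Every interchange of
  operators below has to involve a matrix of this kind.\<close>

definition central_mat :: "'a::semiring_1 mat \<Rightarrow> bool" where
  "central_mat X \<longleftrightarrow> (\<forall>i<dim_row X. \<forall>j<dim_col X. \<forall>p. X $$ (i, j) * p = p * X $$ (i, j))"

lemma central_matD: "central_mat X \<Longrightarrow> i < dim_row X \<Longrightarrow> j < dim_col X \<Longrightarrow> X $$ (i, j) * p = p * X $$ (i, j)"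
  unfolding central_mat_def by blast

lemma central_mat_one [simp]: "central_mat (1\<^sub>m d)"
  by (simp add: central_mat_def)

lemma central_mat_field [simp]: "central_mat (X :: 'k::field mat)"
  by (simp add: central_mat_def mult.commute)

lemma central_mat_lift [simp]: "central_mat (lift_op X)"
  by (simp add: central_mat_def scal_central)

lemma central_product:
  fixes a b p :: "'a::semigroup_mult"
  assumes "\<And>p. a * p = p * a" "\<And>p. b * p = p * b"
  shows "a * b * p = p * (a * b)"
proof -
  have "a * b * p = a * (p * b)" by (simp only: mult.assoc assms(2)[of p])
  also have "\<dots> = (p * a) * b" by (simp only: assms(1)[of p, symmetric] mult.assoc)
  finally show ?thesis by (simp only: mult.assoc)
qed

lemma central_mat_kron:
  assumes "central_mat A" "central_mat B"
  shows "central_mat (kron A B)"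
  unfolding central_mat_def
proof (intro allI impI)
  fix i j p assume ij: "i < dim_row (kron A B)" "j < dim_col (kron A B)"
  then have lt: "i < dim_row A * dim_row B" "j < dim_col A * dim_col B" by (auto simp: kron_def)
  then have "dim_row B > 0" "dim_col B > 0" by (auto intro: gr0I)
  then have c: "A $$ (i div dim_row B, j div dim_col B) * p = p * A $$ (i div dim_row B, j div dim_col B)"
    "B $$ (i mod dim_row B, j mod dim_col B) * p = p * B $$ (i mod dim_row B, j mod dim_col B)" for p
    by (intro central_matD assms; use lt in \<open>simp add: less_mult_imp_div_less\<close>)+
  have "kron A B $$ (i, j) = A $$ (i div dim_row B, j div dim_col B) * B $$ (i mod dim_row B, j mod dim_col B)"
    using lt by (simp add: kron_def)
  then show "kron A B $$ (i, j) * p = p * kron A B $$ (i, j)"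
    by (simp only:) (rule central_product; rule c)
qed

text \<open>Only the entries of B and C change places, so it suffices that one of the two matrices
  is central.\<close>

lemma kron_mult:
  fixes A B C D :: "'a::semiring_1 mat"
  assumes A: "A \<in> carrier_mat d d" and B: "B \<in> carrier_mat e e"
    and C: "C \<in> carrier_mat d d" and D: "D \<in> carrier_mat e e"
    and "central_mat B \<or> central_mat C"
  shows "kron A B * kron C D = kron (A * C) (B * D)"
proof (rule mat_pair_eqI[of _ d e])
  fix i k j l assume lt: "i < d" "k < e" "j < d" "l < e"
  have comm: "B $$ (k, z) * C $$ (y, j) = C $$ (y, j) * B $$ (k, z)" if "z < e" "y < d" for y z
    using assms(5)
  proof
    assume "central_mat B"
    then show ?thesis by (rule central_matD) (use B lt that in auto)
  next
    assume "central_mat C"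
    then show ?thesis by (rule central_matD[symmetric]) (use C lt that in auto)
  qed
  have "(kron A B * kron C D) $$ (i * e + k, j * e + l)
      = (\<Sum>y<d. \<Sum>z<e. kron A B $$ (i * e + k, y * e + z) * kron C D $$ (y * e + z, j * e + l))"
    using lt by (subst index_mult_sum[OF kron_carrier[OF A B] kron_carrier[OF C D]])
      (simp_all add: pair_less sum_pairs)
  also have "\<dots> = (\<Sum>y<d. \<Sum>z<e. (A $$ (i, y) * C $$ (y, j)) * (B $$ (k, z) * D $$ (z, l)))"
  proof (intro sum.cong refl)
    fix y z assume "y \<in> {..<d}" "z \<in> {..<e}"
    then have yz: "y < d" "z < e" by auto
    have "A $$ (i, y) * B $$ (k, z) * (C $$ (y, j) * D $$ (z, l))
       = A $$ (i, y) * (B $$ (k, z) * C $$ (y, j)) * D $$ (z, l)" by (simp only: mult.assoc)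
    also have "\<dots> = (A $$ (i, y) * C $$ (y, j)) * (B $$ (k, z) * D $$ (z, l))"
      by (simp only: comm yz mult.assoc)
    finally show "kron A B $$ (i * e + k, y * e + z) * kron C D $$ (y * e + z, j * e + l) = \<dots>"
      by (simp add: kron_index[OF A B] kron_index[OF C D] lt yz)
  qed
  also have "\<dots> = kron (A * C) (B * D) $$ (i * e + k, j * e + l)"
    unfolding kron_index[OF mult_carrier_mat[OF A C] mult_carrier_mat[OF B D] lt(1,3,2,4)]
      index_mult_sum[OF A C lt(1,3)] index_mult_sum[OF B D lt(2,4)] sum_product ..
  finally show "(kron A B * kron C D) $$ (i * e + k, j * e + l)
      = kron (A * C) (B * D) $$ (i * e + k, j * e + l)" .
next
  show "kron A B * kron C D \<in> carrier_mat (d * e) (d * e)"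
    by (rule mult_carrier_mat[OF kron_carrier[OF A B] kron_carrier[OF C D]])
  show "kron (A * C) (B * D) \<in> carrier_mat (d * e) (d * e)"
    by (rule kron_carrier[OF mult_carrier_mat[OF A C] mult_carrier_mat[OF B D]])
qed

lemma lift_kron: "lift_op (kron A B) = kron (lift_op A) (lift_op B)"
proof (rule eq_matI)
  fix i j assume "i < dim_row (kron (lift_op A) (lift_op B))" "j < dim_col (kron (lift_op A) (lift_op B))"
  then have lt: "i < dim_row A * dim_row B" "j < dim_col A * dim_col B" by (auto simp: kron_def)
  then have "dim_row B > 0" "dim_col B > 0" by (auto intro: gr0I)
  then show "lift_op (kron A B) $$ (i, j) = kron (lift_op A) (lift_op B) $$ (i, j)"
    using lt by (simp add: kron_def ring_hom_scal less_mult_imp_div_less)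
qed (simp_all add: kron_def)

lemma scal_sum: "scal (sum h S) = (\<Sum>i\<in>S. scal (h i))"
  by (induction S rule: infinite_finite_induct) (simp_all add: ring_hom_scal)

lemma lift_mult:
  assumes "A \<in> carrier_mat d d" "B \<in> carrier_mat d d"
  shows "lift_op (A * B) = lift_op A * lift_op B"
  using assms by (intro eq_matI) (auto simp: index_mult_sum[of _ d d _ d] scal_sum ring_hom_scal
      simp del: index_mult_mat(1))

lemma lift_one: "lift_op (1\<^sub>m d) = 1\<^sub>m d"
  by (intro eq_matI) (auto simp: ring_hom_scal)

lemma lift_carrier [simp]: "A \<in> carrier_mat d e \<Longrightarrow> lift_op A \<in> carrier_mat d e"
  by simp

section \<open>Partial traces over the second tensor factor\<close>

lemma ptrace2_carrier [simp]: "ptrace2 d e X \<in> carrier_mat d d"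
  by (simp add: ptrace2_def)

lemma ptrace2_index: "i < d \<Longrightarrow> j < d \<Longrightarrow> ptrace2 d e X $$ (i, j) = (\<Sum>l<e. X $$ (i * e + l, j * e + l))"
  by (simp add: ptrace2_def)

lemma kron_one_mult_index:
  fixes A :: "'a::semiring_1 mat"
  assumes A: "A \<in> carrier_mat d d" and X: "X \<in> carrier_mat (d * e) f" and lt: "i < d" "k < e" "x < f"
  shows "(kron A (1\<^sub>m e) * X) $$ (i * e + k, x) = (\<Sum>j<d. A $$ (i, j) * X $$ (j * e + k, x))"
proof -
  have "(kron A (1\<^sub>m e) * X) $$ (i * e + k, x)
      = (\<Sum>j<d. \<Sum>l<e. kron A (1\<^sub>m e) $$ (i * e + k, j * e + l) * X $$ (j * e + l, x))"
    by (subst index_mult_sum[OF kron_carrier[OF A one_carrier_mat] X]) (use lt in \<open>simp_all add: pair_less sum_pairs\<close>)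
  also have "\<dots> = (\<Sum>j<d. \<Sum>l<e. if l = k then A $$ (i, j) * X $$ (j * e + k, x) else 0)"
    using lt by (intro sum.cong refl) (simp add: kron_index[OF A one_carrier_mat])
  also have "\<dots> = (\<Sum>j<d. A $$ (i, j) * X $$ (j * e + k, x))"
    using lt by simp
  finally show ?thesis .
qed

lemma one_kron_mult_index:
  fixes B :: "'a::semiring_1 mat"
  assumes B: "B \<in> carrier_mat e e" and X: "X \<in> carrier_mat (d * e) f" and lt: "i < d" "k < e" "x < f"
  shows "(kron (1\<^sub>m d) B * X) $$ (i * e + k, x) = (\<Sum>l<e. B $$ (k, l) * X $$ (i * e + l, x))"
proof -
  have "(kron (1\<^sub>m d) B * X) $$ (i * e + k, x)
      = (\<Sum>j<d. \<Sum>l<e. kron (1\<^sub>m d) B $$ (i * e + k, j * e + l) * X $$ (j * e + l, x))"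
    by (subst index_mult_sum[OF kron_carrier[OF one_carrier_mat B] X]) (use lt in \<open>simp_all add: pair_less sum_pairs\<close>)
  also have "\<dots> = (\<Sum>l<e. \<Sum>j<d. if j = i then B $$ (k, l) * X $$ (i * e + l, x) else 0)"
    by (subst sum.swap, intro sum.cong refl) (use lt in \<open>simp add: kron_index[OF one_carrier_mat B]\<close>)
  also have "\<dots> = (\<Sum>l<e. B $$ (k, l) * X $$ (i * e + l, x))"
    using lt by simp
  finally show ?thesis .
qed

lemma mult_kron_one_index:
  fixes A :: "'a::semiring_1 mat"
  assumes A: "A \<in> carrier_mat d d" and X: "X \<in> carrier_mat f (d * e)" and lt: "i < d" "k < e" "x < f"
  shows "(X * kron A (1\<^sub>m e)) $$ (x, i * e + k) = (\<Sum>j<d. X $$ (x, j * e + k) * A $$ (j, i))"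
proof -
  have "(X * kron A (1\<^sub>m e)) $$ (x, i * e + k)
      = (\<Sum>j<d. \<Sum>l<e. X $$ (x, j * e + l) * kron A (1\<^sub>m e) $$ (j * e + l, i * e + k))"
    by (subst index_mult_sum[OF X kron_carrier[OF A one_carrier_mat]]) (use lt in \<open>simp_all add: pair_less sum_pairs\<close>)
  also have "\<dots> = (\<Sum>j<d. \<Sum>l<e. if l = k then X $$ (x, j * e + k) * A $$ (j, i) else 0)"
    using lt by (intro sum.cong refl) (simp add: kron_index[OF A one_carrier_mat])
  also have "\<dots> = (\<Sum>j<d. X $$ (x, j * e + k) * A $$ (j, i))"
    using lt by simp
  finally show ?thesis .
qed

lemma mult_one_kron_index:
  fixes B :: "'a::semiring_1 mat"
  assumes B: "B \<in> carrier_mat e e" and X: "X \<in> carrier_mat f (d * e)" and lt: "i < d" "k < e" "x < f"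
  shows "(X * kron (1\<^sub>m d) B) $$ (x, i * e + k) = (\<Sum>l<e. X $$ (x, i * e + l) * B $$ (l, k))"
proof -
  have "(X * kron (1\<^sub>m d) B) $$ (x, i * e + k)
      = (\<Sum>j<d. \<Sum>l<e. X $$ (x, j * e + l) * kron (1\<^sub>m d) B $$ (j * e + l, i * e + k))"
    by (subst index_mult_sum[OF X kron_carrier[OF one_carrier_mat B]]) (use lt in \<open>simp_all add: pair_less sum_pairs\<close>)
  also have "\<dots> = (\<Sum>l<e. \<Sum>j<d. if j = i then X $$ (x, i * e + l) * B $$ (l, k) else 0)"
    by (subst sum.swap, intro sum.cong refl) (use lt in \<open>simp add: kron_index[OF one_carrier_mat B]\<close>)
  also have "\<dots> = (\<Sum>l<e. X $$ (x, i * e + l) * B $$ (l, k))"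
    using lt by simp
  finally show ?thesis .
qed

lemma ptrace2_kron_left:
  fixes A X :: "'a::semiring_1 mat"
  assumes A: "A \<in> carrier_mat d d" and X: "X \<in> carrier_mat (d * e) (d * e)"
  shows "ptrace2 d e (kron A (1\<^sub>m e) * X) = A * ptrace2 d e X"
proof (rule eq_matI)
  fix i j assume "i < dim_row (A * ptrace2 d e X)" "j < dim_col (A * ptrace2 d e X)"
  then have ij: "i < d" "j < d" using A by (auto simp: ptrace2_def)
  have "ptrace2 d e (kron A (1\<^sub>m e) * X) $$ (i, j)
      = (\<Sum>l<e. \<Sum>y<d. A $$ (i, y) * X $$ (y * e + l, j * e + l))"
    using ij by (auto simp: ptrace2_index pair_less kron_one_mult_index[OF A X] intro!: sum.cong)
  also have "\<dots> = (\<Sum>y<d. A $$ (i, y) * (\<Sum>l<e. X $$ (y * e + l, j * e + l)))"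
    by (subst sum.swap) (simp add: sum_distrib_left)
  also have "\<dots> = (A * ptrace2 d e X) $$ (i, j)"
    using ij by (simp add: index_mult_sum[OF A ptrace2_carrier] ptrace2_index)
  finally show "ptrace2 d e (kron A (1\<^sub>m e) * X) $$ (i, j) = (A * ptrace2 d e X) $$ (i, j)" .
qed (use A in \<open>auto simp: ptrace2_def\<close>)

lemma ptrace2_kron_right:
  fixes A X :: "'a::semiring_1 mat"
  assumes A: "A \<in> carrier_mat d d" and X: "X \<in> carrier_mat (d * e) (d * e)"
  shows "ptrace2 d e (X * kron A (1\<^sub>m e)) = ptrace2 d e X * A"
proof (rule eq_matI)
  fix i j assume "i < dim_row (ptrace2 d e X * A)" "j < dim_col (ptrace2 d e X * A)"
  then have ij: "i < d" "j < d" using A by (auto simp: ptrace2_def)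
  have "ptrace2 d e (X * kron A (1\<^sub>m e)) $$ (i, j)
      = (\<Sum>l<e. \<Sum>y<d. X $$ (i * e + l, y * e + l) * A $$ (y, j))"
    using ij by (auto simp: ptrace2_index pair_less mult_kron_one_index[OF A X] intro!: sum.cong)
  also have "\<dots> = (\<Sum>y<d. (\<Sum>l<e. X $$ (i * e + l, y * e + l)) * A $$ (y, j))"
    by (subst sum.swap) (simp add: sum_distrib_right)
  also have "\<dots> = (ptrace2 d e X * A) $$ (i, j)"
    using ij by (simp add: index_mult_sum[OF ptrace2_carrier A] ptrace2_index)
  finally show "ptrace2 d e (X * kron A (1\<^sub>m e)) $$ (i, j) = (ptrace2 d e X * A) $$ (i, j)" .
qed (use A in \<open>auto simp: ptrace2_def\<close>)

text \<open>The double sum over the traced index is symmetric, but the entries of C must pass those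
  of X; hence cyclicity is available for numerical operators on the traced factor only.\<close>

lemma ptrace2_cyclic:
  fixes C X :: "'a::semiring_1 mat"
  assumes C: "C \<in> carrier_mat e e" and X: "X \<in> carrier_mat (d * e) (d * e)" and "central_mat C"
  shows "ptrace2 d e (kron (1\<^sub>m d) C * X) = ptrace2 d e (X * kron (1\<^sub>m d) C)"
proof (rule eq_matI)
  fix i j assume "i < dim_row (ptrace2 d e (X * kron (1\<^sub>m d) C))"
    "j < dim_col (ptrace2 d e (X * kron (1\<^sub>m d) C))"
  then have ij: "i < d" "j < d" by (auto simp: ptrace2_def)
  have "ptrace2 d e (kron (1\<^sub>m d) C * X) $$ (i, j)
      = (\<Sum>l<e. \<Sum>m<e. C $$ (l, m) * X $$ (i * e + m, j * e + l))"
    using ij by (auto simp: ptrace2_index pair_less one_kron_mult_index[OF C X] intro!: sum.cong)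
  also have "\<dots> = (\<Sum>l<e. \<Sum>m<e. X $$ (i * e + m, j * e + l) * C $$ (l, m))"
    using C by (intro sum.cong refl central_matD assms) auto
  also have "\<dots> = (\<Sum>m<e. \<Sum>l<e. X $$ (i * e + m, j * e + l) * C $$ (l, m))"
    by (rule sum.swap)
  also have "\<dots> = ptrace2 d e (X * kron (1\<^sub>m d) C) $$ (i, j)"
    using ij by (auto simp: ptrace2_index pair_less mult_one_kron_index[OF C X] intro!: sum.cong)
  finally show "ptrace2 d e (kron (1\<^sub>m d) C * X) $$ (i, j) = ptrace2 d e (X * kron (1\<^sub>m d) C) $$ (i, j)" .
qed (auto simp: ptrace2_def)

lemma ptrace2_ptrace2: "ptrace2 d e (ptrace2 (d * e) f X) = ptrace2 d (e * f) X"
proof (rule eq_matI)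
  fix i j assume "i < dim_row (ptrace2 d (e * f) X)" "j < dim_col (ptrace2 d (e * f) X)"
  then have ij: "i < d" "j < d" by (auto simp: ptrace2_def)
  then have "ptrace2 d e (ptrace2 (d * e) f X) $$ (i, j)
      = (\<Sum>k<e. \<Sum>l<f. X $$ ((i * e + k) * f + l, (j * e + k) * f + l))"
    by (auto simp: ptrace2_index pair_less intro!: sum.cong)
  also have "\<dots> = (\<Sum>k<e. \<Sum>l<f. X $$ (i * (e * f) + (k * f + l), j * (e * f) + (k * f + l)))"
    by (simp only: distrib_right mult.assoc add.assoc)
  also have "\<dots> = ptrace2 d (e * f) X $$ (i, j)"
    using ij by (simp add: ptrace2_index sum_pairs)
  finally show "ptrace2 d e (ptrace2 (d * e) f X) $$ (i, j) = ptrace2 d (e * f) X $$ (i, j)" .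
qed (auto simp: ptrace2_def)

lemma ptrace2_one: "X \<in> carrier_mat d d \<Longrightarrow> ptrace2 d 1 X = X"
  by (rule eq_matI) (auto simp: ptrace2_def)

lemma ptrace2_diff:
  fixes X Y :: "'a::ab_group_add mat"
  shows "X \<in> carrier_mat (d * e) (d * e) \<Longrightarrow> Y \<in> carrier_mat (d * e) (d * e) \<Longrightarrow>
    ptrace2 d e (X - Y) = ptrace2 d e X - ptrace2 d e Y"
  by (rule eq_matI) (auto simp: ptrace2_def pair_less sum_subtractf)

lemma ptrace2_smult:
  fixes X :: "'a::semiring_1 mat"
  shows "X \<in> carrier_mat (d * e) (d * e) \<Longrightarrow> ptrace2 d e (c \<cdot>\<^sub>m X) = c \<cdot>\<^sub>m ptrace2 d e X"
  by (rule eq_matI) (auto simp: ptrace2_def pair_less sum_distrib_left)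

section \<open>Operators on a group of copies\<close>

lemma kron_one_right [simp]: "(A :: 'a::semiring_1 mat) \<in> carrier_mat d d \<Longrightarrow> kron A (1\<^sub>m (Suc 0)) = A"
  by (rule eq_matI) (auto simp: kron_def)

lemma kron_one_left [simp]: "(A :: 'a::semiring_1 mat) \<in> carrier_mat d d \<Longrightarrow> kron (1\<^sub>m (Suc 0)) A = A"
  by (rule eq_matI) (auto simp: kron_def)

lemma act_eq:
  fixes Y :: "'a::semiring_1 mat"
  assumes "Y \<in> carrier_mat (n ^ r) (n ^ r)" "m = p + r + t" "i = Suc p"
  shows "act n m i r Y = kron (1\<^sub>m (n ^ p)) (kron Y (1\<^sub>m (n ^ t)))"
  using assms kron_assoc[of "1\<^sub>m (n ^ p) :: 'a mat" "n ^ p" Y "n ^ r" "1\<^sub>m (n ^ t)" "n ^ t"]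
  by (simp add: act_def)

lemma act_carrier [simp]:
  fixes Y :: "'a::semiring_1 mat"
  assumes "Y \<in> carrier_mat (n ^ r) (n ^ r)" "1 \<le> i" "i + r \<le> Suc m"
  shows "act n m i r Y \<in> carrier_mat (n ^ m) (n ^ m)"
proof -
  have "m = (i - 1) + r + (m + 1 - i - r)" using assms by simp
  then have "n ^ m = n ^ (i - 1) * n ^ r * n ^ (m + 1 - i - r)" by (metis power_add)
  then show ?thesis unfolding act_def using assms(1) by simp
qed

lemma kron_act_left:
  fixes Y :: "'a::semiring_1 mat"
  assumes Y: "Y \<in> carrier_mat (n ^ r) (n ^ r)" and i: "1 \<le> i" "i + r \<le> Suc m"
  shows "kron (1\<^sub>m (n ^ p)) (act n m i r Y) = act n (p + m) (p + i) r Y"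
proof -
  define t where "t = m + 1 - i - r"
  have "act n m i r Y = kron (1\<^sub>m (n ^ (i - 1))) (kron Y (1\<^sub>m (n ^ t)))"
    using i by (intro act_eq Y) (auto simp: t_def)
  moreover have "act n (p + m) (p + i) r Y = kron (1\<^sub>m (n ^ (p + (i - 1)))) (kron Y (1\<^sub>m (n ^ t)))"
    using i by (intro act_eq Y) (auto simp: t_def)
  ultimately show ?thesis
    using Y by (simp add: power_add kron_one_one[symmetric]
        kron_assoc[of _ "n ^ p" _ "n ^ (i - 1)" _ "n ^ r * n ^ t"])
qed

lemma kron_act_right:
  fixes Y :: "'a::semiring_1 mat"
  assumes Y: "Y \<in> carrier_mat (n ^ r) (n ^ r)" and i: "1 \<le> i" "i + r \<le> Suc m"
  shows "kron (act n m i r Y) (1\<^sub>m (n ^ p)) = act n (m + p) i r Y"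
proof -
  define t where "t = m + 1 - i - r"
  have "act n m i r Y = kron (1\<^sub>m (n ^ (i - 1))) (kron Y (1\<^sub>m (n ^ t)))"
    using i by (intro act_eq Y) (auto simp: t_def)
  moreover have "act n (m + p) i r Y = kron (1\<^sub>m (n ^ (i - 1))) (kron Y (1\<^sub>m (n ^ (t + p))))"
    using i by (intro act_eq Y) (auto simp: t_def)
  ultimately show ?thesis
    using Y by (simp add: power_add kron_one_one[symmetric]
        kron_assoc[of _ "n ^ (i - 1)" _ "n ^ r * n ^ t" _ "n ^ p"]
        kron_assoc[of _ "n ^ r" _ "n ^ t" _ "n ^ p"])
qed

lemma act_act:
  fixes Y :: "'a::semiring_1 mat"
  assumes Y: "Y \<in> carrier_mat (n ^ s) (n ^ s)" and a: "1 \<le> a" "a + s \<le> Suc r"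
    and i: "1 \<le> i" "i + r \<le> Suc m"
  shows "act n m i r (act n r a s Y) = act n m (i + a - 1) s Y"
proof -
  have "act n m i r (act n r a s Y) = kron (act n (i - 1 + r) (i - 1 + a) s Y) (1\<^sub>m (n ^ (m + 1 - i - r)))"
    unfolding act_def[of n m i r] kron_act_left[OF Y a] ..
  also have "\<dots> = act n (i - 1 + r + (m + 1 - i - r)) (i - 1 + a) s Y"
    by (rule kron_act_right[OF Y]) (use a i in auto)
  finally show ?thesis using i a by (simp add: add.commute)
qed

lemma act_mult:
  fixes X Y :: "'a::semiring_1 mat"
  assumes X: "X \<in> carrier_mat (n ^ r) (n ^ r)" and Y: "Y \<in> carrier_mat (n ^ r) (n ^ r)"
  shows "act n m i r (X * Y) = act n m i r X * act n m i r Y"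
proof -
  let ?p = "n ^ (i - 1)" and ?t = "n ^ (m + 1 - i - r)"
  have p: "kron (1\<^sub>m ?p) X * kron (1\<^sub>m ?p) Y = kron (1\<^sub>m ?p) (X * Y)"
    using kron_mult[of "1\<^sub>m ?p" ?p X "n ^ r" "1\<^sub>m ?p" Y] X Y by simp
  show ?thesis
    unfolding act_def
    using kron_mult[of "kron (1\<^sub>m ?p) X" "?p * n ^ r" "1\<^sub>m ?t" ?t "kron (1\<^sub>m ?p) Y" "1\<^sub>m ?t"] X Y
    by (simp add: p[simplified])
qed

lemma act_one:
  assumes "1 \<le> i" "i + r \<le> Suc m"
  shows "act n m i r (1\<^sub>m (n ^ r)) = (1\<^sub>m (n ^ m) :: 'a::semiring_1 mat)"
proof -
  have "m = (i - 1) + r + (m + 1 - i - r)" using assms by simp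
  then have "n ^ m = n ^ (i - 1) * n ^ r * n ^ (m + 1 - i - r)" by (metis power_add)
  then show ?thesis by (simp add: act_def kron_one_one)
qed

lemma act_full [simp]:
  "(Y :: 'a::semiring_1 mat) \<in> carrier_mat (n ^ m) (n ^ m) \<Longrightarrow> act n m (Suc 0) m Y = Y"
  by (simp add: act_def)

lemma act_full1: "(Y :: 'a::semiring_1 mat) \<in> carrier_mat (n ^ m) (n ^ m) \<Longrightarrow> act n m 1 m Y = Y"
  by simp

lemma lift_act: "lift_op (act n m i r Y) = act n m i r (lift_op Y)"
  by (simp add: act_def lift_kron lift_one)

lemma central_mat_act: "central_mat Y \<Longrightarrow> central_mat (act n m i r Y)"
  by (simp add: act_def central_mat_kron)

text \<open>The operators sit in different tensor factors after a cut behind copy i + r - 1. Over a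
  noncommutative ring their entries must also commute, hence the last condition.\<close>

lemma act_commute:
  fixes X Y :: "'a::semiring_1 mat"
  assumes X: "X \<in> carrier_mat (n ^ r) (n ^ r)" and Y: "Y \<in> carrier_mat (n ^ s) (n ^ s)"
    and ij: "1 \<le> i" "i + r \<le> j" "j + s \<le> Suc m" and c: "central_mat X \<or> central_mat Y"
  shows "act n m i r X * act n m j s Y = act n m j s Y * act n m i r X"
proof -
  define p where "p = i + r - 1"
  define X' where "X' = act n p i r X"
  define Y' where "Y' = act n (m - p) (j - p) s Y"
  have X': "X' \<in> carrier_mat (n ^ p) (n ^ p)" unfolding X'_def using ij X by (intro act_carrier) (auto simp: p_def)
  have Y': "Y' \<in> carrier_mat (n ^ (m - p)) (n ^ (m - p))"
    unfolding Y'_def using ij Y by (intro act_carrier) (auto simp: p_def)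
  have eX: "act n m i r X = kron X' (1\<^sub>m (n ^ (m - p)))"
    unfolding X'_def using ij kron_act_right[OF X, of i p "m - p"] by (simp add: p_def)
  have eY: "act n m j s Y = kron (1\<^sub>m (n ^ p)) Y'"
    unfolding Y'_def using ij kron_act_left[OF Y, of "j - p" "m - p" p] by (simp add: p_def)
  have c': "central_mat Y' \<or> central_mat X'" unfolding X'_def Y'_def using c central_mat_act by blast
  show ?thesis
    unfolding eX eY using kron_mult[OF X' one_carrier_mat one_carrier_mat Y']
      kron_mult[OF one_carrier_mat Y' X' one_carrier_mat] c' X' Y' by simp
qed

text \<open>The Yang-Baxter and compatibility equations are given on three copies only; this
  transports them to copies i, i+1, i+2 of m.\<close>

lemma act_braid:
  fixes A B C A' B' C' :: "'a::semiring_1 mat"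
  assumes eq: "act n 3 a 2 A * act n 3 b 2 B * act n 3 c 2 C = act n 3 a' 2 A' * act n 3 b' 2 B' * act n 3 c' 2 C'"
    and cs: "A \<in> carrier_mat (n^2) (n^2)" "B \<in> carrier_mat (n^2) (n^2)" "C \<in> carrier_mat (n^2) (n^2)"
      "A' \<in> carrier_mat (n^2) (n^2)" "B' \<in> carrier_mat (n^2) (n^2)" "C' \<in> carrier_mat (n^2) (n^2)"
    and ab: "a \<in> {1,2}" "b \<in> {1,2}" "c \<in> {1,2}" "a' \<in> {1,2}" "b' \<in> {1,2}" "c' \<in> {1,2}"
    and i: "1 \<le> i" "i + 2 \<le> m"
  shows "act n m (i + a - 1) 2 A * act n m (i + b - 1) 2 B * act n m (i + c - 1) 2 C
    = act n m (i + a' - 1) 2 A' * act n m (i + b' - 1) 2 B' * act n m (i + c' - 1) 2 C'"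
proof -
  have car: "act n 3 a 2 X \<in> carrier_mat (n ^ 3) (n ^ 3)"
    if "a \<in> {1,2}" "X \<in> carrier_mat (n^2) (n^2)" for a and X :: "'a mat"
    using that by (intro act_carrier) auto
  have two: "act n m i 3 (act n 3 a 2 X) = act n m (i + a - 1) 2 X"
    if "a \<in> {1,2}" "X \<in> carrier_mat (n^2) (n^2)" for a and X :: "'a mat"
    using that i by (intro act_act) auto
  have prod: "act n m i 3 (act n 3 a 2 A * act n 3 b 2 B * act n 3 c 2 C)
    = act n m (i + a - 1) 2 A * act n m (i + b - 1) 2 B * act n m (i + c - 1) 2 C"
    if "A \<in> carrier_mat (n^2) (n^2)" "B \<in> carrier_mat (n^2) (n^2)" "C \<in> carrier_mat (n^2) (n^2)"
      "a \<in> {1,2}" "b \<in> {1,2}" "c \<in> {1,2}" for a b c and A B C :: "'a mat"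
    using act_mult[OF mult_carrier_mat[OF car[OF that(4,1)] car[OF that(5,2)]] car[OF that(6,3)], of m i]
      act_mult[OF car[OF that(4,1)] car[OF that(5,2)], of m i]
      two[OF that(4,1)] two[OF that(5,2)] two[OF that(6,3)] by simp
  show ?thesis using prod[OF cs(1-3) ab(1-3)] prod[OF cs(4-6) ab(4-6)] eq by simp
qed

lemma act_two_index:
  fixes Y :: "'a::semiring_1 mat"
  assumes Y: "Y \<in> carrier_mat (n * n) (n * n)" and X: "X \<in> carrier_mat (d * (n * n) * e) f"
    and lt: "x < d" "a < n" "b < n" "z < e" "y < f"
  shows "(kron (kron (1\<^sub>m d) Y) (1\<^sub>m e) * X) $$ (((x * n + a) * n + b) * e + z, y)
    = (\<Sum>p<n. \<Sum>r<n. Y $$ (a * n + b, p * n + r) * X $$ (((x * n + p) * n + r) * e + z, y))"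
proof -
  have ix: "(x * n + a) * n + b = x * (n * n) + (a * n + b)" for a b by (simp add: algebra_simps)
  have KY: "kron (1\<^sub>m d) Y \<in> carrier_mat (d * (n * n)) (d * (n * n))" using Y by simp
  have "(kron (kron (1\<^sub>m d) Y) (1\<^sub>m e) * X) $$ (((x * n + a) * n + b) * e + z, y)
     = (\<Sum>j<d * (n * n). kron (1\<^sub>m d) Y $$ (x * (n * n) + (a * n + b), j) * X $$ (j * e + z, y))"
    unfolding ix by (rule kron_one_mult_index[OF KY X]) (use lt in \<open>auto intro!: pair_less\<close>)
  also have "\<dots> = (\<Sum>j<d. \<Sum>l<n * n. (if j = x then Y $$ (a * n + b, l) * X $$ ((x * (n * n) + l) * e + z, y) else 0))"
    unfolding sum_pairs[of _ d "n * n"]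
    by (intro sum.cong refl, subst kron_index[OF one_carrier_mat Y]) (use lt in \<open>auto intro!: pair_less\<close>)
  also have "\<dots> = (\<Sum>l<n * n. Y $$ (a * n + b, l) * X $$ ((x * (n * n) + l) * e + z, y))"
    using lt by (subst sum.swap) simp
  also have "\<dots> = (\<Sum>p<n. \<Sum>r<n. Y $$ (a * n + b, p * n + r) * X $$ ((x * (n * n) + (p * n + r)) * e + z, y))"
    by (rule sum_pairs)
  finally show ?thesis by (simp only: ix)
qed

section \<open>Skew invertibility\<close>

lemma scal_swap:
  "scal a * (scal b * (w * scal c)) = w * (scal a * (scal b * scal c))"
proof -
  have "scal a * (scal b * (w * scal c)) = (scal (a * b) * w) * scal c"
    by (simp add: ring_hom_scal mult.assoc)
  also have "\<dots> = w * (scal a * (scal b * scal c))"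
    unfolding scal_central[of "a * b" w] by (simp add: ring_hom_scal mult.assoc)
  finally show ?thesis .
qed

text \<open>Here W acts in a block of dimension c and one further copy, F and G in that copy and the
  next, D in the last one, which is traced. The order of the entries is kept, because the formula
  serves both a numerical W and one built from the generators.\<close>

lemma ptrace2_sandwich_index:
  fixes D F G W :: "'a::semiring_1 mat"
  assumes cs: "D \<in> carrier_mat n n" "F \<in> carrier_mat (n * n) (n * n)" "G \<in> carrier_mat (n * n) (n * n)"
    and W: "W \<in> carrier_mat (c * n) (c * n)" and lt: "x < c" "k < n" "y < c" "l < n"
  shows "ptrace2 (c * n) n (kron (1\<^sub>m (c * n)) D * (kron (1\<^sub>m c) F * (kron W (1\<^sub>m n) * kron (1\<^sub>m c) G)))
      $$ (x * n + k, y * n + l)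
    = (\<Sum>m<n. \<Sum>m'<n. \<Sum>a<n. \<Sum>e<n. \<Sum>b<n.
        D $$ (m, m') * (F $$ (k * n + m', a * n + e) * (W $$ (x * n + a, y * n + b) * G $$ (b * n + e, l * n + m))))"
proof -
  have ck: "kron (1\<^sub>m (c * n)) D \<in> carrier_mat (c * n * n) (c * n * n)"
    "kron (1\<^sub>m c) F \<in> carrier_mat (c * n * n) (c * n * n)"
    "kron (1\<^sub>m c) G \<in> carrier_mat (c * n * n) (c * n * n)"
    "kron W (1\<^sub>m n) \<in> carrier_mat (c * n * n) (c * n * n)"
    using kron_carrier[OF one_carrier_mat cs(1), of "c * n"] kron_carrier[OF one_carrier_mat cs(2), of c]
      kron_carrier[OF one_carrier_mat cs(3), of c] kron_carrier[OF W one_carrier_mat, of n]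
    by (simp_all only: mult.assoc)
  let ?X3 = "kron W (1\<^sub>m n) * kron (1\<^sub>m c) G"
  let ?X2 = "kron (1\<^sub>m c) F * ?X3"
  have X3: "?X3 \<in> carrier_mat (c * n * n) (c * n * n)" by (rule mult_carrier_mat[OF ck(4,3)])
  have X2: "?X2 \<in> carrier_mat (c * n * n) (c * n * n)" by (rule mult_carrier_mat[OF ck(2) X3])
  have nn: "c * n * n = c * (n * n)" by simp
  have entry: "(kron (1\<^sub>m (c * n)) D * ?X2) $$ ((x * n + k) * n + m, (y * n + l) * n + m)
     = (\<Sum>m'<n. D $$ (m, m') * (\<Sum>a<n. \<Sum>e<n. F $$ (k * n + m', a * n + e) *
        (\<Sum>b<n. W $$ (x * n + a, y * n + b) * G $$ (b * n + e, l * n + m))))" if m: "m < n" for m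
  proof -
    let ?y = "(y * n + l) * n + m"
    have y: "?y < c * n * n" using lt m by (intro pair_less_assoc)
    have ix: "(x * n + a) * n + e = x * (n * n) + (a * n + e)" for x a e by (simp add: algebra_simps)
    have G: "kron (1\<^sub>m c) G $$ ((x' * n + b) * n + e, ?y) = (if x' = y then G $$ (b * n + e, l * n + m) else 0)"
      if "x' < c" "b < n" "e < n" for x' b e
      unfolding ix using kron_index[OF one_carrier_mat cs(3), of x' c y "b * n + e" "l * n + m"] that lt m
      by (simp add: pair_less)
    have 3: "?X3 $$ ((x * n + a) * n + e, ?y) = (\<Sum>b<n. W $$ (x * n + a, y * n + b) * G $$ (b * n + e, l * n + m))"
      if "a < n" "e < n" for a e
    proof -
      have "?X3 $$ ((x * n + a) * n + e, ?y) = (\<Sum>x'<c. \<Sum>b<n. W $$ (x * n + a, x' * n + b) *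
          kron (1\<^sub>m c) G $$ ((x' * n + b) * n + e, ?y))"
        using kron_one_mult_index[OF W ck(3), of "x * n + a" e ?y] that lt y by (simp add: pair_less sum_pairs)
      also have "\<dots> = (\<Sum>x'<c. \<Sum>b<n. if x' = y then W $$ (x * n + a, y * n + b) * G $$ (b * n + e, l * n + m) else 0)"
        by (intro sum.cong refl) (use that in \<open>simp add: G\<close>)
      also have "\<dots> = (\<Sum>b<n. W $$ (x * n + a, y * n + b) * G $$ (b * n + e, l * n + m))"
        using lt by (subst sum.swap) simp
      finally show ?thesis .
    qed
    have 2: "?X2 $$ ((x * n + k) * n + m', ?y) = (\<Sum>a<n. \<Sum>e<n. F $$ (k * n + m', a * n + e) * ?X3 $$ ((x * n + a) * n + e, ?y))"
      if "m' < n" for m'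
      using one_kron_mult_index[OF cs(2) X3[unfolded nn], of x "k * n + m'" ?y] that lt y
      unfolding ix nn by (simp add: pair_less sum_pairs)
    have "(kron (1\<^sub>m (c * n)) D * ?X2) $$ ((x * n + k) * n + m, ?y)
      = (\<Sum>m'<n. D $$ (m, m') * ?X2 $$ ((x * n + k) * n + m', ?y))"
      using one_kron_mult_index[OF cs(1) X2, of "x * n + k" m ?y] m lt y by (simp add: pair_less)
    also have "\<dots> = (\<Sum>m'<n. D $$ (m, m') * (\<Sum>a<n. \<Sum>e<n. F $$ (k * n + m', a * n + e) *
        (\<Sum>b<n. W $$ (x * n + a, y * n + b) * G $$ (b * n + e, l * n + m))))"
      by (intro sum.cong refl arg_cong2[where f = "(*)"]) (simp add: 2 3)
    finally show ?thesis .
  qed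
  then show ?thesis using lt by (simp add: ptrace2_index pair_less sum_distrib_left)
qed

lemma empty_mat_eq: "A \<in> carrier_mat 0 0 \<Longrightarrow> B \<in> carrier_mat 0 0 \<Longrightarrow> A = B"
  by (auto simp: mat_eq_iff)

lemma ptrace2_kron:
  fixes A X :: "'a::semiring_1 mat"
  assumes A: "A \<in> carrier_mat d d" and X: "X \<in> carrier_mat (e * f) (e * f)"
  shows "ptrace2 (d * e) f (kron A X) = kron A (ptrace2 e f X)"
proof (rule mat_pair_eqI[of _ d e])
  fix i k j l assume lt: "i < d" "k < e" "j < d" "l < e"
  have "ptrace2 (d * e) f (kron A X) $$ (i * e + k, j * e + l)
      = (\<Sum>z<f. kron A X $$ (i * (e * f) + (k * f + z), j * (e * f) + (l * f + z)))"
    using lt by (simp add: ptrace2_index pair_less distrib_right mult.assoc add.assoc)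
  also have "\<dots> = (\<Sum>z<f. A $$ (i, j) * X $$ (k * f + z, l * f + z))"
    using lt by (intro sum.cong refl kron_index[OF A X]) (auto intro!: pair_less)
  also have "\<dots> = kron A (ptrace2 e f X) $$ (i * e + k, j * e + l)"
    using lt by (simp add: kron_index[OF A ptrace2_carrier] ptrace2_index sum_distrib_left)
  finally show "ptrace2 (d * e) f (kron A X) $$ (i * e + k, j * e + l)
      = kron A (ptrace2 e f X) $$ (i * e + k, j * e + l)" .
qed (use A in simp_all)

text \<open>Passing to the ring right away makes products associate without side conditions on
  dimensions.\<close>

definition opr :: "nat \<Rightarrow> nat \<Rightarrow> nat \<Rightarrow> nat \<Rightarrow> 'a::ring_1 mat \<Rightarrow> 'a seq_endo" where
  "opr n m i r X = embed (n ^ m) (act n m i r X)"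

lemma opr_mult:
  assumes "X \<in> carrier_mat (n ^ r) (n ^ r)" "Y \<in> carrier_mat (n ^ r) (n ^ r)" "1 \<le> i" "i + r \<le> Suc m"
  shows "opr n m i r (X * Y) = opr n m i r X * opr n m i r Y"
  unfolding opr_def act_mult[OF assms(1,2)] using assms by (intro embed_mult act_carrier)

lemma opr_one: "n > 0 \<Longrightarrow> 1 \<le> i \<Longrightarrow> i + r \<le> Suc m \<Longrightarrow> opr n m i r (1\<^sub>m (n ^ r)) = 1"
  by (simp add: opr_def act_one embed_one)

lemma opr_commute:
  assumes "X \<in> carrier_mat (n ^ r) (n ^ r)" "Y \<in> carrier_mat (n ^ s) (n ^ s)"
    and "1 \<le> i" "i + r \<le> j" "j + s \<le> Suc m" "central_mat X \<or> central_mat Y"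
  shows "opr n m i r X * opr n m j s Y = opr n m j s Y * opr n m i r X"
proof -
  have c: "act n m i r X \<in> carrier_mat (n ^ m) (n ^ m)" "act n m j s Y \<in> carrier_mat (n ^ m) (n ^ m)"
    using assms by (auto intro!: act_carrier)
  show ?thesis
    unfolding opr_def embed_mult[OF c, symmetric] embed_mult[OF c(2,1), symmetric] act_commute[OF assms] ..
qed

lemma opr_braid:
  fixes A B C A' B' C' :: "'a::ring_1 mat"
  assumes eq: "act n 3 a 2 A * act n 3 b 2 B * act n 3 c 2 C = act n 3 a' 2 A' * act n 3 b' 2 B' * act n 3 c' 2 C'"
    and cs: "A \<in> carrier_mat (n^2) (n^2)" "B \<in> carrier_mat (n^2) (n^2)" "C \<in> carrier_mat (n^2) (n^2)"
      "A' \<in> carrier_mat (n^2) (n^2)" "B' \<in> carrier_mat (n^2) (n^2)" "C' \<in> carrier_mat (n^2) (n^2)"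
    and ab: "a \<in> {1,2}" "b \<in> {1,2}" "c \<in> {1,2}" "a' \<in> {1,2}" "b' \<in> {1,2}" "c' \<in> {1,2}"
    and i: "1 \<le> i" "i + 2 \<le> m"
  shows "opr n m (i + a - 1) 2 A * opr n m (i + b - 1) 2 B * opr n m (i + c - 1) 2 C
    = opr n m (i + a' - 1) 2 A' * opr n m (i + b' - 1) 2 B' * opr n m (i + c' - 1) 2 C'"
proof -
  have c: "act n m (i + a - 1) 2 X \<in> carrier_mat (n ^ m) (n ^ m)"
    if "a \<in> {1,2}" "X \<in> carrier_mat (n^2) (n^2)" for a and X :: "'a mat"
    using that i by (intro act_carrier) auto
  have e: "opr n m (i + a - 1) 2 A * opr n m (i + b - 1) 2 B * opr n m (i + c - 1) 2 C
    = embed (n ^ m) (act n m (i + a - 1) 2 A * act n m (i + b - 1) 2 B * act n m (i + c - 1) 2 C)"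
    if "a \<in> {1,2}" "b \<in> {1,2}" "c \<in> {1,2}" "A \<in> carrier_mat (n^2) (n^2)"
      "B \<in> carrier_mat (n^2) (n^2)" "C \<in> carrier_mat (n^2) (n^2)" for a b c and A B C :: "'a mat"
    unfolding opr_def
    using embed_mult[OF mult_carrier_mat[OF c[OF that(1,4)] c[OF that(2,5)]] c[OF that(3,6)]]
      embed_mult[OF c[OF that(1,4)] c[OF that(2,5)]] by simp
  show ?thesis
    unfolding e[OF ab(1-3) cs(1-3)] e[OF ab(4-6) cs(4-6)] act_braid[OF eq cs ab i] ..
qed

section \<open>The operator D and injectivity of the contraction with F\<close>

locale braided_space =
  fixes n :: nat and F :: "'k::field mat"
  assumes F_yb: "yang_baxter n F" and D_unique: "\<exists>!D. is_D n F D"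
begin

abbreviation "Fi \<equiv> mat_inv F"
abbreviation "D \<equiv> D_op n F"

lemma F_carrier [simp]: "F \<in> carrier_mat (n ^ 2) (n ^ 2)"
  using F_yb by (simp add: yang_baxter_def)

lemma Fi_carrier [simp]: "Fi \<in> carrier_mat (n ^ 2) (n ^ 2)"
  using F_yb by (intro carrier_mat_mat_inv) (auto simp: yang_baxter_def)

lemma F_Fi: "F * Fi = 1\<^sub>m (n ^ 2)" and Fi_F: "Fi * F = 1\<^sub>m (n ^ 2)"
proof -
  have "invertible_mat F" using F_yb by (simp add: yang_baxter_def)
  from carrier_mat_mat_inv(2,3)[OF F_carrier this]
  show "F * Fi = 1\<^sub>m (n ^ 2)" "Fi * F = 1\<^sub>m (n ^ 2)"
    by (simp_all only: inverts_mat_def carrier_matD(1)[OF F_carrier] carrier_matD(1)[OF Fi_carrier])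
qed

lemma is_D_D: "is_D n F D"
  unfolding D_op_def using D_unique by (rule theI')

lemma D_carrier [simp]: "D \<in> carrier_mat n n"
  using is_D_D by (simp add: is_D_def)

lemma is_D_iff:
  "is_D n F X \<longleftrightarrow> X \<in> carrier_mat n n \<and>
    (\<forall>i<n. \<forall>j<n. (\<Sum>a<n. \<Sum>b<n. F $$ (i * n + a, j * n + b) * X $$ (b, a)) = (if i = j then 1 else 0))"
proof (cases "X \<in> carrier_mat n n")
  case X: True
  have "ptrace2 n n (F * act n 2 2 1 X) $$ (i, j) = (\<Sum>a<n. \<Sum>b<n. F $$ (i * n + a, j * n + b) * X $$ (b, a))"
    if ij: "i < n" "j < n" for i j
    unfolding ptrace2_index[OF ij]
  proof (intro sum.cong refl)
    fix a assume "a \<in> {..<n}"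
    then have "(F * kron (1\<^sub>m n) X) $$ (i * n + a, j * n + a)
        = (\<Sum>b<n. F $$ (i * n + a, j * n + b) * X $$ (b, a))"
      using ij F_carrier by (intro mult_one_kron_index[OF X, of _ "n * n"])
        (auto simp: power2_eq_square pair_less)
    then show "(F * act n 2 2 1 X) $$ (i * n + a, j * n + a)
        = (\<Sum>b<n. F $$ (i * n + a, j * n + b) * X $$ (b, a))"
      using X kron_carrier[OF one_carrier_mat X, of n] by (simp add: act_def kron_one_right[of _ "n * n"])
  qed
  then show ?thesis
    unfolding is_D_def using X by (auto simp: mat_eq_iff ptrace2_def)
qed (simp add: is_D_def)

text \<open>Uniqueness of \<open>D\<close> says that the linear map \<open>X \<mapsto> Tr\<^sub>2 (F X\<^sub>2)\<close> is injective.\<close>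

lemma skew_injective:
  assumes "\<And>i j. i < n \<Longrightarrow> j < n \<Longrightarrow> (\<Sum>a<n. \<Sum>b<n. F $$ (i * n + a, j * n + b) * z b a) = 0"
    and "a < n" "b < n"
  shows "z b a = 0"
proof -
  \<comment> \<open>An element of the kernel, added to D, gives a second solution of the defining
    equation.\<close>
  have "is_D n F (D + mat n n (\<lambda>(b, a). z b a))"
    using is_D_D assms(1) unfolding is_D_iff by (simp add: distrib_left sum.distrib)
  then have "D + mat n n (\<lambda>(b, a). z b a) = D" using D_unique is_D_D by blast
  then have "(D + mat n n (\<lambda>(b, a). z b a)) $$ (b, a) = D $$ (b, a)" by simp
  then show ?thesis using assms(2,3) D_carrier by simp
qed

text \<open>The defining equation of D, placed in the last two of p + 2 copies; the first p copies
  are inert under the trace.\<close>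

lemma trace_F_D:
  "ptrace2 (n ^ Suc p) n (act n (p + 2) (Suc p) 2 F * act n (p + 2) (p + 2) 1 D) = 1\<^sub>m (n ^ Suc p)"
proof -
  have D2: "act n 2 2 1 D \<in> carrier_mat (n ^ 2) (n ^ 2)" using D_carrier by (intro act_carrier) auto
  have F: "act n (p + 2) (Suc p) 2 F = kron (1\<^sub>m (n ^ p)) F"
    using kron_act_left[OF F_carrier, of 1 2 p] by (simp only: act_full1[OF F_carrier]) simp
  have D: "act n (p + 2) (p + 2) 1 D = kron (1\<^sub>m (n ^ p)) (act n 2 2 1 D)"
    using kron_act_left[of D n 1 2 2 p] D_carrier by simp
  have "act n (p + 2) (Suc p) 2 F * act n (p + 2) (p + 2) 1 D = kron (1\<^sub>m (n ^ p)) (F * act n 2 2 1 D)"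
    unfolding F D using kron_mult[OF one_carrier_mat F_carrier one_carrier_mat D2, of "n ^ p"] by simp
  moreover have "ptrace2 (n ^ p * n) n (kron (1\<^sub>m (n ^ p)) (F * act n 2 2 1 D))
      = kron (1\<^sub>m (n ^ p)) (ptrace2 n n (F * act n 2 2 1 D))"
    using mult_carrier_mat[OF F_carrier D2] by (intro ptrace2_kron) (simp_all add: power2_eq_square)
  ultimately show ?thesis
    using is_D_D by (simp add: is_D_def kron_one_one mult.commute)
qed

text \<open>The identity \<open>Tr\<^sub>2 (D\<^sub>2 F X\<^sub>1 F\<inverse>) = tr (D X) I\<close> for the matrix unit \<open>X\<close> in position
  \<open>(a, b)\<close>, in entries. By skew invertibility \<open>X\<close> may be replaced by the second leg of \<open>F\<close>, and then
  the identity follows from \<open>F\<^sub>2 F\<^sub>1 F\<^sub>2\<inverse> = F\<^sub>1\<inverse> F\<^sub>2 F\<^sub>1\<close> by applying \<open>Tr\<^sub>3 (D\<^sub>3 \<cdot>)\<close>.\<close>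

lemma conj_trace_index:
  assumes "a < n" "b < n" "k < n" "l < n"
  shows "(\<Sum>m<n. \<Sum>m'<n. \<Sum>c<n. D $$ (m, m') * F $$ (k * n + m', a * n + c) * Fi $$ (b * n + c, l * n + m))
    = (if k = l then D $$ (b, a) else 0)"
proof -
  define w where "w b a = (\<Sum>m<n. \<Sum>m'<n. \<Sum>c<n.
    D $$ (m, m') * F $$ (k * n + m', a * n + c) * Fi $$ (b * n + c, l * n + m))" for b a
  have n: "n > 0" using assms by simp
  let ?F1 = "act n 3 1 2 F" and ?F2 = "act n 3 2 2 F" and ?G1 = "act n 3 1 2 Fi" and ?G2 = "act n 3 2 2 Fi"
  let ?D3 = "act n 3 3 1 D" and ?e = "embed (n ^ 3)"
  have cs: "?F1 \<in> carrier_mat (n ^ 3) (n ^ 3)" "?F2 \<in> carrier_mat (n ^ 3) (n ^ 3)"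
    "?G1 \<in> carrier_mat (n ^ 3) (n ^ 3)" "?G2 \<in> carrier_mat (n ^ 3) (n ^ 3)"
    "?D3 \<in> carrier_mat (n ^ 3) (n ^ 3)"
    using D_carrier by (auto intro!: act_carrier)
  have inv: "?e ?G1 * ?e ?F1 = 1" "?e ?F2 * ?e ?G2 = 1"
    unfolding embed_mult[OF cs(3,1), symmetric] embed_mult[OF cs(2,4), symmetric]
      act_mult[OF F_carrier Fi_carrier, symmetric] act_mult[OF Fi_carrier F_carrier, symmetric] F_Fi Fi_F
    using n by (simp_all add: act_one embed_one)
  have "?e (?F1 * ?F2 * ?F1) = ?e (?F2 * ?F1 * ?F2)" using F_yb by (simp add: yang_baxter_def)
  then have yb: "?e ?F1 * ?e ?F2 * ?e ?F1 = ?e ?F2 * ?e ?F1 * ?e ?F2"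
    using cs by (simp add: embed_mult[of _ "n ^ 3"] mult_carrier_mat[of _ _ "n ^ 3"])
  have "?e ?F2 * ?e ?F1 * ?e ?G2 = ?e ?G1 * (?e ?F1 * ?e ?F2 * ?e ?F1) * ?e ?G2"
    unfolding mult.assoc[symmetric] inv by simp
  also have "\<dots> = ?e ?G1 * ?e ?F2 * ?e ?F1"
    unfolding yb by (simp only: mult.assoc inv mult_1_right)
  finally have conj: "?e ?F2 * ?e ?F1 * ?e ?G2 = ?e ?G1 * ?e ?F2 * ?e ?F1" .
  have DG: "?D3 * ?G1 = ?G1 * ?D3"
    by (rule act_commute[symmetric]) (use D_carrier in auto)
  have "?e (?D3 * (?F2 * (?F1 * ?G2))) = ?e ?D3 * (?e ?F2 * ?e ?F1 * ?e ?G2)"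
    using cs by (simp add: embed_mult[of _ "n ^ 3"] mult_carrier_mat[of _ _ "n ^ 3"] mult.assoc)
  also have "\<dots> = ?e (?D3 * ?G1) * ?e ?F2 * ?e ?F1"
    unfolding conj embed_mult[OF cs(5,3)] by (simp only: mult.assoc)
  also have "\<dots> = ?e (?G1 * (?D3 * ?F2 * ?F1))"
    unfolding DG using cs by (simp add: embed_mult[of _ "n ^ 3"] mult_carrier_mat[of _ _ "n ^ 3"] mult.assoc)
  finally have eq: "?D3 * (?F2 * (?F1 * ?G2)) = ?G1 * (?D3 * ?F2 * ?F1)"
    using cs by (subst (asm) embed_eq_iff) (auto simp: mult_carrier_mat[of _ _ "n ^ 3"])
  \<comment> \<open>The defining equation has D to the right of F; cyclicity in the traced copy
    brings it to the left.\<close>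
  have tr: "ptrace2 (n ^ 2) n (?D3 * ?F2) = 1\<^sub>m (n ^ 2)"
  proof -
    have "?D3 = kron (1\<^sub>m (n ^ 2)) D" using D_carrier by (simp add: act_def kron_one_right[of _ "n ^ 2 * n"])
    then have "ptrace2 (n ^ 2) n (?D3 * ?F2) = ptrace2 (n ^ 2) n (?F2 * ?D3)"
      using ptrace2_cyclic[OF D_carrier, of ?F2 "n ^ 2"] cs(2)
      by (simp add: power3_eq_cube power2_eq_square)
    also have "\<dots> = 1\<^sub>m (n ^ 2)"
      using trace_F_D[of 1] by (simp add: eval_nat_numeral)
    finally show ?thesis .
  qed
  have n3: "n ^ 3 = n ^ 2 * n" by (simp add: power3_eq_cube power2_eq_square)
  have k1: "act n 3 1 2 X = kron X (1\<^sub>m n)" if "X \<in> carrier_mat (n ^ 2) (n ^ 2)" for X :: "'k mat"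
    using that by (simp add: act_def)
  \<comment> \<open>The outer operators F_1 and its inverse do not touch the third copy, so they
    leave the trace, where they cancel.\<close>
  have "ptrace2 (n ^ 2) n (?D3 * (?F2 * (?F1 * ?G2))) = Fi * (ptrace2 (n ^ 2) n (?D3 * ?F2) * F)"
    unfolding eq unfolding k1[OF F_carrier] k1[OF Fi_carrier] using cs n3
    by (subst ptrace2_kron_left[OF Fi_carrier], simp add: mult_carrier_mat[of _ _ "n ^ 3"] k1[OF F_carrier, symmetric])
      (subst ptrace2_kron_right[OF F_carrier], simp_all add: mult_carrier_mat[of _ _ "n ^ 3"])
  then have trace: "ptrace2 (n ^ 2) n (?D3 * (?F2 * (?F1 * ?G2))) = 1\<^sub>m (n ^ 2)"
    using Fi_F F_carrier unfolding tr by simp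
  \<comment> \<open>For fixed k and l, the array \<open>w\<close> has the same image under the
    injective contraction as D multiplied by the Kronecker delta of k and l.\<close>
  have entry: "(\<Sum>a<n. \<Sum>b<n. F $$ (i * n + a, j * n + b) * w b a) = (if i = j \<and> k = l then 1 else 0)"
    if ij: "i < n" "j < n" for i j
  proof -
    have "(if i = j \<and> k = l then 1 else 0) = ptrace2 (n ^ 2) n (?D3 * (?F2 * (?F1 * ?G2))) $$ (i * n + k, j * n + l)"
      unfolding trace using ij assms by (simp add: power2_eq_square pair_less pair_eq_iff)
    also have "\<dots> = (\<Sum>m<n. \<Sum>m'<n. \<Sum>a<n. \<Sum>c<n. \<Sum>b<n.
      D $$ (m, m') * (F $$ (k * n + m', a * n + c) * (F $$ (i * n + a, j * n + b) * Fi $$ (b * n + c, l * n + m))))"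
    proof -
      have c2: "D \<in> carrier_mat n n" "F \<in> carrier_mat (n * n) (n * n)" "Fi \<in> carrier_mat (n * n) (n * n)"
        using D_carrier F_carrier Fi_carrier by (simp_all only: power2_eq_square)
      have "?D3 = kron (1\<^sub>m (n * n)) D" "?F2 = kron (1\<^sub>m n) F" "?F1 = kron F (1\<^sub>m n)" "?G2 = kron (1\<^sub>m n) Fi"
        using c2 kron_carrier[OF one_carrier_mat c2(1), of "n * n"] kron_carrier[OF one_carrier_mat c2(2), of n]
          kron_carrier[OF one_carrier_mat c2(3), of n]
        by (simp_all add: act_def power2_eq_square kron_one_right[of _ "n * n * n"] kron_one_right[of _ "n * (n * n)"]
          kron_one_left[of _ "n * n"])
      then show ?thesis
        using ptrace2_sandwich_index[OF c2 c2(2) ij(1) assms(3) ij(2) assms(4)] by (simp only: power2_eq_square)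
    qed
    also have "\<dots> = (\<Sum>a<n. \<Sum>b<n. \<Sum>m<n. \<Sum>m'<n. \<Sum>c<n.
      D $$ (m, m') * (F $$ (k * n + m', a * n + c) * (F $$ (i * n + a, j * n + b) * Fi $$ (b * n + c, l * n + m))))"
      unfolding sum.cartesian_product
      by (rule sum.reindex_bij_witness[of _ "\<lambda>(a,b,m,m',c). (m,m',a,c,b)" "\<lambda>(m,m',a,c,b). (a,b,m,m',c)"]) auto
    also have "\<dots> = (\<Sum>a<n. \<Sum>b<n. F $$ (i * n + a, j * n + b) * w b a)"
      by (simp add: w_def sum_distrib_left mult_ac)
    finally show ?thesis by simp
  qed
  have "w b a - (if k = l then D $$ (b, a) else 0) = 0"
  proof (rule skew_injective[OF _ assms(1,2)])
    fix i j assume ij: "i < n" "j < n"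
    have "(\<Sum>a<n. \<Sum>b<n. F $$ (i * n + a, j * n + b) * (w b a - (if k = l then D $$ (b, a) else 0)))
      = (\<Sum>a<n. \<Sum>b<n. F $$ (i * n + a, j * n + b) * w b a)
        - (if k = l then (\<Sum>a<n. \<Sum>b<n. F $$ (i * n + a, j * n + b) * D $$ (b, a)) else 0)"
      by (simp add: right_diff_distrib sum_subtractf)
    also have "\<dots> = 0"
      unfolding entry[OF ij] using is_D_D ij by (simp add: is_D_iff)
    finally show "(\<Sum>a<n. \<Sum>b<n. F $$ (i * n + a, j * n + b) * (w b a - (if k = l then D $$ (b, a) else 0))) = 0" .
  qed
  then show ?thesis by (simp add: w_def)
qed

text \<open>In entries this is a contraction of Y with four factors F, removed one at a time by
  \<open>skew_injective\<close>. A factor can be removed when its outer indices are free, and each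
  removal frees the inner ones for the others; this forces F_1 to go before the outer F_2 and the
  inner F_2, and F_3 to go last.\<close>

lemma skew_injective2:
  assumes Y: "Y \<in> carrier_mat (n ^ 2) (n ^ 2)"
    and tr: "ptrace2 (n ^ 2) (n ^ 2) (act n 4 2 2 F * (act n 4 1 2 F * (act n 4 3 2 F * (act n 4 2 2 F * act n 4 3 2 Y))))
      = 0\<^sub>m (n ^ 2) (n ^ 2)"
  shows "Y = 0\<^sub>m (n ^ 2) (n ^ 2)"
proof -
  define ix where "ix p q r s = ((p * n + q) * n + r) * n + s" for p q r s
  let ?F1 = "act n 4 1 2 F" and ?F2 = "act n 4 2 2 F" and ?F3 = "act n 4 3 2 F" and ?Y = "act n 4 3 2 Y"
  have cs: "?F1 \<in> carrier_mat (n ^ 4) (n ^ 4)" "?F2 \<in> carrier_mat (n ^ 4) (n ^ 4)"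
    "?F3 \<in> carrier_mat (n ^ 4) (n ^ 4)" "?Y \<in> carrier_mat (n ^ 4) (n ^ 4)"
    using Y by (auto intro!: act_carrier)
  have n4: "n ^ 4 = n * (n * n) * n" "n ^ 4 = n * n * (n * n)" "n ^ 4 = n * n * n * n"
    by (simp_all add: power4_eq_xxxx)
  have Fn: "F \<in> carrier_mat (n * n) (n * n)" using F_carrier by (simp add: power2_eq_square)
  have ix_less: "ix p q r s < n ^ 4" if "p < n" "q < n" "r < n" "s < n" for p q r s
    unfolding ix_def n4(3) using that by (intro pair_less)
  have ix22: "ix p q r s = (p * n + q) * (n * n) + (r * n + s)" for p q r s
    by (simp add: ix_def algebra_simps)
  have row1: "(?F1 * X) $$ (ix i j k l, y) = (\<Sum>p<n. \<Sum>r<n. F $$ (i * n + j, p * n + r) * X $$ (ix p r k l, y))"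
    if "X \<in> carrier_mat (n ^ 4) (n ^ 4)" "i < n" "j < n" "k < n" "l < n" "y < n ^ 4" for X i j k l y
    using act_two_index[OF Fn, of X 1 "n * n" "n ^ 4" 0 i j "k * n + l" y] that
    by (simp add: act_def ix22 n4(2) pair_less power2_eq_square)
  have row2: "(?F2 * X) $$ (ix i j k l, y) = (\<Sum>p<n. \<Sum>r<n. F $$ (j * n + k, p * n + r) * X $$ (ix i p r l, y))"
    if "X \<in> carrier_mat (n ^ 4) (n ^ 4)" "i < n" "j < n" "k < n" "l < n" "y < n ^ 4" for X i j k l y
    using act_two_index[OF Fn, of X n n "n ^ 4" i j k l y] that
    by (simp add: act_def ix_def n4(1) power2_eq_square)
  have row3: "(?F3 * X) $$ (ix i j k l, y) = (\<Sum>p<n. \<Sum>r<n. F $$ (k * n + l, p * n + r) * X $$ (ix i j p r, y))"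
    if "X \<in> carrier_mat (n ^ 4) (n ^ 4)" "i < n" "j < n" "k < n" "l < n" "y < n ^ 4" for X i j k l y
    using act_two_index[OF Fn, of X "n * n" 1 "n ^ 4" "i * n + j" k l 0 y] that
    by (simp add: act_def ix_def n4(2) pair_less power2_eq_square)
  have Y3: "?Y $$ (ix p v w u, ix j1 j2 c d) = (if p = j1 \<and> v = j2 then Y $$ (w * n + u, c * n + d) else 0)"
    if "p < n" "v < n" "w < n" "u < n" "j1 < n" "j2 < n" "c < n" "d < n" for p v w u j1 j2 c d
  proof -
    have "?Y = kron (1\<^sub>m (n * n)) Y"
      using Y kron_carrier[OF one_carrier_mat Y, of "n * n"] by (simp add: act_def power2_eq_square
        kron_one_right[of _ "n * n * (n * n)"])
    then show ?thesis unfolding ix22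
      using kron_index[of "1\<^sub>m (n * n)" "n * n" Y "n * n" "p * n + v" "j1 * n + j2" "w * n + u" "c * n + d"] that Y
      by (simp add: pair_less power2_eq_square pair_eq_iff)
  qed
  have del: "(\<Sum>v<n. \<Sum>w<n. f v w * (if p = j1 \<and> v = j2 then g w else 0)) = (if p = j1 then (\<Sum>w<n. f j2 w * g w) else 0)"
    if "j2 < n" for f :: "nat \<Rightarrow> nat \<Rightarrow> 'k" and g p j1 j2
    using that by (subst sum.swap) (simp add: if_distrib[of "(*) _"] cong: if_cong)
  have del': "(\<Sum>p<n. \<Sum>s<n. f p s * (if p = j1 then g s else 0)) = (\<Sum>s<n. f j1 s * g s)"
    if "j1 < n" for f :: "nat \<Rightarrow> nat \<Rightarrow> 'k" and g j1
    using that by (subst sum.swap) (simp add: if_distrib[of "(*) _"] cong: if_cong)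
  have main: "(\<Sum>c<n. \<Sum>d<n. \<Sum>p<n. \<Sum>r<n. \<Sum>s<n. \<Sum>t<n. \<Sum>u<n. \<Sum>w<n.
      F $$ (i2 * n + c, p * n + r) * (F $$ (i1 * n + p, j1 * n + s) * (F $$ (r * n + d, t * n + u) *
        (F $$ (s * n + t, j2 * n + w) * Y $$ (w * n + u, c * n + d))))) = 0"
    if lt: "i1 < n" "i2 < n" "j1 < n" "j2 < n" for i1 i2 j1 j2
  proof -
    have c': "?F2 * ?Y \<in> carrier_mat (n ^ 4) (n ^ 4)" "?F3 * (?F2 * ?Y) \<in> carrier_mat (n ^ 4) (n ^ 4)"
      "?F1 * (?F3 * (?F2 * ?Y)) \<in> carrier_mat (n ^ 4) (n ^ 4)"
      using cs by (simp_all add: mult_carrier_mat[of _ _ "n ^ 4"])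
    have "(?F2 * (?F1 * (?F3 * (?F2 * ?Y)))) $$ (ix i1 i2 c d, ix j1 j2 c d) =
      (\<Sum>p<n. \<Sum>r<n. F $$ (i2 * n + c, p * n + r) * (\<Sum>s<n. F $$ (i1 * n + p, j1 * n + s) *
        (\<Sum>t<n. \<Sum>u<n. F $$ (r * n + d, t * n + u) *
        (\<Sum>w<n. F $$ (s * n + t, j2 * n + w) * Y $$ (w * n + u, c * n + d)))))"
      if cd: "c < n" "d < n" for c d
    proof -
      have y: "ix j1 j2 c d < n ^ 4" using ix_less lt cd by blast
      have a: "(?F2 * ?Y) $$ (ix p' s t u, ix j1 j2 c d)
        = (if p' = j1 then (\<Sum>w<n. F $$ (s * n + t, j2 * n + w) * Y $$ (w * n + u, c * n + d)) else 0)"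
        if "p' < n" "s < n" "t < n" "u < n" for p' s t u
        using row2[OF cs(4) that y] that lt cd by (simp add: Y3 del)
      have b: "(?F3 * (?F2 * ?Y)) $$ (ix p' s r d, ix j1 j2 c d)
        = (if p' = j1 then (\<Sum>t<n. \<Sum>u<n. F $$ (r * n + d, t * n + u) *
            (\<Sum>w<n. F $$ (s * n + t, j2 * n + w) * Y $$ (w * n + u, c * n + d))) else 0)"
        if "p' < n" "s < n" "r < n" for p' s r
        using row3[OF c'(1) that cd(2) y] that lt cd by (simp add: a)
      have e: "(?F1 * (?F3 * (?F2 * ?Y))) $$ (ix i1 p r d, ix j1 j2 c d)
        = (\<Sum>s<n. F $$ (i1 * n + p, j1 * n + s) * (\<Sum>t<n. \<Sum>u<n. F $$ (r * n + d, t * n + u) *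
            (\<Sum>w<n. F $$ (s * n + t, j2 * n + w) * Y $$ (w * n + u, c * n + d))))"
        if "p < n" "r < n" for p r
        using row1[OF c'(2) lt(1) that(1,2) cd(2) y] that lt cd by (simp add: b del')
      show ?thesis
        unfolding row2[OF c'(3) lt(1,2) cd y]
        by (intro sum.cong refl arg_cong2[where f = "(*)"] e) auto
    qed
    note entry = this
    have "0 = ptrace2 (n ^ 2) (n ^ 2) (?F2 * (?F1 * (?F3 * (?F2 * ?Y)))) $$ (i1 * n + i2, j1 * n + j2)"
      unfolding tr using lt by (simp add: pair_less power2_eq_square)
    also have "\<dots> = (\<Sum>c<n. \<Sum>d<n. (?F2 * (?F1 * (?F3 * (?F2 * ?Y)))) $$ (ix i1 i2 c d, ix j1 j2 c d))"
      unfolding ix22 using lt by (simp add: pair_less power2_eq_square ptrace2_index sum_pairs)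
    also have "\<dots> = (\<Sum>c<n. \<Sum>d<n. \<Sum>p<n. \<Sum>r<n. \<Sum>s<n. \<Sum>t<n. \<Sum>u<n. \<Sum>w<n.
      F $$ (i2 * n + c, p * n + r) * (F $$ (i1 * n + p, j1 * n + s) * (F $$ (r * n + d, t * n + u) *
        (F $$ (s * n + t, j2 * n + w) * Y $$ (w * n + u, c * n + d)))))"
      by (intro sum.cong refl, subst entry) (auto simp: sum_distrib_left)
    finally show ?thesis by simp
  qed
  \<comment> \<open>F_1 is removed: \<open>i1\<close>, \<open>j1\<close> are its free indices, and
    its contracted indices \<open>p\<close>, \<open>s\<close> become free for the next two
    removals.\<close>
  have stage1: "(\<Sum>c<n. \<Sum>d<n. \<Sum>r<n. \<Sum>t<n. \<Sum>u<n. \<Sum>w<n.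
      F $$ (i2 * n + c, p * n + r) * (F $$ (r * n + d, t * n + u) *
        (F $$ (s * n + t, j2 * n + w) * Y $$ (w * n + u, c * n + d)))) = 0"
    if lt: "i2 < n" "j2 < n" and sp: "p < n" "s < n" for i2 j2 p s
  proof (rule skew_injective[OF _ sp], goal_cases)
    case (1 x y)
    show ?case
      unfolding main[OF 1(1) lt(1) 1(2) lt(2), symmetric] sum_distrib_left unfolding sum.cartesian_product
      by (rule sum.reindex_bij_witness[of _ "\<lambda>(c,d,p,r,s,t,u,w). (p,s,c,d,r,t,u,w)"
          "\<lambda>(p,s,c,d,r,t,u,w). (c,d,p,r,s,t,u,w)"]) (auto simp: mult_ac)
  qed
  have stage2: "(\<Sum>d<n. \<Sum>t<n. \<Sum>u<n. \<Sum>w<n. F $$ (r * n + d, t * n + u) *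
        (F $$ (s * n + t, j2 * n + w) * Y $$ (w * n + u, c * n + d))) = 0"
    if lt: "j2 < n" "s < n" and cr: "c < n" "r < n" for j2 s c r
  proof (rule skew_injective[OF _ cr], goal_cases)
    case (1 x y)
    show ?case
      unfolding stage1[OF 1(1) lt(1) 1(2) lt(2), symmetric] sum_distrib_left unfolding sum.cartesian_product
      by (rule sum.reindex_bij_witness[of _ "\<lambda>(c,d,r,t,u,w). (c,r,d,t,u,w)"
          "\<lambda>(c,r,d,t,u,w). (c,d,r,t,u,w)"]) (auto simp: mult_ac)
  qed
  have stage3: "(\<Sum>d<n. \<Sum>u<n. F $$ (r * n + d, t * n + u) * Y $$ (w * n + u, c * n + d)) = 0"
    if lt: "c < n" "r < n" and tw: "t < n" "w < n" for c r t w
  proof (rule skew_injective[OF _ tw], goal_cases)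
    case (1 x y)
    show ?case
      unfolding stage2[OF 1(2,1) lt, symmetric] sum_distrib_left unfolding sum.cartesian_product
      by (rule sum.reindex_bij_witness[of _ "\<lambda>(d,t,u,w). (t,w,d,u)"
          "\<lambda>(t,w,d,u). (d,t,u,w)"]) (auto simp: mult_ac)
  qed
  show ?thesis
  proof (rule mat_pair_eqI[of _ n n])
    fix w u c d assume lt: "w < n" "u < n" "c < n" "d < n"
    have "Y $$ (w * n + u, c * n + d) = 0"
      by (rule skew_injective[where z = "\<lambda>u d. Y $$ (w * n + u, c * n + d)", OF _ lt(4,2)])
        (rule stage3; use lt in simp)
    then show "Y $$ (w * n + u, c * n + d) = 0\<^sub>m (n ^ 2) (n ^ 2) $$ (w * n + u, c * n + d)"
      using lt by (simp add: pair_less power2_eq_square)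
  qed (use Y in \<open>simp_all add: power2_eq_square\<close>)
qed

section \<open>Braiding pairs of copies, and the commutation of D tensor D with compatible
  operators\<close>

text \<open>\<open>F\<^sub>2 F\<^sub>1 F\<^sub>3 F\<^sub>2\<close> exchanges the pairs of copies \<open>1, 2\<close> and \<open>3, 4\<close>.\<close>

definition "double_F = act n 4 2 2 F * (act n 4 1 2 F * (act n 4 3 2 F * act n 4 2 2 F))"

lemma act4_carrier: "X \<in> carrier_mat (n ^ 2) (n ^ 2) \<Longrightarrow> i \<in> {1,2,3} \<Longrightarrow> act n 4 i 2 X \<in> carrier_mat (n ^ 4) (n ^ 4)"
  by (intro act_carrier) auto

lemma double_F_carrier: "double_F \<in> carrier_mat (n ^ 4) (n ^ 4)"
  unfolding double_F_def by (intro mult_carrier_mat[of _ _ "n ^ 4"] act4_carrier) auto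

lemma F_self_compatible: "compatible_pair n F F"
  using F_yb by (simp add: yang_baxter_def compatible_pair_def)

lemma compatible_opr:
  assumes "compatible_pair n X F" "X \<in> carrier_mat (n ^ 2) (n ^ 2)" "1 \<le> i" "i + 2 \<le> m"
  shows "opr n m i 2 X * opr n m (i + 1) 2 F * opr n m i 2 F
      = opr n m (i + 1) 2 F * opr n m i 2 F * opr n m (i + 1) 2 X"
    "opr n m (i + 1) 2 X * opr n m i 2 F * opr n m (i + 1) 2 F
      = opr n m i 2 F * opr n m (i + 1) 2 F * opr n m i 2 X"
  using opr_braid[of n 1 X 2 F 1 F 2 F 1 F 2 X i m] opr_braid[of n 2 X 1 F 2 F 1 F 2 F 1 X i m] assms
  by (simp_all add: compatible_pair_def)

text \<open>Compatibility moves X across two factors at a time, from copies 1, 2 to 2, 3 and on to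
  3, 4. For the opposite direction the commuting factors F_1 and F_3 are interchanged first.\<close>

lemma double_F_shift:
  assumes c: "compatible_pair n X F" and X: "X \<in> carrier_mat (n ^ 2) (n ^ 2)"
  shows "act n 4 1 2 X * double_F = double_F * act n 4 3 2 X"
    "act n 4 3 2 X * double_F = double_F * act n 4 1 2 X"
proof -
  let ?x = "\<lambda>i. opr n 4 i 2 X" and ?f = "\<lambda>i. opr n 4 i 2 F" and ?G = "embed (n ^ 4) double_F"
  note cs = act4_carrier[OF X, of 1, simplified] act4_carrier[OF X, of 3, simplified]
  note cF = act4_carrier[OF F_carrier]
  have r: "?x 1 * ?f 2 * ?f 1 = ?f 2 * ?f 1 * ?x 2" "?x 2 * ?f 3 * ?f 2 = ?f 3 * ?f 2 * ?x 3"
    "?x 2 * ?f 1 * ?f 2 = ?f 1 * ?f 2 * ?x 1" "?x 3 * ?f 2 * ?f 3 = ?f 2 * ?f 3 * ?x 2"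
    using compatible_opr[OF c X, of 1 4] compatible_opr[OF c X, of 2 4] by (simp_all del: One_nat_def)
  have f: "?f 1 * ?f 3 = ?f 3 * ?f 1"
    by (rule opr_commute) auto
  have G: "?G = ?f 2 * (?f 1 * (?f 3 * ?f 2))"
    unfolding double_F_def opr_def using cF[of 1] cF[of 2] cF[of 3]
    by (simp add: embed_mult[of _ "n ^ 4"] mult_carrier_mat[of _ _ "n ^ 4"])
  have "?x 1 * ?G = (?x 1 * ?f 2 * ?f 1) * (?f 3 * ?f 2)"
    unfolding G by (simp only: mult.assoc)
  also have "\<dots> = ?f 2 * ?f 1 * (?x 2 * ?f 3 * ?f 2)" unfolding r(1) by (simp only: mult.assoc)
  also have "\<dots> = ?G * ?x 3" unfolding r(2) G by (simp only: mult.assoc)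
  finally have "embed (n ^ 4) (act n 4 1 2 X * double_F) = embed (n ^ 4) (double_F * act n 4 3 2 X)"
    using cs double_F_carrier by (simp add: embed_mult[of _ "n ^ 4"] opr_def)
  then show "act n 4 1 2 X * double_F = double_F * act n 4 3 2 X"
    using cs double_F_carrier by (subst (asm) embed_eq_iff) (auto simp: mult_carrier_mat[of _ _ "n ^ 4"])
  have "?x 3 * ?G = ?x 3 * ?f 2 * (?f 1 * ?f 3) * ?f 2"
    unfolding G by (simp only: mult.assoc)
  also have "\<dots> = (?x 3 * ?f 2 * ?f 3) * (?f 1 * ?f 2)" unfolding f by (simp only: mult.assoc)
  also have "\<dots> = ?f 2 * ?f 3 * (?x 2 * ?f 1 * ?f 2)" unfolding r(4) by (simp only: mult.assoc)
  also have "\<dots> = ?f 2 * (?f 3 * ?f 1) * ?f 2 * ?x 1" unfolding r(3) by (simp only: mult.assoc)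
  also have "\<dots> = ?G * ?x 1" unfolding G f[symmetric] by (simp only: mult.assoc)
  finally have "embed (n ^ 4) (act n 4 3 2 X * double_F) = embed (n ^ 4) (double_F * act n 4 1 2 X)"
    using cs double_F_carrier by (simp add: embed_mult[of _ "n ^ 4"] opr_def)
  then show "act n 4 3 2 X * double_F = double_F * act n 4 1 2 X"
    using cs double_F_carrier by (subst (asm) embed_eq_iff) (auto simp: mult_carrier_mat[of _ _ "n ^ 4"])
qed

definition "DD = act n 2 1 1 D * act n 2 2 1 D"

lemma DD_carrier [simp]: "DD \<in> carrier_mat (n ^ 2) (n ^ 2)"
  unfolding DD_def using D_carrier by (intro mult_carrier_mat[of _ _ "n ^ 2"] act_carrier) auto

text \<open>Since D_4 commutes with D_3 and F_2, it can be placed next to F_3, and the trace over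
  copy 4 replaces F_3 D_4 by I. There remains F_2 F_1 F_2 D_3 = F_1 F_2 F_1 D_3 = F_1 (F_2 D_3) F_1,
  where the trace over copy 3 replaces the middle by I.\<close>

lemma trace_double_F_DD: "ptrace2 (n ^ 2) (n ^ 2) (double_F * act n 4 3 2 DD) = F * F"
proof (cases "n = 0")
  case True
  then show ?thesis
    by (intro empty_mat_eq) (use mult_carrier_mat[OF F_carrier F_carrier] in \<open>simp_all add: ptrace2_def\<close>)
next
  case False
  let ?f = "\<lambda>m i. act n m i 2 F" and ?d = "\<lambda>m i. act n m i 1 D"
  have D1: "D \<in> carrier_mat (n ^ 1) (n ^ 1)" using D_carrier by simp
  have cf: "?f m i \<in> carrier_mat (n ^ m) (n ^ m)" if "1 \<le> i" "i + 2 \<le> Suc m" for m i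
    using that by (intro act_carrier) auto
  have cd: "?d m i \<in> carrier_mat (n ^ m) (n ^ m)" if "1 \<le> i" "i \<le> m" for m i
    using that D_carrier by (intro act_carrier) auto
  note mult = mult_carrier_mat[of _ "n ^ 4" "n ^ 4" _ "n ^ 4"] mult_carrier_mat[of _ "n ^ 3" "n ^ 3" _ "n ^ 3"]
  have a: "act n 4 3 2 DD = ?d 4 3 * ?d 4 4"
  proof -
    have c2: "act n 2 1 1 D \<in> carrier_mat (n ^ 2) (n ^ 2)" "act n 2 2 1 D \<in> carrier_mat (n ^ 2) (n ^ 2)"
      by (intro cd; simp)+
    show ?thesis
      unfolding DD_def act_mult[OF c2]
      using act_act[OF D1, of 1 2 3 4] act_act[OF D1, of 2 2 3 4] by simp
  qed
  define P where "P = ?f 3 2 * ?f 3 1"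
  define Q where "Q = ?f 3 2 * ?d 3 3"
  have PQ: "P \<in> carrier_mat (n ^ 3) (n ^ 3)" "Q \<in> carrier_mat (n ^ 3) (n ^ 3)"
    unfolding P_def Q_def by (auto intro!: mult cf cd)
  have k: "kron X (1\<^sub>m n) * kron Y (1\<^sub>m n) = kron (X * Y) (1\<^sub>m n)"
    if "X \<in> carrier_mat (n ^ 3) (n ^ 3)" "Y \<in> carrier_mat (n ^ 3) (n ^ 3)" for X Y :: "'k mat"
    using kron_mult[OF that(1) one_carrier_mat that(2) one_carrier_mat, of n] by simp
  have kf: "?f 4 1 = kron (?f 3 1) (1\<^sub>m n)" "?f 4 2 = kron (?f 3 2) (1\<^sub>m n)"
    using kron_act_right[OF F_carrier, of 1 3 1] kron_act_right[OF F_carrier, of 2 3 1] by simp_all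
  have kd: "?d 4 3 = kron (?d 3 3) (1\<^sub>m n)"
    using kron_act_right[OF D1, of 3 3 1] by simp
  have KP: "kron P (1\<^sub>m n) = ?f 4 2 * ?f 4 1"
    unfolding P_def kf by (rule k[symmetric]) (auto intro!: cf)
  have KQ: "kron Q (1\<^sub>m n) = ?f 4 2 * ?d 4 3"
    unfolding Q_def kd kf(2) by (rule k[symmetric]) (auto intro!: cf cd)
  let ?E = "embed (n ^ 4)"
  have c1: "?E (?d 4 3) * ?E (?d 4 4) = ?E (?d 4 4) * ?E (?d 4 3)"
    using opr_commute[OF D1 D1, of 3 4 4] by (simp add: opr_def)
  have c2: "?E (?f 4 2) * ?E (?d 4 4) = ?E (?d 4 4) * ?E (?f 4 2)"
    using opr_commute[OF F_carrier D1, of 2 4 4] by (simp add: opr_def)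
  have em: "embed d (X * Y) = embed d X * embed d Y"
    if "X \<in> carrier_mat d d" "Y \<in> carrier_mat d d" for X Y :: "'k mat" and d
    using that by (rule embed_mult)
  have "?E (double_F * act n 4 3 2 DD) = ?E (?f 4 2) * (?E (?f 4 1) * (?E (?f 4 3) * (?E (?f 4 2) *
      (?E (?d 4 3) * ?E (?d 4 4)))))"
    unfolding double_F_def a by (simp add: em mult cf cd mult.assoc)
  also have "\<dots> = ?E (?f 4 2) * ?E (?f 4 1) * ?E (?f 4 3) * (?E (?f 4 2) * ?E (?d 4 4)) * ?E (?d 4 3)"
    unfolding c1 by (simp only: mult.assoc)
  also have "\<dots> = ?E (kron P (1\<^sub>m n) * ((?f 4 3 * ?d 4 4) * kron Q (1\<^sub>m n)))"
    unfolding c2 KP KQ by (simp add: em mult cf cd mult.assoc)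
  finally have eq: "double_F * act n 4 3 2 DD = kron P (1\<^sub>m n) * ((?f 4 3 * ?d 4 4) * kron Q (1\<^sub>m n))"
    by (subst (asm) embed_eq_iff) (auto intro!: mult double_F_carrier act4_carrier cf cd simp: KP KQ)
  have n4: "n ^ 4 = n ^ 3 * n" "n ^ 3 = n ^ 2 * n" by (simp_all add: eval_nat_numeral)
  have FD4: "?f 4 3 * ?d 4 4 \<in> carrier_mat (n ^ 3 * n) (n ^ 3 * n)"
    unfolding n4(1)[symmetric] by (intro mult cf cd) auto
  have FD3: "?f 3 2 * ?d 3 3 \<in> carrier_mat (n ^ 2 * n) (n ^ 2 * n)"
    unfolding n4(2)[symmetric] by (intro mult cf cd) auto
  have sums: "Suc 1 = 2" "1 + 2 = (3::nat)" "Suc 2 = 3" "2 + 2 = (4::nat)" by simp_all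
  have t4: "ptrace2 (n ^ 3) n (?f 4 3 * ?d 4 4) = 1\<^sub>m (n ^ 3)"
    using trace_F_D[of 2] unfolding sums .
  have t3: "ptrace2 (n ^ 2) n (?f 3 2 * ?d 3 3) = 1\<^sub>m (n ^ 2)"
    using trace_F_D[of 1] unfolding sums .
  have tr4: "ptrace2 (n ^ 3) n (double_F * act n 4 3 2 DD) = P * Q"
  proof -
    have KQ': "kron Q (1\<^sub>m n) \<in> carrier_mat (n ^ 3 * n) (n ^ 3 * n)" using PQ by simp
    show ?thesis
      unfolding eq ptrace2_kron_left[OF PQ(1) mult_carrier_mat[OF FD4 KQ']]
        ptrace2_kron_right[OF PQ(2) FD4] t4 using PQ by simp
  qed
  have k3: "?f 3 1 = kron F (1\<^sub>m n)" using kron_one_left[OF F_carrier] by (simp add: act_def)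
  have "embed (n ^ 3) (P * Q) = embed (n ^ 3) (?f 3 2) * embed (n ^ 3) (?f 3 1) * embed (n ^ 3) (?f 3 2) * embed (n ^ 3) (?d 3 3)"
    unfolding P_def Q_def by (simp add: em mult cf cd mult.assoc)
  also have "\<dots> = embed (n ^ 3) (?f 3 1) * embed (n ^ 3) (?f 3 2) * (embed (n ^ 3) (?f 3 1) * embed (n ^ 3) (?d 3 3))"
    using compatible_opr(1)[OF F_self_compatible F_carrier, of 1 3]
    by (simp add: opr_def mult.assoc[symmetric] del: One_nat_def)
  also have "embed (n ^ 3) (?f 3 1) * embed (n ^ 3) (?d 3 3) = embed (n ^ 3) (?d 3 3) * embed (n ^ 3) (?f 3 1)"
    using opr_commute[OF F_carrier D1, of 1 3 3] by (simp add: opr_def)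
  also have "embed (n ^ 3) (?f 3 1) * embed (n ^ 3) (?f 3 2) * (embed (n ^ 3) (?d 3 3) * embed (n ^ 3) (?f 3 1))
      = embed (n ^ 3) (?f 3 1 * ((?f 3 2 * ?d 3 3) * ?f 3 1))"
    by (simp add: em mult cf cd mult.assoc)
  finally have eq3: "P * Q = ?f 3 1 * ((?f 3 2 * ?d 3 3) * ?f 3 1)"
    by (subst (asm) embed_eq_iff) (auto intro!: mult cf cd PQ)
  have KF: "kron F (1\<^sub>m n) \<in> carrier_mat (n ^ 2 * n) (n ^ 2 * n)" by simp
  have "ptrace2 (n ^ 2) n (P * Q) = F * F"
    unfolding eq3 k3 ptrace2_kron_left[OF F_carrier mult_carrier_mat[OF FD3 KF]]
      ptrace2_kron_right[OF F_carrier FD3] t3 left_mult_one_mat[OF F_carrier] ..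
  then show ?thesis
    using ptrace2_ptrace2[of "n ^ 2" n n "double_F * act n 4 3 2 DD"] tr4
    by (simp only: n4(2)[symmetric] power2_eq_square[symmetric])
qed

lemma twist_twist_carrier [simp]:
  assumes "X \<in> carrier_mat (n ^ 2) (n ^ 2)"
  shows "twist F (twist F X) \<in> carrier_mat (n ^ 2) (n ^ 2)"
  unfolding twist_def
  by (rule mult_carrier_mat mult_carrier_mat[OF F_carrier] F_carrier Fi_carrier assms)+

lemma opr_inverse:
  assumes "n > 0" "1 \<le> i" "i + 2 \<le> Suc m"
  shows "opr n m i 2 F * opr n m i 2 Fi = 1" "opr n m i 2 Fi * opr n m i 2 F = 1"
  unfolding opr_mult[OF F_carrier Fi_carrier assms(2,3), symmetric]
    opr_mult[OF Fi_carrier F_carrier assms(2,3), symmetric] F_Fi Fi_F using assms by (simp_all add: opr_one)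

lemma opr_twist_twist:
  assumes X: "X \<in> carrier_mat (n ^ 2) (n ^ 2)" and i: "1 \<le> i" "i + 2 \<le> Suc m"
  shows "opr n m i 2 (twist F (twist F X)) =
    opr n m i 2 F * (opr n m i 2 F * opr n m i 2 X * opr n m i 2 Fi) * opr n m i 2 Fi"
proof -
  have FX: "F * X \<in> carrier_mat (n ^ 2) (n ^ 2)" by (rule mult_carrier_mat[OF F_carrier X])
  have T: "F * X * Fi \<in> carrier_mat (n ^ 2) (n ^ 2)" by (rule mult_carrier_mat[OF FX Fi_carrier])
  show ?thesis
    unfolding twist_def opr_mult[OF mult_carrier_mat[OF F_carrier T] Fi_carrier i]
      opr_mult[OF F_carrier T i] opr_mult[OF FX Fi_carrier i] opr_mult[OF F_carrier X i] ..
qed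

text \<open>Under the injective map \<open>Y \<mapsto> Tr\<^sub>3\<^sub>4 (F\<^sub>2 F\<^sub>1 F\<^sub>3 F\<^sub>2 Y\<^sub>3\<^sub>4)\<close> both sides become \<open>F\<^sup>2 X\<close>.\<close>

lemma DD_intertwine:
  assumes c: "compatible_pair n X F" and X: "X \<in> carrier_mat (n ^ 2) (n ^ 2)"
  shows "DD * X = twist F (twist F X) * DD"
proof (cases "n = 0")
  case True
  then show ?thesis
    by (intro empty_mat_eq) (use mult_carrier_mat[OF DD_carrier X]
        mult_carrier_mat[OF twist_twist_carrier[OF X] DD_carrier] in simp_all)
next
  case False
  let ?X' = "twist F (twist F X)" and ?T = "ptrace2 (n ^ 2) (n ^ 2)"
  let ?a = "\<lambda>i X. act n 4 i 2 X"
  note X' = twist_twist_carrier[OF X]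
  have n4: "n ^ 4 = n ^ 2 * n ^ 2" by (simp add: power_add[symmetric])
  note G = double_F_carrier
  have c1: "?a 1 Y \<in> carrier_mat (n ^ 4) (n ^ 4)" and c3: "?a 3 Y \<in> carrier_mat (n ^ 4) (n ^ 4)"
    if "Y \<in> carrier_mat (n ^ 2) (n ^ 2)" for Y :: "'k mat"
    by (rule act4_carrier[OF that]; simp)+
  have a1: "?a 1 Y = kron Y (1\<^sub>m (n ^ 2))" and a3: "?a 3 Y = kron (1\<^sub>m (n ^ 2)) Y"
    if "Y \<in> carrier_mat (n ^ 2) (n ^ 2)" for Y :: "'k mat"
    using that kron_carrier[OF one_carrier_mat that, of "n ^ 2"]
    by (simp_all add: act_def kron_one_right[of _ "n ^ 2 * n ^ 2"])
  have cyc: "?T (?a 3 Y * Z) = ?T (Z * ?a 3 Y)"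
    if "Y \<in> carrier_mat (n ^ 2) (n ^ 2)" "Z \<in> carrier_mat (n ^ 4) (n ^ 4)" for Y Z :: "'k mat"
    unfolding a3[OF that(1)] using that by (intro ptrace2_cyclic) (simp_all only: n4 central_mat_field)
  have GDD: "double_F * ?a 3 DD \<in> carrier_mat (n ^ 4) (n ^ 4)"
    by (rule mult_carrier_mat[OF G c3[OF DD_carrier]])
  \<comment> \<open>X is cycled within copies 3, 4 to the far left, crosses \<open>double_F\<close>
    into copies 1, 2, and leaves the trace on the right.\<close>
  have "?T (double_F * ?a 3 (DD * X)) = ?T (double_F * ?a 3 DD * ?a 3 X)"
    unfolding act_mult[OF DD_carrier X] assoc_mult_mat[OF G c3[OF DD_carrier] c3[OF X]] ..
  also have "\<dots> = ?T (?a 3 X * (double_F * ?a 3 DD))"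
    by (rule cyc[OF X GDD, symmetric])
  also have "\<dots> = ?T (double_F * (?a 1 X * ?a 3 DD))"
    unfolding assoc_mult_mat[OF c3[OF X] G c3[OF DD_carrier], symmetric] double_F_shift(2)[OF c X]
      assoc_mult_mat[OF G c1[OF X] c3[OF DD_carrier]] ..
  also have "?a 1 X * ?a 3 DD = ?a 3 DD * ?a 1 X"
    by (rule act_commute[OF X DD_carrier]) auto
  also have "?T (double_F * (?a 3 DD * ?a 1 X)) = ?T (double_F * ?a 3 DD) * X"
    unfolding assoc_mult_mat[OF G c3[OF DD_carrier] c1[OF X], symmetric] unfolding a1[OF X]
    by (rule ptrace2_kron_right[OF X]) (use GDD in \<open>simp only: n4\<close>)
  finally have L: "?T (double_F * ?a 3 (DD * X)) = F * F * X" by (simp only: trace_double_F_DD)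
  \<comment> \<open>\<open>double_F\<close> carries F, its inverse and X separately from one pair of
    copies to the other, hence also the double twist built from them.\<close>
  have shift: "?a 1 ?X' * double_F = double_F * ?a 3 ?X'"
  proof -
    let ?e = "embed (n ^ 4)" and ?o = "\<lambda>i X. opr n 4 i 2 X"
    have s: "?o 1 Y * ?e double_F = ?e double_F * ?o 3 Y"
      if "compatible_pair n Y F" "Y \<in> carrier_mat (n ^ 2) (n ^ 2)" for Y :: "'k mat"
      unfolding opr_def using double_F_shift(1)[OF that]
      by (simp only: embed_mult[OF c1[OF that(2)] G, symmetric] embed_mult[OF G c3[OF that(2)], symmetric])
    note sF = s[OF F_self_compatible F_carrier] and sX = s[OF c X]
    have o: "?o 1 F * ?o 1 Fi = 1" "?o 1 Fi * ?o 1 F = 1" "?o 3 F * ?o 3 Fi = 1" "?o 3 Fi * ?o 3 F = 1"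
      using False by (auto intro!: opr_inverse)
    have "?o 1 Fi * (?o 1 F * ?e double_F) * ?o 3 Fi = ?o 1 Fi * ?e double_F * (?o 3 F * ?o 3 Fi)"
      unfolding sF by (simp only: mult.assoc)
    then have sFi: "?e double_F * ?o 3 Fi = ?o 1 Fi * ?e double_F"
      unfolding mult.assoc[symmetric] o by (simp add: o)
    have "?o 1 ?X' * ?e double_F = ?o 1 F * (?o 1 F * (?o 1 X * (?o 1 Fi * (?o 1 Fi * ?e double_F))))"
      using X by (simp add: opr_twist_twist mult.assoc)
    also have "\<dots> = ?o 1 F * (?o 1 F * (?o 1 X * ?e double_F)) * ?o 3 Fi * ?o 3 Fi"
      unfolding sFi[symmetric] mult.assoc[symmetric] unfolding mult.assoc sFi[symmetric]
      unfolding mult.assoc[symmetric] ..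
    also have "\<dots> = ?e double_F * ?o 3 ?X'"
      unfolding sX mult.assoc[symmetric] unfolding mult.assoc sF
      unfolding mult.assoc[symmetric] sF using X by (simp add: opr_twist_twist mult.assoc)
    finally show ?thesis
      unfolding opr_def embed_mult[OF c1[OF X'] G, symmetric] embed_mult[OF G c3[OF X'], symmetric]
      by (simp only: embed_eq_iff[OF mult_carrier_mat[OF c1[OF X'] G] mult_carrier_mat[OF G c3[OF X']]])
  qed
  have "?T (double_F * ?a 3 (?X' * DD)) = ?T (?a 1 ?X' * (double_F * ?a 3 DD))"
    unfolding act_mult[OF X' DD_carrier] assoc_mult_mat[OF G c3[OF X'] c3[OF DD_carrier], symmetric]
      shift[symmetric] assoc_mult_mat[OF c1[OF X'] G c3[OF DD_carrier]] ..
  also have "\<dots> = ?X' * ?T (double_F * ?a 3 DD)"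
    unfolding a1[OF X'] by (rule ptrace2_kron_left[OF X']) (use GDD in \<open>simp only: n4\<close>)
  \<comment> \<open>The double twist is F^2 X F^(-2), and the trace supplies F^2; the inverses
    cancel.\<close>
  also have "\<dots> = F * F * X"
  proof -
    let ?e = "\<lambda>X. opr n 2 1 2 X"
    have o: "?e F * ?e Fi = 1" "?e Fi * ?e F = 1"
      using False by (auto intro!: opr_inverse)
    have FF: "F * F \<in> carrier_mat (n ^ 2) (n ^ 2)" by (rule mult_carrier_mat[OF F_carrier F_carrier])
    have "?e ?X' * (?e F * ?e F) = ?e F * (?e F * (?e X * (?e Fi * ((?e Fi * ?e F) * ?e F))))"
      using X by (simp add: opr_twist_twist mult.assoc)
    then have "?e ?X' * (?e F * ?e F) = ?e F * ?e F * ?e X"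
      unfolding o by (simp add: o mult.assoc del: One_nat_def)
    then have "?e (?X' * (F * F)) = ?e (F * F * X)"
      using X X' FF by (simp add: opr_mult)
    then show ?thesis
      unfolding trace_double_F_DD opr_def
      using mult_carrier_mat[OF X' FF] mult_carrier_mat[OF FF X] by (simp add: embed_eq_iff)
  qed
  finally have R: "?T (double_F * ?a 3 (?X' * DD)) = F * F * X" .
  have cDX: "DD * X \<in> carrier_mat (n ^ 2) (n ^ 2)" "?X' * DD \<in> carrier_mat (n ^ 2) (n ^ 2)"
    using mult_carrier_mat[OF DD_carrier X] mult_carrier_mat[OF X' DD_carrier] by blast+
  let ?Y = "DD * X - ?X' * DD"
  have cd: "?Y \<in> carrier_mat (n ^ 2) (n ^ 2)" by (rule minus_carrier_mat[OF cDX(2)])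
  have aY: "?a 3 ?Y = ?a 3 (DD * X) - ?a 3 (?X' * DD)"
    unfolding a3[OF cd] a3[OF cDX(1)] a3[OF cDX(2)]
  proof (rule mat_pair_eqI[of _ "n ^ 2" "n ^ 2"])
    note k = kron_carrier[OF one_carrier_mat cDX(1), of "n ^ 2"] kron_carrier[OF one_carrier_mat cDX(2), of "n ^ 2"]
    show "kron (1\<^sub>m (n ^ 2)) ?Y \<in> carrier_mat (n ^ 2 * n ^ 2) (n ^ 2 * n ^ 2)"
      by (rule kron_carrier[OF one_carrier_mat cd])
    show "kron (1\<^sub>m (n ^ 2)) (DD * X) - kron (1\<^sub>m (n ^ 2)) (?X' * DD) \<in> carrier_mat (n ^ 2 * n ^ 2) (n ^ 2 * n ^ 2)"
      by (rule minus_carrier_mat[OF k(2)])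
    fix i k' j l assume lt: "i < n ^ 2" "k' < n ^ 2" "j < n ^ 2" "l < n ^ 2"
    have "(kron (1\<^sub>m (n ^ 2)) (DD * X) - kron (1\<^sub>m (n ^ 2)) (?X' * DD)) $$ (i * n ^ 2 + k', j * n ^ 2 + l)
      = kron (1\<^sub>m (n ^ 2)) (DD * X) $$ (i * n ^ 2 + k', j * n ^ 2 + l)
        - kron (1\<^sub>m (n ^ 2)) (?X' * DD) $$ (i * n ^ 2 + k', j * n ^ 2 + l)"
      by (rule index_minus_mat(1)) (simp_all only: carrier_matD[OF k(2)] pair_less lt)
    moreover have "?Y $$ (k', l) = (DD * X) $$ (k', l) - (?X' * DD) $$ (k', l)"
      by (rule index_minus_mat(1)) (simp_all only: carrier_matD[OF cDX(2)] lt)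
    ultimately show "kron (1\<^sub>m (n ^ 2)) ?Y $$ (i * n ^ 2 + k', j * n ^ 2 + l) =
        (kron (1\<^sub>m (n ^ 2)) (DD * X) - kron (1\<^sub>m (n ^ 2)) (?X' * DD)) $$ (i * n ^ 2 + k', j * n ^ 2 + l)"
      by (simp only: kron_index[OF one_carrier_mat cd lt(1,3,2,4)] kron_index[OF one_carrier_mat cDX(1) lt(1,3,2,4)]
        kron_index[OF one_carrier_mat cDX(2) lt(1,3,2,4)] right_diff_distrib)
  qed
  have "?T (double_F * ?a 3 ?Y) = ?T (double_F * ?a 3 (DD * X)) - ?T (double_F * ?a 3 (?X' * DD))"
    unfolding aY mult_minus_distrib_mat[OF G c3[OF cDX(1)] c3[OF cDX(2)]]
    by (rule ptrace2_diff)
      (use mult_carrier_mat[OF G c3[OF cDX(1)]] mult_carrier_mat[OF G c3[OF cDX(2)]] in \<open>simp_all only: n4\<close>)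
  also have "\<dots> = 0\<^sub>m (n ^ 2) (n ^ 2)" unfolding L R
    using mult_carrier_mat[OF mult_carrier_mat[OF F_carrier F_carrier] X] by simp
  also have "double_F * ?a 3 ?Y = ?a 2 F * (?a 1 F * (?a 3 F * (?a 2 F * ?a 3 ?Y)))"
  proof -
    have c2: "?a 2 F \<in> carrier_mat (n ^ 4) (n ^ 4)" by (rule act4_carrier) auto
    note cF = c1[OF F_carrier] c2 c3[OF F_carrier] and cY = c3[OF cd]
    have m: "?a 3 F * ?a 2 F \<in> carrier_mat (n ^ 4) (n ^ 4)" by (rule mult_carrier_mat[OF cF(3,2)])
    show ?thesis
      unfolding double_F_def assoc_mult_mat[OF cF(2) mult_carrier_mat[OF cF(1) m] cY]
        assoc_mult_mat[OF cF(1) m cY] assoc_mult_mat[OF cF(3,2) cY] ..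
  qed
  finally have "?Y = 0\<^sub>m (n ^ 2) (n ^ 2)" by (rule skew_injective2[OF cd])
  then show ?thesis
    using cDX by (auto simp: mat_eq_iff)
qed

text \<open>W enters linearly and the numerical entries are central, so the sum over them splits off
  and \<open>conj_trace_index\<close> evaluates it. The conjugation moves the last copy of W one
  place to the right; tracing it there leaves an identity in the vacated copy.\<close>

lemma trace_conj:
  assumes W: "W \<in> carrier_mat (c * n) (c * n)"
  shows "ptrace2 (c * n) n (kron (1\<^sub>m (c * n)) (lift_op D) * (kron (1\<^sub>m c) (lift_op F) *
      (kron W (1\<^sub>m n) * kron (1\<^sub>m c) (lift_op Fi))))
    = kron (ptrace2 c n (kron (1\<^sub>m c) (lift_op D) * W)) (1\<^sub>m n)"
proof (rule mat_pair_eqI[of _ c n])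
  let ?D = "lift_op D" and ?F = "lift_op F" and ?G = "lift_op Fi"
  have cs: "?D \<in> carrier_mat n n" "?F \<in> carrier_mat (n * n) (n * n)" "?G \<in> carrier_mat (n * n) (n * n)"
    using D_carrier F_carrier Fi_carrier by (simp_all add: power2_eq_square)
  fix x k y l assume lt: "x < c" "k < n" "y < c" "l < n"
  have sc: "?D $$ (m, m') = scal (D $$ (m, m'))" if "m < n" "m' < n" for m m'
    using that carrier_matD[OF D_carrier] by simp
  have sF: "?F $$ (i, j) = scal (F $$ (i, j))" "?G $$ (i, j) = scal (Fi $$ (i, j))"
    if "i < n * n" "j < n * n" for i j
    using that carrier_matD[OF F_carrier] carrier_matD[OF Fi_carrier] by (simp_all add: power2_eq_square)
  let ?X = "kron (1\<^sub>m (c * n)) ?D * (kron (1\<^sub>m c) ?F * (kron W (1\<^sub>m n) * kron (1\<^sub>m c) ?G))"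
  have "ptrace2 (c * n) n ?X $$ (x * n + k, y * n + l) = (\<Sum>m<n. \<Sum>m'<n. \<Sum>a<n. \<Sum>e<n. \<Sum>b<n. ?D $$ (m, m') *
      (?F $$ (k * n + m', a * n + e) * (W $$ (x * n + a, y * n + b) * ?G $$ (b * n + e, l * n + m))))"
    by (rule ptrace2_sandwich_index[OF cs W lt])
  also have "\<dots> = (\<Sum>m<n. \<Sum>m'<n. \<Sum>a<n. \<Sum>e<n. \<Sum>b<n.
      W $$ (x * n + a, y * n + b) * scal (D $$ (m, m') * F $$ (k * n + m', a * n + e) * Fi $$ (b * n + e, l * n + m)))"
    unfolding sum_distrib_left
    by (intro sum.cong refl) (use lt in \<open>simp add: sc sF pair_less ring_hom_scal scal_swap mult.assoc\<close>)
  also have "\<dots> = (\<Sum>a<n. \<Sum>b<n. \<Sum>m<n. \<Sum>m'<n. \<Sum>e<n.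
      W $$ (x * n + a, y * n + b) * scal (D $$ (m, m') * F $$ (k * n + m', a * n + e) * Fi $$ (b * n + e, l * n + m)))"
    unfolding sum.cartesian_product
    by (rule sum.reindex_bij_witness[of _ "\<lambda>(a,b,m,m',e). (m,m',a,e,b)" "\<lambda>(m,m',a,e,b). (a,b,m,m',e)"]) auto
  also have "\<dots> = (\<Sum>a<n. \<Sum>b<n. W $$ (x * n + a, y * n + b) * scal (\<Sum>m<n. \<Sum>m'<n. \<Sum>e<n.
      D $$ (m, m') * F $$ (k * n + m', a * n + e) * Fi $$ (b * n + e, l * n + m)))"
    by (simp only: scal_sum sum_distrib_left)
  also have "\<dots> = (\<Sum>a<n. \<Sum>b<n. W $$ (x * n + a, y * n + b) * scal (if k = l then D $$ (b, a) else 0))"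
    using lt by (intro sum.cong refl) (simp add: conj_trace_index)
  also have "\<dots> = (\<Sum>b<n. \<Sum>a<n. scal (D $$ (b, a)) * W $$ (x * n + a, y * n + b)) * (if k = l then 1 else 0)"
    by (subst sum.swap, cases "k = l") (simp_all add: scal_central[of _ "W $$ _"] ring_hom_scal)
  also have "(\<Sum>b<n. \<Sum>a<n. scal (D $$ (b, a)) * W $$ (x * n + a, y * n + b))
      = ptrace2 c n (kron (1\<^sub>m c) ?D * W) $$ (x, y)"
    using lt by (simp add: ptrace2_index one_kron_mult_index[OF cs(1) W] pair_less sc)
  also have "\<dots> * (if k = l then 1 else 0)
      = kron (ptrace2 c n (kron (1\<^sub>m c) ?D * W)) (1\<^sub>m n) $$ (x * n + k, y * n + l)"
    using lt by (subst kron_index[OF ptrace2_carrier one_carrier_mat]) simp_all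
  finally show "ptrace2 (c * n) n ?X $$ (x * n + k, y * n + l)
      = kron (ptrace2 c n (kron (1\<^sub>m c) ?D * W)) (1\<^sub>m n) $$ (x * n + k, y * n + l)" .
qed simp_all

end

section \<open>The chain of matrices \<open>M\<close>\<close>

text \<open>The double twist of an operator compatible with F is again compatible with F. Any x that
  intertwines f_i with f_j and r_i with r_j also intertwines the inverses, hence the double twists;
  all the conditions of the chain have this form.\<close>

lemma (in braided_chain) twist_chain_twist:
  assumes "twist_chain f g r \<mu> N"
  shows "twist_chain f g (\<lambda>i. f i * (f i * r i * g i) * g i) \<mu> N"
proof -
  interpret r: twist_chain f g r \<mu> N by (rule assms)
  have conj: "f i * (f i * r i * g i) * g i * x = x * (f j * (f j * r j * g j) * g j)"
    if ij: "1 \<le> i" "i < N" "1 \<le> j" "j < N" and f: "f i * x = x * f j" and r: "r i * x = x * r j" for i j x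
  proof -
    have "g i * (f i * x) * g j = g i * (x * f j) * g j" unfolding f ..
    then have "(g i * f i) * x * g j = g i * x * (f j * g j)" by (simp only: mult.assoc)
    then have g: "g i * x = x * g j" using ij fg by simp
    have "f i * (f i * r i * g i) * g i * x = f i * (f i * (r i * (g i * (g i * x))))" by (simp only: mult.assoc)
    also have "\<dots> = f i * (f i * (r i * x)) * g j * g j" unfolding g by (simp only: mult.assoc[symmetric] g)
    also have "\<dots> = f i * (f i * x) * r j * g j * g j" unfolding r by (simp only: mult.assoc)
    also have "\<dots> = x * (f j * (f j * r j * g j) * g j)" unfolding f mult.assoc[symmetric] f
      by (simp only: mult.assoc)
    finally show ?thesis .
  qed
  show ?thesis
  proof
    fix i j assume ij: "1 \<le> i" "Suc i < j" "j < N"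
    then have b: "1 \<le> i" "i < N" "1 \<le> j" "j < N" by auto
    show "f i * (f i * r i * g i) * g i * f j = f j * (f i * (f i * r i * g i) * g i)"
      using conj[of i i "f j"] ij b far(1)[OF ij] r.far(1)[OF ij] by simp
    show "f j * (f j * r j * g j) * g j * f i = f i * (f j * (f j * r j * g j) * g j)"
      using conj[of j j "f i"] ij b far(2)[OF ij] r.far(2)[OF ij] by simp
  next
    fix i assume i: "1 \<le> i" "Suc i < N"
    then have b: "i < N" "1 \<le> Suc i" by auto
    show "f i * (f i * r i * g i) * g i * f (Suc i) * f i = f (Suc i) * f i * (f (Suc i) * (f (Suc i) * r (Suc i) * g (Suc i)) * g (Suc i))"
      using conj[of i "Suc i" "f (Suc i) * f i"] i b near(1)[OF i] r.near(1)[OF i] by (simp only: mult.assoc)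
    show "f (Suc i) * (f (Suc i) * r (Suc i) * g (Suc i)) * g (Suc i) * f i * f (Suc i) = f i * f (Suc i) * (f i * (f i * r i * g i) * g i)"
      using conj[of "Suc i" i "f i * f (Suc i)"] i b near(2)[OF i] r.near(2)[OF i] by (simp only: mult.assoc)
  next
    fix i assume i: "2 \<le> i" "i < N"
    show "f i * (f i * r i * g i) * g i * \<mu> 1 = \<mu> 1 * (f i * (f i * r i * g i) * g i)"
      using conj[of i i "\<mu> 1"] i \<mu>_1[OF i] r.\<mu>_1[OF i] by simp
  qed (fact fg \<mu>_Suc)+
qed

lemma lift_braid:
  fixes A B C A' B' C' :: "'k::field mat"
  assumes eq: "act n 3 a 2 A * act n 3 b 2 B * act n 3 c 2 C = act n 3 a' 2 A' * act n 3 b' 2 B' * act n 3 c' 2 C'"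
    and cs: "A \<in> carrier_mat (n^2) (n^2)" "B \<in> carrier_mat (n^2) (n^2)" "C \<in> carrier_mat (n^2) (n^2)"
      "A' \<in> carrier_mat (n^2) (n^2)" "B' \<in> carrier_mat (n^2) (n^2)" "C' \<in> carrier_mat (n^2) (n^2)"
    and ab: "a \<in> {1,2}" "b \<in> {1,2}" "c \<in> {1,2}" "a' \<in> {1,2}" "b' \<in> {1,2}" "c' \<in> {1,2}"
  shows "act n 3 a 2 (lift_op A) * act n 3 b 2 (lift_op B) * act n 3 c 2 (lift_op C)
    = act n 3 a' 2 (lift_op A') * act n 3 b' 2 (lift_op B') * act n 3 c' 2 (lift_op C')"
proof -
  have c: "act n 3 a 2 X \<in> carrier_mat (n ^ 3) (n ^ 3)"
    if "a \<in> {1,2}" "X \<in> carrier_mat (n^2) (n^2)" for a and X :: "'k mat"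
    using that by (intro act_carrier) auto
  have e: "act n 3 a 2 (lift_op A) * act n 3 b 2 (lift_op B) * act n 3 c 2 (lift_op C)
    = lift_op (act n 3 a 2 A * act n 3 b 2 B * act n 3 c 2 C)"
    if "a \<in> {1,2}" "b \<in> {1,2}" "c \<in> {1,2}" "A \<in> carrier_mat (n^2) (n^2)"
      "B \<in> carrier_mat (n^2) (n^2)" "C \<in> carrier_mat (n^2) (n^2)" for a b c and A B C :: "'k mat"
    unfolding lift_act[symmetric]
    using lift_mult[OF mult_carrier_mat[OF c[OF that(1,4)] c[OF that(2,5)]] c[OF that(3,6)]]
      lift_mult[OF c[OF that(1,4)] c[OF that(2,5)]] by simp
  show ?thesis unfolding e[OF ab(1-3) cs(1-3)] e[OF ab(4-6) cs(4-6)] eq ..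
qed

lemma gen_mat_carrier_mat [simp]: "gen_mat n \<in> carrier_mat n n"
  by (simp add: gen_mat_def)

context braided_space
begin

lemma compatible_opr_lift:
  assumes "compatible_pair n X F" "X \<in> carrier_mat (n ^ 2) (n ^ 2)" "1 \<le> i" "i + 2 \<le> m"
  shows "opr n m i 2 (lift_op X) * opr n m (i + 1) 2 (lift_op F) * opr n m i 2 (lift_op F)
      = opr n m (i + 1) 2 (lift_op F) * opr n m i 2 (lift_op F) * opr n m (i + 1) 2 (lift_op X)"
    "opr n m (i + 1) 2 (lift_op X) * opr n m i 2 (lift_op F) * opr n m (i + 1) 2 (lift_op F)
      = opr n m i 2 (lift_op F) * opr n m (i + 1) 2 (lift_op F) * opr n m i 2 (lift_op X)"
  using opr_braid[OF lift_braid[of n 1 X 2 F 1 F 2 F 1 F 2 X], of i m]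
    opr_braid[OF lift_braid[of n 2 X 1 F 2 F 1 F 2 F 1 X], of i m] assms
  by (simp_all add: compatible_pair_def)

lemma M_bar_carrier: "1 \<le> i \<Longrightarrow> i \<le> m \<Longrightarrow> M_bar n F m i \<in> carrier_mat (n ^ m) (n ^ m)"
proof (induction i)
  case (Suc i)
  show ?case
  proof (cases i)
    case 0
    have "act n m 1 1 (gen_mat n :: 'k free_alg mat) \<in> carrier_mat (n ^ m) (n ^ m)"
      using Suc.prems gen_mat_carrier_mat[of n] by (intro act_carrier) auto
    then show ?thesis by (simp add: 0)
  next
    case (Suc j)
    then have IH: "M_bar n F m (Suc j) \<in> carrier_mat (n ^ m) (n ^ m)" using Suc.IH Suc.prems by simp
    have a: "lift_op (act n m (Suc j) 2 X) \<in> carrier_mat (n ^ m) (n ^ m)"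
      if "X \<in> carrier_mat (n ^ 2) (n ^ 2)" for X :: "'k mat"
      by (intro lift_carrier act_carrier that) (use Suc.prems Suc in auto)
    show ?thesis unfolding Suc M_bar.simps
      by (rule mult_carrier_mat[OF mult_carrier_mat[OF a[OF F_carrier] IH] a[OF Fi_carrier]])
  qed
qed simp

lemma M_bar_Suc: "1 \<le> i \<Longrightarrow> M_bar n F m (Suc i) = act n m i 2 (lift_op F) * M_bar n F m i * act n m i 2 (lift_op Fi)"
  by (cases i) (simp_all add: lift_act)

lemma M_bar_extend: "1 \<le> i \<Longrightarrow> i \<le> m \<Longrightarrow> M_bar n F (m + p) i = kron (M_bar n F m i) (1\<^sub>m (n ^ p))"
proof (induction i)
  case (Suc i)
  show ?case
  proof (cases "i = 0")
    case True
    then show ?thesis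
      using kron_act_right[of "gen_mat n :: 'k free_alg mat" n 1 1 m p] Suc.prems gen_mat_carrier_mat[of n]
      by simp
  next
    case False
    then have i: "1 \<le> i" "i + 2 \<le> Suc m" using Suc.prems by auto
    have IH: "M_bar n F (m + p) i = kron (M_bar n F m i) (1\<^sub>m (n ^ p))" using Suc i by simp
    have MC: "M_bar n F m i \<in> carrier_mat (n ^ m) (n ^ m)" by (rule M_bar_carrier) (use i in auto)
    have c: "act n m i 2 (lift_op X) \<in> carrier_mat (n ^ m) (n ^ m)" if "X \<in> carrier_mat (n ^ 2) (n ^ 2)" for X :: "'k mat"
      using that i by (intro act_carrier lift_carrier)
    have k: "kron A (1\<^sub>m (n ^ p)) * kron B (1\<^sub>m (n ^ p)) = kron (A * B) (1\<^sub>m (n ^ p))"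
      if "A \<in> carrier_mat (n ^ m) (n ^ m)" "B \<in> carrier_mat (n ^ m) (n ^ m)" for A B :: "'k free_alg mat"
      using kron_mult[OF that(1) one_carrier_mat that(2) one_carrier_mat, of "n ^ p"] by simp
    have a: "act n (m + p) i 2 (lift_op X) = kron (act n m i 2 (lift_op X)) (1\<^sub>m (n ^ p))"
      if "X \<in> carrier_mat (n ^ 2) (n ^ 2)" for X :: "'k mat"
      by (rule kron_act_right[OF lift_carrier[OF that] i, symmetric])
    show ?thesis
      unfolding M_bar_Suc[OF i(1)] IH a[OF F_carrier] a[OF Fi_carrier] k[OF c[OF F_carrier] MC]
        k[OF mult_carrier_mat[OF c[OF F_carrier] MC] c[OF Fi_carrier]] ..
  qed
qed simp

lemma lift_opr_inverse:
  assumes "n > 0" "1 \<le> i" "i + 2 \<le> Suc m"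
  shows "opr n m i 2 (lift_op F) * opr n m i 2 (lift_op Fi) = 1"
    "opr n m i 2 (lift_op Fi) * opr n m i 2 (lift_op F) = 1"
  unfolding opr_mult[OF lift_carrier[OF F_carrier] lift_carrier[OF Fi_carrier] assms(2,3), symmetric]
    opr_mult[OF lift_carrier[OF Fi_carrier] lift_carrier[OF F_carrier] assms(2,3), symmetric]
    lift_mult[OF F_carrier Fi_carrier, symmetric] lift_mult[OF Fi_carrier F_carrier, symmetric]
    F_Fi Fi_F lift_one using assms by (simp_all add: opr_one)

lemma twist_chain_M:
  assumes n: "n > 0" and c: "compatible_pair n X F" and X: "X \<in> carrier_mat (n ^ 2) (n ^ 2)"
  shows "twist_chain (\<lambda>i. opr n m i 2 (lift_op F)) (\<lambda>i. opr n m i 2 (lift_op Fi))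
    (\<lambda>i. opr n m i 2 (lift_op X)) (\<lambda>i. embed (n ^ m) (M_bar n F m i)) m"
proof
  fix i j assume ij: "1 \<le> i" "Suc i < j" "j < m"
  show "opr n m i 2 (lift_op X) * opr n m j 2 (lift_op F) = opr n m j 2 (lift_op F) * opr n m i 2 (lift_op X)"
    by (rule opr_commute) (use ij X in \<open>auto intro!: lift_carrier\<close>)
  show "opr n m j 2 (lift_op X) * opr n m i 2 (lift_op F) = opr n m i 2 (lift_op F) * opr n m j 2 (lift_op X)"
    by (rule opr_commute[symmetric]) (use ij X in \<open>auto intro!: lift_carrier\<close>)
next
  fix i assume i: "1 \<le> i" "Suc i < m"
  show "opr n m i 2 (lift_op X) * opr n m (Suc i) 2 (lift_op F) * opr n m i 2 (lift_op F)
      = opr n m (Suc i) 2 (lift_op F) * opr n m i 2 (lift_op F) * opr n m (Suc i) 2 (lift_op X)"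
    "opr n m (Suc i) 2 (lift_op X) * opr n m i 2 (lift_op F) * opr n m (Suc i) 2 (lift_op F)
      = opr n m i 2 (lift_op F) * opr n m (Suc i) 2 (lift_op F) * opr n m i 2 (lift_op X)"
    using compatible_opr_lift[OF c X, of i m] i by simp_all
next
  fix i assume i: "1 \<le> i" "i < m"
  show "opr n m i 2 (lift_op F) * opr n m i 2 (lift_op Fi) = 1"
    "opr n m i 2 (lift_op Fi) * opr n m i 2 (lift_op F) = 1"
    using lift_opr_inverse[OF n, of i m] i by simp_all
  have MC: "M_bar n F m i \<in> carrier_mat (n ^ m) (n ^ m)" by (rule M_bar_carrier) (use i in auto)
  have c: "act n m i 2 (lift_op X) \<in> carrier_mat (n ^ m) (n ^ m)" if "X \<in> carrier_mat (n ^ 2) (n ^ 2)" for X :: "'k mat"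
    using that i by (intro act_carrier lift_carrier) auto
  show "embed (n ^ m) (M_bar n F m (Suc i)) = opr n m i 2 (lift_op F) * embed (n ^ m) (M_bar n F m i) * opr n m i 2 (lift_op Fi)"
    unfolding M_bar_Suc[OF i(1)] opr_def embed_mult[OF mult_carrier_mat[OF c[OF F_carrier] MC] c[OF Fi_carrier]]
      embed_mult[OF c[OF F_carrier] MC] ..
next
  fix i assume i: "2 \<le> i" "i < m"
  have "opr n m 1 1 (gen_mat n) * opr n m i 2 (lift_op X) = opr n m i 2 (lift_op X) * opr n m 1 1 (gen_mat n)"
    by (rule opr_commute) (use i X gen_mat_carrier_mat[of n] in \<open>auto intro!: lift_carrier\<close>)
  then show "opr n m i 2 (lift_op X) * embed (n ^ m) (M_bar n F m 1) = embed (n ^ m) (M_bar n F m 1) * opr n m i 2 (lift_op X)"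
    by (simp add: opr_def)
qed

lemma braided_chain_M:
  assumes "n > 0"
  shows "braided_chain (\<lambda>i. opr n m i 2 (lift_op F)) (\<lambda>i. opr n m i 2 (lift_op Fi))
    (\<lambda>i. embed (n ^ m) (M_bar n F m i)) m"
  unfolding braided_chain_def by (rule twist_chain_M[OF assms F_self_compatible F_carrier])

text \<open>Over the field there is no M, and the chain \<open>\<mu>\<close> is taken trivial; this
  version serves to shift antisymmetrizers.\<close>

lemma twist_chain_numeric:
  assumes n: "n > 0" and c: "compatible_pair n X F" and X: "X \<in> carrier_mat (n ^ 2) (n ^ 2)"
  shows "twist_chain (\<lambda>i. opr n m i 2 F) (\<lambda>i. opr n m i 2 Fi) (\<lambda>i. opr n m i 2 X) (\<lambda>i. 1) m"
proof
  fix i j assume ij: "1 \<le> i" "Suc i < j" "j < m"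
  show "opr n m i 2 X * opr n m j 2 F = opr n m j 2 F * opr n m i 2 X"
    by (rule opr_commute) (use ij X in auto)
  show "opr n m j 2 X * opr n m i 2 F = opr n m i 2 F * opr n m j 2 X"
    by (rule opr_commute[symmetric]) (use ij X in auto)
next
  fix i assume i: "1 \<le> i" "Suc i < m"
  show "opr n m i 2 X * opr n m (Suc i) 2 F * opr n m i 2 F
      = opr n m (Suc i) 2 F * opr n m i 2 F * opr n m (Suc i) 2 X"
    "opr n m (Suc i) 2 X * opr n m i 2 F * opr n m (Suc i) 2 F
      = opr n m i 2 F * opr n m (Suc i) 2 F * opr n m i 2 X"
    using compatible_opr[OF c X, of i m] i by simp_all
qed (use opr_inverse[OF n, of _ m] in simp_all)

end

section \<open>Iterated partial quantum traces\<close>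

lemma op_prod_empty: "b < a \<Longrightarrow> op_prod N f a b = 1\<^sub>m N"
  by (simp add: op_prod_def)

lemma op_prod_Suc:
  assumes "\<And>i. a \<le> i \<Longrightarrow> i \<le> Suc b \<Longrightarrow> f i \<in> carrier_mat N N" and "a \<le> Suc b"
  shows "op_prod N f a (Suc b) = op_prod N f a b * f (Suc b)"
proof -
  have *: "foldr (\<lambda>i X. f i * X) xs Y = foldr (\<lambda>i X. f i * X) xs (1\<^sub>m N) * Y \<and>
      foldr (\<lambda>i X. f i * X) xs (1\<^sub>m N) \<in> carrier_mat N N"
    if "\<forall>i\<in>set xs. f i \<in> carrier_mat N N" "Y \<in> carrier_mat N N" for xs Y
    using that
  proof (induction xs)
    case (Cons x xs)
    then have c: "f x \<in> carrier_mat N N" "foldr (\<lambda>i X. f i * X) xs (1\<^sub>m N) \<in> carrier_mat N N" by auto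
    then show ?case
      using Cons assoc_mult_mat[OF c Cons.prems(2)] mult_carrier_mat[OF c] by simp
  qed simp
  have "[a..<Suc (Suc b)] = [a..<Suc b] @ [Suc b]" using assms(2) by simp
  then show ?thesis
    unfolding op_prod_def using *[of "[a..<Suc b]" "f (Suc b)"] assms right_mult_one_mat[OF assms(1)[of "Suc b"]]
    by (simp del: upt_Suc)
qed

lemma op_prod_carrier:
  assumes "\<And>i. a \<le> i \<Longrightarrow> i \<le> b \<Longrightarrow> f i \<in> carrier_mat N N"
  shows "op_prod N f a b \<in> carrier_mat N N"
proof -
  have "foldr (\<lambda>i X. f i * X) xs (1\<^sub>m N) \<in> carrier_mat N N" if "\<forall>i\<in>set xs. f i \<in> carrier_mat N N" for xs
    using that by (induction xs) (auto intro: mult_carrier_mat[of _ N N])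
  then show ?thesis unfolding op_prod_def using assms by (simp del: upt_Suc)
qed

lemma op_prod_map:
  assumes "\<And>i. a \<le> i \<Longrightarrow> i \<le> b \<Longrightarrow> f i \<in> carrier_mat N N"
    and h1: "h (1\<^sub>m N) = 1\<^sub>m N'" and h: "\<And>X Y. X \<in> carrier_mat N N \<Longrightarrow> Y \<in> carrier_mat N N \<Longrightarrow> h (X * Y) = h X * h Y"
    and hf: "\<And>i. a \<le> i \<Longrightarrow> i \<le> b \<Longrightarrow> h (f i) = g i"
  shows "h (op_prod N f a b) = op_prod N' g a b"
proof -
  have "h (foldr (\<lambda>i X. f i * X) xs (1\<^sub>m N)) = foldr (\<lambda>i X. g i * X) xs (1\<^sub>m N') \<and>
      foldr (\<lambda>i X. f i * X) xs (1\<^sub>m N) \<in> carrier_mat N N"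
    if "\<forall>i\<in>set xs. f i \<in> carrier_mat N N \<and> h (f i) = g i" for xs
    using that
  proof (induction xs)
    case (Cons x xs)
    then have c: "f x \<in> carrier_mat N N" "foldr (\<lambda>i X. f i * X) xs (1\<^sub>m N) \<in> carrier_mat N N" by auto
    then show ?case
      using Cons h[OF c] mult_carrier_mat[OF c] by simp
  qed (simp add: h1)
  then show ?thesis unfolding op_prod_def using assms by (simp del: upt_Suc)
qed

lemma op_prod_kron:
  assumes "\<And>i. a \<le> i \<Longrightarrow> i \<le> b \<Longrightarrow> f i \<in> carrier_mat N N"
  shows "kron (op_prod N f a b) (1\<^sub>m e) = op_prod (N * e) (\<lambda>i. kron (f i) (1\<^sub>m e)) a b"
  using assms
proof (rule op_prod_map[where h = "\<lambda>X. kron X (1\<^sub>m e)"])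
  fix X Y :: "'a mat" assume "X \<in> carrier_mat N N" "Y \<in> carrier_mat N N"
  then show "kron (X * Y) (1\<^sub>m e) = kron X (1\<^sub>m e) * kron Y (1\<^sub>m e)"
    by (subst kron_mult[OF _ one_carrier_mat _ one_carrier_mat]) auto
qed (simp_all add: kron_one_one)

lemma op_prod_lift:
  assumes "\<And>i. a \<le> i \<Longrightarrow> i \<le> b \<Longrightarrow> f i \<in> carrier_mat N N"
  shows "lift_op (op_prod N f a b) = op_prod N (\<lambda>i. lift_op (f i)) a b"
  by (rule op_prod_map[OF assms]) (simp_all add: lift_one lift_mult)

lemma op_prod_cong: "(\<And>i. a \<le> i \<Longrightarrow> i \<le> b \<Longrightarrow> f i = g i) \<Longrightarrow> op_prod N f a b = op_prod N g a b"
  unfolding op_prod_def by (rule foldr_cong) auto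

lemma embed_op_prod:
  assumes "\<And>i. a \<le> i \<Longrightarrow> i \<le> b \<Longrightarrow> f i \<in> carrier_mat N N" and N: "N > 0"
  shows "embed N (op_prod N f a b) = chain_prod (\<lambda>i. embed N (f i)) a b"
proof -
  have "embed N (foldr (\<lambda>i X. f i * X) xs (1\<^sub>m N)) = prod_list (map (\<lambda>i. embed N (f i)) xs) \<and>
      foldr (\<lambda>i X. f i * X) xs (1\<^sub>m N) \<in> carrier_mat N N"
    if "\<forall>i\<in>set xs. f i \<in> carrier_mat N N" for xs
    using that
  proof (induction xs)
    case (Cons x xs)
    then have c: "f x \<in> carrier_mat N N" "foldr (\<lambda>i X. f i * X) xs (1\<^sub>m N) \<in> carrier_mat N N" by auto
    then show ?case
      using Cons embed_mult[OF c] mult_carrier_mat[OF c] by simp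
  qed (simp add: embed_one N)
  then show ?thesis unfolding op_prod_def chain_prod_def using assms by (simp del: upt_Suc)
qed

context braided_space
begin

definition ptr :: "nat \<Rightarrow> 'k free_alg mat \<Rightarrow> 'k free_alg mat" where
  "ptr c X = ptrace2 c n (kron (1\<^sub>m c) (lift_op D) * X)"

text \<open>\<open>qtr i j\<close> is the partial quantum trace over the last \<open>j\<close> of \<open>i + j\<close> copies.\<close>

primrec qtr :: "nat \<Rightarrow> nat \<Rightarrow> 'k free_alg mat \<Rightarrow> 'k free_alg mat" where
  "qtr i 0 X = X"
| "qtr i (Suc j) X = qtr i j (ptr (n ^ (i + j)) X)"

lemma lift_D_carrier: "lift_op D \<in> carrier_mat n n"
  by (rule lift_carrier[OF D_carrier])

lemma ptr_carrier [simp]: "ptr c X \<in> carrier_mat c c"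
  by (simp add: ptr_def)

lemma ptr_left:
  assumes P: "P \<in> carrier_mat c c" and X: "X \<in> carrier_mat (c * n) (c * n)"
  shows "ptr c (kron P (1\<^sub>m n) * X) = P * ptr c X"
proof -
  let ?D = "kron (1\<^sub>m c) (lift_op D)"
  have D: "?D \<in> carrier_mat (c * n) (c * n)" by (rule kron_carrier[OF one_carrier_mat lift_D_carrier])
  have P1: "kron P (1\<^sub>m n) \<in> carrier_mat (c * n) (c * n)" by (rule kron_carrier[OF P one_carrier_mat])
  have "?D * kron P (1\<^sub>m n) = kron P (1\<^sub>m n) * ?D"
    using kron_mult[OF one_carrier_mat lift_D_carrier P one_carrier_mat]
      kron_mult[OF P one_carrier_mat one_carrier_mat lift_D_carrier] P carrier_matD[OF lift_D_carrier] by simp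
  then have "?D * (kron P (1\<^sub>m n) * X) = kron P (1\<^sub>m n) * (?D * X)"
    using assoc_mult_mat[OF D P1 X] assoc_mult_mat[OF P1 D X] by simp
  then show ?thesis
    unfolding ptr_def using ptrace2_kron_left[OF P mult_carrier_mat[OF D X]] by simp
qed

lemma ptr_right:
  assumes P: "P \<in> carrier_mat c c" and X: "X \<in> carrier_mat (c * n) (c * n)"
  shows "ptr c (X * kron P (1\<^sub>m n)) = ptr c X * P"
proof -
  have D: "kron (1\<^sub>m c) (lift_op D) \<in> carrier_mat (c * n) (c * n)" by (rule kron_carrier[OF one_carrier_mat lift_D_carrier])
  show ?thesis
    unfolding ptr_def assoc_mult_mat[OF D X kron_carrier[OF P one_carrier_mat], symmetric]
    by (rule ptrace2_kron_right[OF P mult_carrier_mat[OF D X]])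
qed

lemma kron_one_Suc:
  fixes P :: "'a::semiring_1 mat"
  assumes "P \<in> carrier_mat d d"
  shows "kron P (1\<^sub>m (n ^ Suc j)) = kron (kron P (1\<^sub>m (n ^ j))) (1\<^sub>m n)"
  unfolding kron_assoc[OF assms one_carrier_mat one_carrier_mat] kron_one_one power_Suc2 ..

lemma qtr_left:
  assumes P: "P \<in> carrier_mat (n ^ i) (n ^ i)" and "X \<in> carrier_mat (n ^ (i + j)) (n ^ (i + j))"
  shows "qtr i j (kron P (1\<^sub>m (n ^ j)) * X) = P * qtr i j X"
  using assms(2)
proof (induction j arbitrary: X)
  case 0
  then show ?case using kron_one_right[OF P] by simp
next
  case (Suc j)
  have K: "kron P (1\<^sub>m (n ^ j)) \<in> carrier_mat (n ^ (i + j)) (n ^ (i + j))"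
    using kron_carrier[OF P one_carrier_mat, of "n ^ j"] by (simp add: power_add)
  have X: "X \<in> carrier_mat (n ^ (i + j) * n) (n ^ (i + j) * n)" using Suc.prems by (simp add: mult.commute)
  show ?case unfolding qtr.simps kron_one_Suc[OF P] ptr_left[OF K X] by (rule Suc.IH) simp
qed

lemma qtr_right:
  assumes P: "P \<in> carrier_mat (n ^ i) (n ^ i)" and "X \<in> carrier_mat (n ^ (i + j)) (n ^ (i + j))"
  shows "qtr i j (X * kron P (1\<^sub>m (n ^ j))) = qtr i j X * P"
  using assms(2)
proof (induction j arbitrary: X)
  case 0
  then show ?case using kron_one_right[OF P] by simp
next
  case (Suc j)
  have K: "kron P (1\<^sub>m (n ^ j)) \<in> carrier_mat (n ^ (i + j)) (n ^ (i + j))"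
    using kron_carrier[OF P one_carrier_mat, of "n ^ j"] by (simp add: power_add)
  have X: "X \<in> carrier_mat (n ^ (i + j) * n) (n ^ (i + j) * n)" using Suc.prems by (simp add: mult.commute)
  show ?case unfolding qtr.simps kron_one_Suc[OF P] ptr_right[OF K X] by (rule Suc.IH) simp
qed

lemma qtr_add: "qtr i (a + b) X = qtr i a (qtr (i + a) b X)"
  by (induction b arbitrary: X) (simp_all add: add.assoc)

definition Dprod :: "nat \<Rightarrow> nat \<Rightarrow> 'k mat" where
  "Dprod k a = op_prod (n ^ k) (\<lambda>a. act n k a 1 D) a k"

lemma D_act_carrier: "1 \<le> a \<Longrightarrow> a \<le> k \<Longrightarrow> act n k a 1 D \<in> carrier_mat (n ^ k) (n ^ k)"
  using D_carrier by (intro act_carrier) auto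

lemma Dprod_carrier: "1 \<le> a \<Longrightarrow> Dprod k a \<in> carrier_mat (n ^ k) (n ^ k)"
  unfolding Dprod_def by (intro op_prod_carrier D_act_carrier) auto

text \<open>The simultaneous trace equals the iterated one: the operators D of the earlier copies do
  not touch the last copy and leave its trace.\<close>

lemma ptrace_Dprod:
  assumes "Z \<in> carrier_mat (n ^ (i + j)) (n ^ (i + j))"
  shows "ptrace2 (n ^ i) (n ^ j) (lift_op (Dprod (i + j) (Suc i)) * Z) = qtr i j Z"
  using assms
proof (induction j arbitrary: Z)
  case 0
  then show ?case using ptrace2_one[of Z "n ^ i"] by (simp add: Dprod_def op_prod_empty lift_one)
next
  case (Suc j)
  let ?m = "i + j"
  have D1: "D \<in> carrier_mat (n ^ 1) (n ^ 1)" using D_carrier by simp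
  have P: "Dprod ?m (Suc i) \<in> carrier_mat (n ^ ?m) (n ^ ?m)" by (rule Dprod_carrier) simp
  have "Dprod (i + Suc j) (Suc i) = op_prod (n ^ Suc ?m) (\<lambda>a. act n (Suc ?m) a 1 D) (Suc i) ?m * act n (Suc ?m) (Suc ?m) 1 D"
    unfolding Dprod_def add_Suc_right by (rule op_prod_Suc) (rule D_act_carrier, auto)
  also have "op_prod (n ^ Suc ?m) (\<lambda>a. act n (Suc ?m) a 1 D) (Suc i) ?m = kron (Dprod ?m (Suc i)) (1\<^sub>m n)"
    unfolding Dprod_def power_Suc2
  proof (subst op_prod_kron)
    show "op_prod (n ^ ?m * n) (\<lambda>a. act n (Suc ?m) a 1 D) (Suc i) ?m
        = op_prod (n ^ ?m * n) (\<lambda>a. kron (act n ?m a 1 D) (1\<^sub>m n)) (Suc i) ?m"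
      using kron_act_right[OF D1, of _ ?m 1] by (intro op_prod_cong) simp
  qed (rule D_act_carrier, auto)
  also have "act n (Suc ?m) (Suc ?m) 1 D = kron (1\<^sub>m (n ^ ?m)) D"
    using kron_act_left[OF D1, of 1 1 ?m] act_full1[OF D1] by simp
  finally have DP: "lift_op (Dprod (i + Suc j) (Suc i))
      = kron (lift_op (Dprod ?m (Suc i))) (1\<^sub>m n) * kron (1\<^sub>m (n ^ ?m)) (lift_op D)"
    using lift_mult[OF kron_carrier[OF P one_carrier_mat] kron_carrier[OF one_carrier_mat D_carrier]]
    by (simp add: lift_kron lift_one)
  have Z: "Z \<in> carrier_mat (n ^ ?m * n) (n ^ ?m * n)" using Suc.prems by (simp add: mult.commute)
  have KD: "kron (1\<^sub>m (n ^ ?m)) (lift_op D) \<in> carrier_mat (n ^ ?m * n) (n ^ ?m * n)"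
    by (rule kron_carrier[OF one_carrier_mat lift_D_carrier])
  have KP: "kron (lift_op (Dprod ?m (Suc i))) (1\<^sub>m n) \<in> carrier_mat (n ^ ?m * n) (n ^ ?m * n)"
    by (rule kron_carrier[OF lift_carrier[OF P] one_carrier_mat])
  have "ptrace2 (n ^ i) (n ^ Suc j) (lift_op (Dprod (i + Suc j) (Suc i)) * Z)
      = ptrace2 (n ^ i) (n ^ j) (ptrace2 (n ^ ?m) n (kron (lift_op (Dprod ?m (Suc i))) (1\<^sub>m n) * (kron (1\<^sub>m (n ^ ?m)) (lift_op D) * Z)))"
    unfolding DP assoc_mult_mat[OF KP KD Z] unfolding power_add ptrace2_ptrace2 power_Suc2 ..
  also have "\<dots> = ptrace2 (n ^ i) (n ^ j) (lift_op (Dprod ?m (Suc i)) * ptr (n ^ ?m) Z)"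
    unfolding ptr_def ptrace2_kron_left[OF lift_carrier[OF P] mult_carrier_mat[OF KD Z]] ..
  also have "\<dots> = qtr i j (ptr (n ^ ?m) Z)" by (rule Suc.IH) simp
  finally show ?case by simp
qed

lemma qtrace_from2_eq:
  assumes "Z \<in> carrier_mat (n ^ Suc j) (n ^ Suc j)"
  shows "qtrace_from2 n F (Suc j) Z = qtr 1 j Z"
  using ptrace_Dprod[of Z 1 j] assms by (simp add: qtrace_from2_def Dprod_def numeral_2_eq_2)

section \<open>Shifting a traced block by one copy\<close>

text \<open>\<open>shift_up i j = F\<^sub>i\<^sub>+\<^sub>1 \<dots> F\<^sub>i\<^sub>+\<^sub>j\<close> on \<open>i + j + 1\<close> copies, and its inverse.\<close>

primrec shift_up :: "nat \<Rightarrow> nat \<Rightarrow> 'k free_alg mat" where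
  "shift_up i 0 = 1\<^sub>m (n ^ Suc i)"
| "shift_up i (Suc j) = kron (shift_up i j) (1\<^sub>m n) * kron (1\<^sub>m (n ^ (i + j))) (lift_op F)"

primrec shift_down :: "nat \<Rightarrow> nat \<Rightarrow> 'k free_alg mat" where
  "shift_down i 0 = 1\<^sub>m (n ^ Suc i)"
| "shift_down i (Suc j) = kron (1\<^sub>m (n ^ (i + j))) (lift_op Fi) * kron (shift_down i j) (1\<^sub>m n)"

lemma kron_F_carrier:
  "X \<in> carrier_mat (n ^ 2) (n ^ 2) \<Longrightarrow> kron (1\<^sub>m (n ^ m)) (lift_op X) \<in> carrier_mat (n ^ Suc m * n) (n ^ Suc m * n)"
  using kron_carrier[OF one_carrier_mat lift_carrier, of X "n ^ 2" "n ^ m"]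
  by (simp only: power_Suc2 power2_eq_square mult.assoc)

lemma shift_carrier:
  "shift_up i j \<in> carrier_mat (n ^ Suc (i + j)) (n ^ Suc (i + j))"
  "shift_down i j \<in> carrier_mat (n ^ Suc (i + j)) (n ^ Suc (i + j))"
proof (induction j)
  case (Suc j)
  have e: "n ^ Suc (i + Suc j) = n ^ Suc (i + j) * n" by simp
  {
    case 1
    show ?case unfolding shift_up.simps e
      by (rule mult_carrier_mat[OF kron_carrier[OF Suc(1) one_carrier_mat] kron_F_carrier[OF F_carrier]])
  next
    case 2
    show ?case unfolding shift_down.simps e
      by (rule mult_carrier_mat[OF kron_F_carrier[OF Fi_carrier] kron_carrier[OF Suc(2) one_carrier_mat]])
  }
qed simp_all

lemma shift_inverse: "shift_up i j * shift_down i j = 1\<^sub>m (n ^ Suc (i + j))"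
proof (induction j)
  case (Suc j)
  let ?U = "kron (shift_up i j) (1\<^sub>m n)" and ?V = "kron (shift_down i j) (1\<^sub>m n)"
  let ?F = "kron (1\<^sub>m (n ^ (i + j))) (lift_op F)" and ?G = "kron (1\<^sub>m (n ^ (i + j))) (lift_op Fi)"
  have e: "n ^ Suc (i + Suc j) = n ^ Suc (i + j) * n" by simp
  have e': "n ^ (i + j) * n ^ 2 = n ^ Suc (i + j) * n" by (simp only: power_Suc2 power2_eq_square mult.assoc)
  have cs: "?U \<in> carrier_mat (n ^ Suc (i + j) * n) (n ^ Suc (i + j) * n)" "?V \<in> carrier_mat (n ^ Suc (i + j) * n) (n ^ Suc (i + j) * n)"
    by (rule kron_carrier[OF shift_carrier(1) one_carrier_mat] kron_carrier[OF shift_carrier(2) one_carrier_mat])+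
  note cF = kron_F_carrier[OF F_carrier, of "i + j"] kron_F_carrier[OF Fi_carrier, of "i + j"]
  have "?F * ?G = kron (1\<^sub>m (n ^ (i + j))) (lift_op F * lift_op Fi)"
    using kron_mult[OF one_carrier_mat lift_carrier[OF F_carrier] one_carrier_mat lift_carrier[OF Fi_carrier], of "n ^ (i + j)"] by simp
  also have "\<dots> = 1\<^sub>m (n ^ Suc (i + j) * n)"
    unfolding lift_mult[OF F_carrier Fi_carrier, symmetric] F_Fi lift_one kron_one_one e' ..
  finally have FG: "?F * ?G = 1\<^sub>m (n ^ Suc (i + j) * n)" .
  have "shift_up i (Suc j) * shift_down i (Suc j) = ?U * ((?F * ?G) * ?V)"
    unfolding shift_up.simps shift_down.simps assoc_mult_mat[OF cs(1) cF(1) mult_carrier_mat[OF cF(2) cs(2)]]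
      assoc_mult_mat[OF cF cs(2)] ..
  also have "\<dots> = ?U * ?V" unfolding FG left_mult_one_mat[OF cs(2)] ..
  also have "\<dots> = kron (shift_up i j * shift_down i j) (1\<^sub>m n)"
    using kron_mult[OF shift_carrier(1) one_carrier_mat shift_carrier(2) one_carrier_mat, of n] by simp
  finally show ?case unfolding Suc.IH kron_one_one e .
qed simp

lemma shift_up_eq: "shift_up i j = op_prod (n ^ Suc (i + j)) (\<lambda>l. act n (Suc (i + j)) l 2 (lift_op F)) (Suc i) (i + j)"
proof (induction j)
  case (Suc j)
  let ?m = "Suc (i + j)"
  have LF: "lift_op F \<in> carrier_mat (n ^ 2) (n ^ 2)" by (rule lift_carrier[OF F_carrier])
  have c: "act n m l 2 (lift_op F) \<in> carrier_mat (n ^ m) (n ^ m)" if "1 \<le> l" "l < m" for m l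
    by (rule act_carrier[OF LF]) (use that in auto)
  have e: "n ^ Suc ?m = n ^ ?m * n" by simp
  have "op_prod (n ^ Suc ?m) (\<lambda>l. act n (Suc ?m) l 2 (lift_op F)) (Suc i) (Suc (i + j))
      = op_prod (n ^ Suc ?m) (\<lambda>l. act n (Suc ?m) l 2 (lift_op F)) (Suc i) (i + j) * act n (Suc ?m) ?m 2 (lift_op F)"
    by (rule op_prod_Suc) (rule c, auto)
  also have "op_prod (n ^ Suc ?m) (\<lambda>l. act n (Suc ?m) l 2 (lift_op F)) (Suc i) (i + j)
      = op_prod (n ^ ?m * n) (\<lambda>l. kron (act n ?m l 2 (lift_op F)) (1\<^sub>m n)) (Suc i) (i + j)"
    unfolding e using kron_act_right[OF LF, of _ ?m 1] by (intro op_prod_cong) simp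
  also have "\<dots> = kron (shift_up i j) (1\<^sub>m n)"
    unfolding Suc.IH by (rule op_prod_kron[symmetric]) (rule c, auto)
  also have "act n (Suc ?m) ?m 2 (lift_op F) = kron (1\<^sub>m (n ^ (i + j))) (lift_op F)"
    using kron_act_left[OF LF, of 1 2 "i + j"] act_full1[OF LF] by simp
  finally show ?case by simp
qed (simp add: op_prod_empty)

text \<open>The innermost F of the conjugation sits at the last copy, the first to be traced. There
  \<open>trace_conj\<close> removes it together with its inverse, the outer factors leave the trace,
  and what remains is a shorter conjugation of the traced W.\<close>

lemma qtr_shift:
  assumes "W \<in> carrier_mat (n ^ (i + j)) (n ^ (i + j))"
  shows "qtr (Suc i) j (shift_up i j * (kron W (1\<^sub>m n) * shift_down i j)) = kron (qtr i j W) (1\<^sub>m n)"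
  using assms
proof (induction j arbitrary: W)
  case 0
  then show ?case
    using right_mult_one_mat[OF kron_carrier[OF 0[simplified] one_carrier_mat], of n]
      left_mult_one_mat[OF kron_carrier[OF 0[simplified] one_carrier_mat], of n]
    by (simp add: mult.commute)
next
  case (Suc j)
  let ?c = "n ^ (i + j)" and ?m = "n ^ Suc (i + j)"
  let ?U = "shift_up i j" and ?V = "shift_down i j"
  let ?F = "kron (1\<^sub>m ?c) (lift_op F)" and ?G = "kron (1\<^sub>m ?c) (lift_op Fi)"
  note UV = shift_carrier[of i j]
  note cU = kron_carrier[OF UV(1) one_carrier_mat, of n] and cV = kron_carrier[OF UV(2) one_carrier_mat, of n]
  note cF = kron_F_carrier[OF F_carrier, of "i + j"] and cG = kron_F_carrier[OF Fi_carrier, of "i + j"]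
  have W: "W \<in> carrier_mat (?c * n) (?c * n)" using Suc.prems by (simp add: mult.commute)
  have m: "?m = ?c * n" by simp
  have cW: "kron W (1\<^sub>m n) \<in> carrier_mat (?m * n) (?m * n)" using kron_carrier[OF W one_carrier_mat, of n] unfolding m .
  let ?X = "?F * (kron W (1\<^sub>m n) * ?G)"
  have WG: "kron W (1\<^sub>m n) * ?G \<in> carrier_mat (?m * n) (?m * n)" by (rule mult_carrier_mat[OF cW cG])
  have X: "?X \<in> carrier_mat (?m * n) (?m * n)" by (rule mult_carrier_mat[OF cF WG])
  have "shift_up i (Suc j) * (kron W (1\<^sub>m n) * shift_down i (Suc j)) = kron ?U (1\<^sub>m n) * (?X * kron ?V (1\<^sub>m n))"
    unfolding shift_up.simps shift_down.simps assoc_mult_mat[OF cU cF mult_carrier_mat[OF cW mult_carrier_mat[OF cG cV]]]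
    unfolding assoc_mult_mat[OF cW cG cV, symmetric] assoc_mult_mat[OF cF WG cV] ..
  then have "ptr (n ^ (Suc i + j)) (shift_up i (Suc j) * (kron W (1\<^sub>m n) * shift_down i (Suc j))) = ?U * (ptr ?m ?X * ?V)"
    using ptr_left[OF UV(1) mult_carrier_mat[OF X cV]] ptr_right[OF UV(2) X] by simp
  also have "ptr ?m ?X = kron (ptr ?c W) (1\<^sub>m n)"
    unfolding ptr_def m by (rule trace_conj[OF W])
  finally show ?case using Suc.IH[of "ptr ?c W"] by simp
qed

end

section \<open>Antisymmetrizers of the Yang--Baxter matrix\<close>

lemma kron_add:
  fixes A B X Y :: "'a::semiring_1 mat"
  assumes "A \<in> carrier_mat d d" "X \<in> carrier_mat e e" "Y \<in> carrier_mat e e"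
  shows "kron A (X + Y) = kron A X + kron A Y" "kron (X + Y) A = kron X A + kron Y A"
proof -
  show "kron A (X + Y) = kron A X + kron A Y"
    by (rule mat_pair_eqI[of _ d e]) (use assms in \<open>simp_all add: kron_index[of _ d _ e] distrib_left
      pair_less carrier_matD[OF kron_carrier[OF assms(1,3)]]\<close>)
  show "kron (X + Y) A = kron X A + kron Y A"
    by (rule mat_pair_eqI[of _ e d]) (use assms in \<open>simp_all add: kron_index[of _ e _ d] distrib_right
      pair_less carrier_matD[OF kron_carrier[OF assms(3,1)]]\<close>)
qed

lemma kron_smult:
  fixes A X :: "'a::comm_semiring_1 mat"
  assumes "A \<in> carrier_mat d d" "X \<in> carrier_mat e e"
  shows "kron A (c \<cdot>\<^sub>m X) = c \<cdot>\<^sub>m kron A X" "kron (c \<cdot>\<^sub>m X) A = c \<cdot>\<^sub>m kron X A"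
proof -
  show "kron A (c \<cdot>\<^sub>m X) = c \<cdot>\<^sub>m kron A X"
    by (rule mat_pair_eqI[of _ d e]) (use assms in \<open>simp_all add: kron_index[of _ d _ e] mult.left_commute
      pair_less carrier_matD[OF kron_carrier[OF assms]]\<close>)
  show "kron (c \<cdot>\<^sub>m X) A = c \<cdot>\<^sub>m kron X A"
    by (rule mat_pair_eqI[of _ e d]) (use assms in \<open>simp_all add: kron_index[of _ e _ d] mult.assoc
      pair_less carrier_matD[OF kron_carrier[OF assms(2,1)]]\<close>)
qed

lemma opr_add:
  fixes X Y :: "'a::ring_1 mat"
  assumes X: "X \<in> carrier_mat (n ^ r) (n ^ r)" and Y: "Y \<in> carrier_mat (n ^ r) (n ^ r)" and i: "1 \<le> i" "i + r \<le> Suc m"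
  shows "opr n m i r (X + Y) = opr n m i r X + opr n m i r Y"
proof -
  have "act n m i r (X + Y) = act n m i r X + act n m i r Y"
    unfolding act_def kron_add(1)[OF one_carrier_mat X Y]
    by (rule kron_add(2)[OF one_carrier_mat kron_carrier[OF one_carrier_mat X] kron_carrier[OF one_carrier_mat Y]])
  then show ?thesis
    unfolding opr_def using embed_add[OF act_carrier[OF X i] act_carrier[OF Y i]] by simp
qed

lemma opr_smult:
  fixes X :: "'k::field mat"
  assumes X: "X \<in> carrier_mat (n ^ r) (n ^ r)" and i: "1 \<le> i" "i + r \<le> Suc m"
  shows "opr n m i r (c \<cdot>\<^sub>m X) = endo_scale c (opr n m i r X)"
proof -
  have "act n m i r (c \<cdot>\<^sub>m X) = c \<cdot>\<^sub>m act n m i r X"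
    unfolding act_def kron_smult(1)[OF one_carrier_mat X]
    by (rule kron_smult(2)[OF one_carrier_mat kron_carrier[OF one_carrier_mat X]])
  then show ?thesis
    unfolding opr_def using embed_smult[OF act_carrier[OF X i]] by simp
qed

lemma opr_diff:
  fixes X Y :: "'a::ring_1 mat"
  assumes X: "X \<in> carrier_mat (n ^ r) (n ^ r)" and Y: "Y \<in> carrier_mat (n ^ r) (n ^ r)" and i: "1 \<le> i" "i + r \<le> Suc m"
  shows "opr n m i r (X - Y) = opr n m i r X - opr n m i r Y"
proof -
  have "X - Y + Y = X" using X Y by (intro eq_matI) auto
  then show ?thesis using opr_add[OF minus_carrier_mat[OF Y, of X] Y i] by (simp add: algebra_simps)
qed

lemma opr_opr:
  assumes "Y \<in> carrier_mat (n ^ s) (n ^ s)" "1 \<le> a" "a + s \<le> Suc r" "1 \<le> i" "i + r \<le> Suc m"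
  shows "opr n m i r (act n r a s Y) = opr n m (i + a - 1) s Y"
  unfolding opr_def act_act[OF assms] ..

lemma antisym_carrier: "R \<in> carrier_mat (n ^ 2) (n ^ 2) \<Longrightarrow> antisym n q R k \<in> carrier_mat (n ^ k) (n ^ k)"
proof (induction k)
  case (Suc j)
  show ?case
  proof (cases j)
    case (Suc m)
    let ?k = "Suc j"
    have A: "act n ?k 1 j (antisym n q R j) \<in> carrier_mat (n ^ ?k) (n ^ ?k)"
      by (rule act_carrier[OF Suc.IH[OF Suc.prems]]) auto
    have "act n ?k j 2 R \<in> carrier_mat (n ^ ?k) (n ^ ?k)"
      by (rule act_carrier[OF Suc.prems]) (auto simp: Suc)
    then have S: "q ^ j \<cdot>\<^sub>m 1\<^sub>m (n ^ ?k) - qnum q j \<cdot>\<^sub>m act n ?k j 2 R \<in> carrier_mat (n ^ ?k) (n ^ ?k)"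
      by (intro minus_carrier_mat smult_carrier_mat)
    have "antisym n q R ?k = (1 / qnum q ?k) \<cdot>\<^sub>m (act n ?k 1 j (antisym n q R j) *
        (q ^ j \<cdot>\<^sub>m 1\<^sub>m (n ^ ?k) - qnum q j \<cdot>\<^sub>m act n ?k j 2 R) * act n ?k 1 j (antisym n q R j))"
      unfolding Suc antisym.simps by (simp add: Let_def)
    also have "\<dots> \<in> carrier_mat (n ^ ?k) (n ^ ?k)"
      by (rule smult_carrier_mat[OF mult_carrier_mat[OF mult_carrier_mat[OF A S] A]])
    finally show ?thesis .
  qed simp
qed simp

locale quantum_matrix = braided_space n F for n :: nat and F :: "'k::field mat" +
  fixes R :: "'k mat" and q :: 'k
  assumes n_pos: "n > 0" and R_yb: "yang_baxter n R" and R_hecke: "hecke_type n q R"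
    and compat: "compatible_pair n R F"
    and q_nz: "q \<noteq> 0" and q_no_root: "m > 0 \<Longrightarrow> q ^ m \<noteq> 1"
begin

sublocale H: hecke_scalars endo_scale q
  using scaled_ring_endo q_nz q_no_root by (simp add: hecke_scalars_def hecke_scalars_axioms_def)

lemma R_carrier [simp]: "R \<in> carrier_mat (n ^ 2) (n ^ 2)"
  using R_yb by (simp add: yang_baxter_def)

abbreviation "antisymm \<equiv> antisym n q R"

lemma antisymm_carrier: "antisymm k \<in> carrier_mat (n ^ k) (n ^ k)"
  by (rule antisym_carrier[OF R_carrier])

text \<open>The dictionary between matrices and ring elements: a block of j copies starting at copy
  p + 1 uses the generators R_{p+1}, ..., R_{p+j-1}.\<close>

lemma opr_antisymm:
  "p + j \<le> m \<Longrightarrow> opr n m (Suc p) j (antisymm j) = H.asym q (\<lambda>l. opr n m (l + p) 2 R) j"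
proof (induction j)
  case 0
  then show ?case using opr_one[OF n_pos, of "Suc p" 0 m] by simp
next
  case (Suc j)
  show ?case
  proof (cases j)
    case 0
    have "qnum q 0 = 0" by (simp add: qnum_def)
    then show ?thesis
      using opr_one[OF n_pos, of "Suc p" 1 m] Suc.prems by (simp add: 0 H.qnum_1 H.sc_simps)
  next
    case j: (Suc i)
    let ?k = "Suc j"
    have b: "1 \<le> Suc p" "Suc p + ?k \<le> Suc m" using Suc.prems by auto
    let ?A = "act n ?k 1 j (antisymm j)" and ?R = "act n ?k j 2 R" and ?I = "1\<^sub>m (n ^ ?k) :: 'k mat"
    have A: "?A \<in> carrier_mat (n ^ ?k) (n ^ ?k)" by (rule act_carrier[OF antisymm_carrier]) auto
    have Rc: "?R \<in> carrier_mat (n ^ ?k) (n ^ ?k)" by (rule act_carrier[OF R_carrier]) (auto simp: j)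
    have I: "c \<cdot>\<^sub>m ?I \<in> carrier_mat (n ^ ?k) (n ^ ?k)" for c by simp
    have RR: "c \<cdot>\<^sub>m ?R \<in> carrier_mat (n ^ ?k) (n ^ ?k)" for c using Rc by (rule smult_carrier_mat)
    note S = minus_carrier_mat[OF RR, of "q ^ j \<cdot>\<^sub>m ?I" "qnum q j"]
    have eA: "opr n m (Suc p) ?k ?A = H.asym q (\<lambda>l. opr n m (l + p) 2 R) j"
      using opr_opr[OF antisymm_carrier, of 1 j ?k "Suc p" m] b Suc by simp
    have eR: "opr n m (Suc p) ?k ?R = opr n m (j + p) 2 R"
      using opr_opr[OF R_carrier, of j ?k "Suc p" m] b j by (simp add: add.commute)
    have "antisymm ?k = (1 / qnum q ?k) \<cdot>\<^sub>m (?A * (q ^ j \<cdot>\<^sub>m ?I - qnum q j \<cdot>\<^sub>m ?R) * ?A)"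
      unfolding j antisym.simps by (simp add: Let_def)
    then have "opr n m (Suc p) ?k (antisymm ?k) = endo_scale (1 / qnum q ?k)
       (opr n m (Suc p) ?k ?A * (endo_scale (q ^ j) 1 - endo_scale (qnum q j) (opr n m (Suc p) ?k ?R)) * opr n m (Suc p) ?k ?A)"
      by (simp only: opr_smult[OF mult_carrier_mat[OF mult_carrier_mat[OF A S] A] b]
        opr_mult[OF mult_carrier_mat[OF A S] A b] opr_mult[OF A S b] opr_diff[OF I RR b]
        opr_smult[OF Rc b] opr_smult[OF one_carrier_mat b] opr_one[OF n_pos b])
    then show ?thesis unfolding eA eR by simp
  qed
qed

lemma R_square: "R * R = (q - inverse q) \<cdot>\<^sub>m R + 1\<^sub>m (n ^ 2)"
proof -
  let ?e = "opr n 2 1 2 :: 'k mat \<Rightarrow> _" and ?I = "1\<^sub>m (n ^ 2) :: 'k mat"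
  have b: "(1::nat) \<le> 1" "1 + 2 \<le> Suc 2" by auto
  have I: "c \<cdot>\<^sub>m ?I \<in> carrier_mat (n ^ 2) (n ^ 2)" for c by simp
  have S: "R - q \<cdot>\<^sub>m ?I \<in> carrier_mat (n ^ 2) (n ^ 2)" "R + inverse q \<cdot>\<^sub>m ?I \<in> carrier_mat (n ^ 2) (n ^ 2)"
    by (rule minus_carrier_mat[OF I] add_carrier_mat[OF I])+
  have Z: "?e (0\<^sub>m (n ^ 2) (n ^ 2)) = 0"
  proof -
    have "?I - ?I = 0\<^sub>m (n ^ 2) (n ^ 2)" by (rule eq_matI) auto
    moreover have "?e (?I - ?I) = ?e ?I - ?e ?I" by (rule opr_diff[OF one_carrier_mat one_carrier_mat b])
    ultimately show ?thesis by (simp only: diff_self)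
  qed
  have "?e ((R - q \<cdot>\<^sub>m ?I) * (R + inverse q \<cdot>\<^sub>m ?I)) = 0"
    using R_hecke Z by (simp add: hecke_type_def)
  then have "(?e R - endo_scale q 1) * (?e R + endo_scale (inverse q) 1) = 0"
    by (simp only: opr_mult[OF S b] opr_diff[OF R_carrier I b] opr_add[OF R_carrier I b]
      opr_smult[OF one_carrier_mat b] opr_one[OF n_pos b])
  then have "?e R * ?e R = endo_scale (q - inverse q) (?e R) + 1"
    using q_nz by (simp add: H.sc_simps algebra_simps H.sc_diff(2) eq_neg_iff_add_eq_0)
  then have "?e (R * R) = ?e ((q - inverse q) \<cdot>\<^sub>m R + ?I)"
    by (simp only: opr_mult[OF R_carrier R_carrier b] opr_add[OF smult_carrier_mat[OF R_carrier] one_carrier_mat b]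
      opr_smult[OF R_carrier b] opr_one[OF n_pos b])
  then show ?thesis
    unfolding opr_def using act_full1 embed_eq_iff mult_carrier_mat[OF R_carrier R_carrier]
      add_carrier_mat[OF one_carrier_mat, of "(q - inverse q) \<cdot>\<^sub>m R" "n ^ 2"]
    by metis
qed

lemma hecke_gens_R:
  assumes "p + K \<le> m"
  shows "H.hecke_gens (\<lambda>l. opr n m (l + p) 2 R) K"
  unfolding H.hecke_gens_def
proof (intro conjI allI impI)
  fix i assume i: "1 \<le> i \<and> i < K"
  then have b: "1 \<le> i + p" "i + p + 2 \<le> Suc m" using assms by auto
  show "opr n m (i + p) 2 R * opr n m (i + p) 2 R = endo_scale (q - inverse q) (opr n m (i + p) 2 R) + 1"
    unfolding opr_mult[OF R_carrier R_carrier b, symmetric] R_square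
    by (simp only: opr_add[OF smult_carrier_mat[OF R_carrier] one_carrier_mat b]
      opr_smult[OF R_carrier b] opr_one[OF n_pos b])
next
  fix i assume i: "1 \<le> i \<and> Suc i < K"
  then have "1 \<le> i + p" "i + p + 2 \<le> m" using assms by auto
  then show "opr n m (i + p) 2 R * opr n m (Suc i + p) 2 R * opr n m (i + p) 2 R =
      opr n m (Suc i + p) 2 R * opr n m (i + p) 2 R * opr n m (Suc i + p) 2 R"
    using opr_braid[of n 1 R 2 R 1 R 2 R 1 R 2 R "i + p" m] R_yb
    by (simp add: yang_baxter_def)
next
  fix i j assume ij: "1 \<le> i \<and> Suc i < j \<and> j < K"
  show "opr n m (i + p) 2 R * opr n m (j + p) 2 R = opr n m (j + p) 2 R * opr n m (i + p) 2 R"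
    by (rule opr_commute) (use ij assms in auto)
qed

text \<open>\<open>M_antisym i j\<close> is \<open>A\<^sub>j M\<^sub>i\<^sub>+\<^sub>1 \<dots> M\<^sub>i\<^sub>+\<^sub>j\<close> in the last \<open>j\<close> of \<open>i + j\<close> copies.\<close>

definition M_antisym :: "nat \<Rightarrow> nat \<Rightarrow> 'k free_alg mat" where
  "M_antisym i j = lift_op (act n (i + j) (Suc i) j (antisymm j)) * op_prod (n ^ (i + j)) (M_bar n F (i + j)) (Suc i) (i + j)"

lemma lift_antisymm_carrier: "Suc p + j \<le> Suc m \<Longrightarrow> lift_op (act n m (Suc p) j (antisymm j)) \<in> carrier_mat (n ^ m) (n ^ m)"
  by (rule lift_carrier, rule act_carrier[OF antisymm_carrier]) auto

lemma M_prod_carrier: "1 \<le> a \<Longrightarrow> b \<le> m \<Longrightarrow> op_prod (n ^ m) (M_bar n F m) a b \<in> carrier_mat (n ^ m) (n ^ m)"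
  by (rule op_prod_carrier, rule M_bar_carrier) auto

lemma M_antisym_carrier: "M_antisym i j \<in> carrier_mat (n ^ (i + j)) (n ^ (i + j))"
  unfolding M_antisym_def by (rule mult_carrier_mat[OF lift_antisymm_carrier M_prod_carrier]) auto

text \<open>Conjugation by F_{i+1} ... F_{i+j} moves the whole block by one copy: each R_l in the
  antisymmetrizer becomes R_{l+1} by compatibility, and each overlined M_l becomes the next
  one.\<close>

lemma M_antisym_shift: "M_antisym (Suc i) j = shift_up i j * (kron (M_antisym i j) (1\<^sub>m n) * shift_down i j)"
proof -
  let ?m = "Suc (i + j)"
  let ?N = "n ^ ?m"
  let ?A = "\<lambda>p. act n ?m (Suc p) j (antisymm j)"
  \<comment> \<open>The same product as \<open>shift_up i j\<close>, but over the field, where the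
    antisymmetrizer is an element of a scaled ring; the identity is lifted afterwards.\<close>
  define u where "u = op_prod ?N (\<lambda>l. act n ?m l 2 F) (Suc i) (i + j)"
  have N: "?N > 0" using n_pos by simp
  have cA: "?A p \<in> carrier_mat ?N ?N" if "p \<le> Suc i" for p
    by (rule act_carrier[OF antisymm_carrier]) (use that in auto)
  have cF: "act n ?m l 2 F \<in> carrier_mat ?N ?N" if "Suc i \<le> l" "l \<le> i + j" for l
    by (rule act_carrier[OF F_carrier]) (use that in auto)
  have u: "u \<in> carrier_mat ?N ?N" unfolding u_def by (rule op_prod_carrier[OF cF])
  interpret Rn: twist_chain "\<lambda>i. opr n ?m i 2 F" "\<lambda>i. opr n ?m i 2 Fi" "\<lambda>i. opr n ?m i 2 R" "\<lambda>i. 1" ?m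
    by (rule twist_chain_numeric[OF n_pos compat R_carrier])
  interpret B: braided_chain "\<lambda>i. opr n ?m i 2 (lift_op F)" "\<lambda>i. opr n ?m i 2 (lift_op Fi)"
      "\<lambda>i. embed ?N (M_bar n F ?m i)" ?m
    by (rule braided_chain_M[OF n_pos])
  have eu: "embed ?N u = chain_prod (\<lambda>l. opr n ?m l 2 F) (Suc i) (i + j)"
    unfolding u_def opr_def by (rule embed_op_prod[OF cF N])
  have "embed ?N u * H.asym q (\<lambda>l. opr n ?m (l + i) 2 R) j = H.asym q (\<lambda>l. opr n ?m (l + Suc i) 2 R) j * embed ?N u"
  proof (rule H.asym_intertwine)
    fix l assume "1 \<le> l" "l < j"
    then show "embed ?N u * opr n ?m (l + i) 2 R = opr n ?m (l + Suc i) 2 R * embed ?N u"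
      unfolding eu using Rn.r_shift[of "Suc i" "l + i" "i + j"] by simp
  qed
  moreover have eA: "embed ?N (?A p) = H.asym q (\<lambda>l. opr n ?m (l + p) 2 R) j" if "p \<le> Suc i" for p
    using opr_antisymm[of p j ?m] that unfolding opr_def[of n ?m "Suc p" j] by simp
  ultimately have "embed ?N (u * ?A i) = embed ?N (?A (Suc i) * u)"
    by (simp only: embed_mult[OF u cA] embed_mult[OF cA u] le_refl le_SucI)
  then have uA: "u * ?A i = ?A (Suc i) * u"
    using embed_eq_iff[OF mult_carrier_mat[OF u cA] mult_carrier_mat[OF cA u], of i "Suc i"] by simp
  have Lu: "lift_op u = shift_up i j"
  proof -
    have "lift_op u = op_prod ?N (\<lambda>l. lift_op (act n ?m l 2 F)) (Suc i) (i + j)"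
      unfolding u_def by (rule op_prod_lift[OF cF])
    then show ?thesis unfolding shift_up_eq by (simp only: lift_act)
  qed
  let ?LA = "\<lambda>p. lift_op (?A p)"
  have cL: "?LA p \<in> carrier_mat ?N ?N" if "p \<le> Suc i" for p by (rule lift_carrier[OF cA[OF that]])
  have LA: "shift_up i j * ?LA i = ?LA (Suc i) * shift_up i j"
    unfolding Lu[symmetric] using lift_mult[OF u cA, of i] lift_mult[OF cA u, of "Suc i"] uA by simp
  let ?P = "op_prod ?N (M_bar n F ?m) (Suc i) (i + j)" and ?Q = "op_prod ?N (M_bar n F ?m) (Suc (Suc i)) ?m"
  have cP: "?P \<in> carrier_mat ?N ?N" "?Q \<in> carrier_mat ?N ?N" by (rule M_prod_carrier; simp)+
  have ePQ: "embed ?N ?P = chain_prod (\<lambda>l. embed ?N (M_bar n F ?m l)) (Suc i) (i + j)"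
    "embed ?N ?Q = chain_prod (\<lambda>l. embed ?N (M_bar n F ?m l)) (Suc (Suc i)) (Suc (i + j))"
    by (rule embed_op_prod[OF M_bar_carrier N]; simp)+
  note cU = shift_carrier(1)[of i j] and cV = shift_carrier(2)[of i j]
  have LF: "lift_op F \<in> carrier_mat (n ^ 2) (n ^ 2)" by (rule lift_carrier[OF F_carrier])
  have eU: "embed ?N (shift_up i j) = chain_prod (\<lambda>l. opr n ?m l 2 (lift_op F)) (Suc i) (i + j)"
    unfolding shift_up_eq opr_def by (rule embed_op_prod[OF act_carrier[OF LF] N]) auto
  have "embed ?N (shift_up i j) * embed ?N ?P = embed ?N ?Q * embed ?N (shift_up i j)"
    unfolding ePQ
  proof (rule chain_prod_intertwine)
    fix l assume "Suc i \<le> l" "l \<le> i + j"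
    then show "embed ?N (shift_up i j) * embed ?N (M_bar n F ?m l) = embed ?N (M_bar n F ?m (Suc l)) * embed ?N (shift_up i j)"
      unfolding eU using B.\<mu>_shift[of "Suc i" l "i + j"] by simp
  qed
  then have "embed ?N (shift_up i j * ?P) = embed ?N (?Q * shift_up i j)"
    by (simp only: embed_mult[OF cU cP(1)] embed_mult[OF cP(2) cU])
  then have UP: "shift_up i j * ?P = ?Q * shift_up i j"
    by (rule iffD1[OF embed_eq_iff[OF mult_carrier_mat[OF cU cP(1)] mult_carrier_mat[OF cP(2) cU]]])
  have K: "kron (M_antisym i j) (1\<^sub>m n) = ?LA i * ?P"
  proof -
    have c: "lift_op (act n (i + j) (Suc i) j (antisymm j)) \<in> carrier_mat (n ^ (i + j)) (n ^ (i + j))"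
      by (rule lift_antisymm_carrier) simp
    have "kron (lift_op (act n (i + j) (Suc i) j (antisymm j))) (1\<^sub>m n) = ?LA i"
      using kron_act_right[OF antisymm_carrier, of "Suc i" j "i + j" 1]
        lift_kron[of "act n (i + j) (Suc i) j (antisymm j)" "1\<^sub>m n"]
      by (simp add: lift_one)
    moreover have "kron (op_prod (n ^ (i + j)) (M_bar n F (i + j)) (Suc i) (i + j)) (1\<^sub>m n) = ?P"
    proof -
      have "kron (op_prod (n ^ (i + j)) (M_bar n F (i + j)) (Suc i) (i + j)) (1\<^sub>m n)
        = op_prod (n ^ (i + j) * n) (\<lambda>l. kron (M_bar n F (i + j) l) (1\<^sub>m n)) (Suc i) (i + j)"
        by (rule op_prod_kron[OF M_bar_carrier]) auto
      also have "\<dots> = ?P"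
        using M_bar_extend[of _ "i + j" 1] by (subst power_Suc2) (auto intro!: op_prod_cong)
      finally show ?thesis .
    qed
    ultimately show ?thesis
      unfolding M_antisym_def using kron_mult[OF c one_carrier_mat M_prod_carrier one_carrier_mat, of "Suc i" "i + j" n] by simp
  qed
  have "shift_up i j * (kron (M_antisym i j) (1\<^sub>m n) * shift_down i j) = (shift_up i j * ?LA i) * (?P * shift_down i j)"
    unfolding K assoc_mult_mat[OF cL[OF le_SucI[OF le_refl]] cP(1) cV]
      assoc_mult_mat[OF cU cL[OF le_SucI[OF le_refl]] mult_carrier_mat[OF cP(1) cV]] ..
  also have "\<dots> = ?LA (Suc i) * ((shift_up i j * ?P) * shift_down i j)"
    unfolding LA assoc_mult_mat[OF cL[OF le_refl] cU mult_carrier_mat[OF cP(1) cV]]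
      assoc_mult_mat[OF cU cP(1) cV] ..
  also have "\<dots> = ?LA (Suc i) * (?Q * (shift_up i j * shift_down i j))"
    unfolding UP assoc_mult_mat[OF cP(2) cU cV] ..
  also have "\<dots> = M_antisym (Suc i) j"
    unfolding shift_inverse right_mult_one_mat[OF cP(2)] by (simp add: M_antisym_def)
  finally show ?thesis ..
qed

text \<open>Without preceding copies this is the definition of sigma_j. Each further preceding copy
  is the result of a shift, and by \<open>qtr_shift\<close> it carries the identity; so the trace
  stays a multiple of I although the overlined M's act in the preceding copies as well.\<close>

lemma qtr_M_antisym: "qtr i j (M_antisym i j) = sigma n q R F j \<cdot>\<^sub>m 1\<^sub>m (n ^ i)"
proof (induction i)
  case 0
  show ?case
  proof (cases j)
    case 0
    \<comment> \<open>With no copies at all the matrices have size 1, and the value agrees with the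
      convention sigma_0 = 1.\<close>
    have "act n 0 1 0 (antisymm 0) = 1\<^sub>m (n ^ 0)"
      using act_one[of 1 0 0 n, where ?'a = 'k] by simp
    then have "M_antisym 0 0 = 1\<^sub>m (n ^ 0)"
      unfolding M_antisym_def by (simp add: op_prod_empty lift_one)
    then show ?thesis by (simp add: 0 sigma_def) (rule eq_matI, auto)
  next
    case (Suc l)
    have X: "M_antisym 0 j \<in> carrier_mat (n ^ Suc l) (n ^ Suc l)"
      using M_antisym_carrier[of 0 j] by (simp add: Suc)
    have "M_antisym 0 j = lift_op (antisymm j) * op_prod (n ^ j) (M_bar n F j) 1 j"
      unfolding M_antisym_def using act_full1[OF antisymm_carrier] by simp
    then have W: "M_wedge n q R F j = qtr 1 l (M_antisym 0 j)"
      unfolding M_wedge_def using qtrace_from2_eq[OF X] by (simp add: Suc)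
    have "qtr 0 j (M_antisym 0 j) = ptr 1 (qtr 1 l (M_antisym 0 j))"
      using qtr_add[of 0 1 l "M_antisym 0 j"] by (simp add: Suc)
    also have "\<dots> = mat_trace (lift_op D * qtr 1 l (M_antisym 0 j)) \<cdot>\<^sub>m 1\<^sub>m 1"
      unfolding ptr_def using kron_one_left[OF lift_D_carrier] carrier_matD[OF lift_D_carrier]
      by (intro eq_matI) (auto simp: ptrace2_def mat_trace_def)
    also have "mat_trace (lift_op D * qtr 1 l (M_antisym 0 j)) = sigma n q R F j"
      by (simp add: sigma_def Suc qtrace_def W[unfolded Suc])
    finally show ?thesis by simp
  qed
next
  case (Suc i)
  have "kron (c \<cdot>\<^sub>m 1\<^sub>m (n ^ i)) (1\<^sub>m n) = c \<cdot>\<^sub>m 1\<^sub>m (n ^ Suc i)" for c :: "'k free_alg"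
    unfolding power_Suc2
    by (rule mat_pair_eqI[of _ "n ^ i" n]) (auto simp: kron_index[of _ "n ^ i" _ n] pair_less pair_eq_iff)
  then show ?case
    unfolding M_antisym_shift qtr_shift[OF M_antisym_carrier] Suc.IH by simp
qed

section \<open>Separating a power of M from a coefficient sigma_j\<close>

abbreviation "M_prod k \<equiv> op_prod (n ^ k) (M_bar n F k) 1 k"
abbreviation "R_prod k p \<equiv> op_prod (n ^ k) (\<lambda>i. act n k i 2 R) 1 p"

lemma R_prod_carrier: "p < k \<Longrightarrow> R_prod k p \<in> carrier_mat (n ^ k) (n ^ k)"
  by (rule op_prod_carrier, rule act_carrier[OF R_carrier]) auto

lemma op_prod_split:
  assumes "\<And>i. a \<le> i \<Longrightarrow> i \<le> b \<Longrightarrow> f i \<in> carrier_mat N N" "N > 0" "a \<le> Suc c" "c \<le> b"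
  shows "op_prod N f a b = op_prod N (f :: nat \<Rightarrow> 'x::ring_1 mat) a c * op_prod N f (Suc c) b"
proof -
  have c: "op_prod N f a c \<in> carrier_mat N N" "op_prod N f (Suc c) b \<in> carrier_mat N N" "op_prod N f a b \<in> carrier_mat N N"
    using assms by (auto intro!: op_prod_carrier)
  have "embed N (op_prod N f a b) = embed N (op_prod N f a c * op_prod N f (Suc c) b)"
    unfolding embed_mult[OF c(1,2)] using assms chain_prod_split[of a c b "\<lambda>i. embed N (f i)"]
    by (simp add: embed_op_prod)
  then show ?thesis using embed_eq_iff[OF c(3) mult_carrier_mat[OF c(1,2)]] by simp
qed

text \<open>The antisymmetrizer acts in the last j copies, so it passes the first p + 1 overlined
  M's and meets the remaining ones. Their trace over the last j copies is sigma_j I, and the first p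
  + 1 copies yield the power of M.\<close>

lemma M_pow_sigma:
  assumes k: "k = Suc (p + j)"
  shows "qtrace_from2 n F k (lift_op (R_prod k p * act n k (Suc (Suc p)) j (antisymm j)) * M_prod k)
    = M_pow n R F (Suc p) * (sigma n q R F j \<cdot>\<^sub>m 1\<^sub>m n)"
proof -
  let ?i = "Suc p" and ?N = "n ^ k"
  let ?A = "act n k (Suc ?i) j (antisymm j)"
  have A: "?A \<in> carrier_mat ?N ?N" by (rule act_carrier[OF antisymm_carrier]) (auto simp: k)
  have Rp: "R_prod k p \<in> carrier_mat ?N ?N" by (rule R_prod_carrier) (simp add: k)
  have N: "?N > 0" using n_pos by simp
  have ki: "k = ?i + j" by (simp add: k)
  have MP: "op_prod ?N (M_bar n F k) 1 ?i \<in> carrier_mat ?N ?N" "op_prod ?N (M_bar n F k) (Suc ?i) k \<in> carrier_mat ?N ?N"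
    by (rule M_prod_carrier; simp add: k)+
  have split: "M_prod k = op_prod ?N (M_bar n F k) 1 ?i * op_prod ?N (M_bar n F k) (Suc ?i) k"
    by (rule op_prod_split[OF M_bar_carrier N]) (auto simp: k)
  have k1: "kron (op_prod (n ^ ?i) f 1 b) (1\<^sub>m (n ^ j)) = op_prod ?N g 1 b"
    if "\<And>l. 1 \<le> l \<Longrightarrow> l \<le> b \<Longrightarrow> f l \<in> carrier_mat (n ^ ?i) (n ^ ?i) \<and> kron (f l) (1\<^sub>m (n ^ j)) = g l"
    for f g :: "nat \<Rightarrow> 'x::ring_1 mat" and b
  proof -
    have "kron (op_prod (n ^ ?i) f 1 b) (1\<^sub>m (n ^ j)) = op_prod (n ^ ?i * n ^ j) (\<lambda>l. kron (f l) (1\<^sub>m (n ^ j))) 1 b"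
      by (rule op_prod_kron) (use that in auto)
    also have "\<dots> = op_prod ?N g 1 b"
      unfolding ki power_add by (rule op_prod_cong) (use that in auto)
    finally show ?thesis .
  qed
  have M1: "op_prod ?N (M_bar n F k) 1 ?i = kron (M_prod ?i) (1\<^sub>m (n ^ j))"
  proof (rule k1[symmetric], intro conjI)
    fix l assume l: "1 \<le> l" "l \<le> ?i"
    show "M_bar n F ?i l \<in> carrier_mat (n ^ ?i) (n ^ ?i)" by (rule M_bar_carrier[OF l])
    show "kron (M_bar n F ?i l) (1\<^sub>m (n ^ j)) = M_bar n F k l" unfolding ki by (rule M_bar_extend[OF l, symmetric])
  qed
  have R1: "R_prod k p = kron (R_prod ?i p) (1\<^sub>m (n ^ j))"
  proof (rule k1[symmetric], intro conjI)
    fix l assume "1 \<le> l" "l \<le> p"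
    then show "act n ?i l 2 R \<in> carrier_mat (n ^ ?i) (n ^ ?i)" by (intro act_carrier[OF R_carrier]) auto
    show "kron (act n ?i l 2 R) (1\<^sub>m (n ^ j)) = act n k l 2 R"
      unfolding ki by (rule kron_act_right[OF R_carrier]) (use \<open>1 \<le> l\<close> \<open>l \<le> p\<close> in auto)
  qed
  have cR: "R_prod ?i p \<in> carrier_mat (n ^ ?i) (n ^ ?i)" by (rule R_prod_carrier) simp
  have cM: "M_prod ?i \<in> carrier_mat (n ^ ?i) (n ^ ?i)" by (rule M_prod_carrier) auto
  have cA': "antisymm j \<in> carrier_mat (n ^ j) (n ^ j)" by (rule antisymm_carrier)
  have A1: "lift_op ?A = kron (1\<^sub>m (n ^ ?i)) (lift_op (antisymm j))"
    using kron_act_left[OF cA', of 1 j ?i] act_full1[OF cA'] lift_kron[of "1\<^sub>m (n ^ ?i)" "antisymm j"]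
    by (simp add: ki lift_one)
  have comm: "lift_op ?A * op_prod ?N (M_bar n F k) 1 ?i = op_prod ?N (M_bar n F k) 1 ?i * lift_op ?A"
    unfolding A1 M1
    using kron_mult[OF one_carrier_mat lift_carrier[OF cA'] cM one_carrier_mat]
      kron_mult[OF cM one_carrier_mat one_carrier_mat lift_carrier[OF cA']] cM carrier_matD[OF cA'] by simp
  define Z where "Z = lift_op (R_prod ?i p) * M_prod ?i"
  have Z: "Z \<in> carrier_mat (n ^ ?i) (n ^ ?i)" unfolding Z_def by (rule mult_carrier_mat[OF lift_carrier[OF cR] cM])
  have KZ: "kron Z (1\<^sub>m (n ^ j)) = lift_op (R_prod k p) * op_prod ?N (M_bar n F k) 1 ?i"
    unfolding Z_def M1 R1 lift_kron lift_one
    using kron_mult[OF lift_carrier[OF cR] one_carrier_mat cM one_carrier_mat, of "n ^ j"] by simp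
  have MA: "M_antisym ?i j = lift_op ?A * op_prod ?N (M_bar n F k) (Suc ?i) k"
    unfolding M_antisym_def ki ..
  have LA: "lift_op ?A \<in> carrier_mat ?N ?N" and LR: "lift_op (R_prod k p) \<in> carrier_mat ?N ?N"
    by (rule lift_carrier[OF A] lift_carrier[OF Rp])+
  have "lift_op (R_prod k p * ?A) * M_prod k = lift_op (R_prod k p) * ((lift_op ?A * op_prod ?N (M_bar n F k) 1 ?i)
      * op_prod ?N (M_bar n F k) (Suc ?i) k)"
    unfolding lift_mult[OF Rp A] split assoc_mult_mat[OF LR LA mult_carrier_mat[OF MP]] assoc_mult_mat[OF LA MP] ..
  also have "\<dots> = kron Z (1\<^sub>m (n ^ j)) * M_antisym ?i j"
    unfolding comm KZ MA assoc_mult_mat[OF MP(1) LA MP(2)] assoc_mult_mat[OF LR MP(1) mult_carrier_mat[OF LA MP(2)]] ..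
  finally have eq: "lift_op (R_prod k p * ?A) * M_prod k = kron Z (1\<^sub>m (n ^ j)) * M_antisym ?i j" .
  have total: "lift_op (R_prod k p * ?A) * M_prod k \<in> carrier_mat (n ^ Suc (p + j)) (n ^ Suc (p + j))"
    unfolding k[symmetric] by (rule mult_carrier_mat[OF lift_carrier[OF mult_carrier_mat[OF Rp A]] M_prod_carrier]) auto
  let ?s = "sigma n q R F j"
  have "qtrace_from2 n F k (lift_op (R_prod k p * ?A) * M_prod k) = qtr 1 p (qtr (1 + p) j (kron Z (1\<^sub>m (n ^ j)) * M_antisym ?i j))"
    unfolding eq[symmetric] qtr_add[symmetric] using qtrace_from2_eq[OF total] by (simp add: k)
  also have "qtr (1 + p) j (kron Z (1\<^sub>m (n ^ j)) * M_antisym ?i j) = Z * (?s \<cdot>\<^sub>m 1\<^sub>m (n ^ ?i))"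
    using qtr_left[OF Z M_antisym_carrier] by (simp add: qtr_M_antisym)
  \<comment> \<open>As sigma_j is not central, it has to remain a right factor; written as an
    operator on the first copy, it leaves the trace on the right.\<close>
  also have "?s \<cdot>\<^sub>m 1\<^sub>m (n ^ ?i) = kron (?s \<cdot>\<^sub>m 1\<^sub>m n) (1\<^sub>m (n ^ p))"
    unfolding power_Suc
    by (rule mat_pair_eqI[of _ n "n ^ p"]) (auto simp: kron_index[of _ n _ "n ^ p"] pair_less pair_eq_iff)
  also have "qtr 1 p (Z * kron (?s \<cdot>\<^sub>m 1\<^sub>m n) (1\<^sub>m (n ^ p))) = qtr 1 p Z * (?s \<cdot>\<^sub>m 1\<^sub>m n)"
    using qtr_right[of "?s \<cdot>\<^sub>m 1\<^sub>m n" 1 Z p] Z by simp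
  also have "qtr 1 p Z = M_pow n R F ?i"
    unfolding M_pow_def using qtrace_from2_eq[OF Z] by (simp add: Z_def)
  finally show ?thesis .
qed

end

section \<open>Cyclicity modulo the relations\<close>

lemma free_mat_gen: "free_mat n n (gen_mat n)"
  by (auto simp: free_mat_def gen_mat_def free_algebra_def)

context quantum_matrix
begin

abbreviation "\<I> \<equiv> qm_ideal n R F"
abbreviation "R'' \<equiv> twist F (twist F R)"

lemma ideal_I: "ideal \<I> (free_algebra n)"
  by (rule qm_class_ring_hom(1)[OF R_yb F_yb])

lemma I_subset: "x \<in> \<I> \<Longrightarrow> x \<in> carrier (free_algebra n)"
  using ideal.Icarr[OF ideal_I] .

lemma I_zero: "0 \<in> \<I>"
  using additive_subgroup.zero_closed[OF ideal.axioms(1)[OF ideal_I]] by (simp add: free_algebra_ops)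

lemma I_add: "x \<in> \<I> \<Longrightarrow> y \<in> \<I> \<Longrightarrow> x + y \<in> \<I>"
  using additive_subgroup.a_closed[OF ideal.axioms(1)[OF ideal_I]] by (simp add: free_algebra_ops)

lemma I_left: "x \<in> \<I> \<Longrightarrow> a \<in> carrier (free_algebra n) \<Longrightarrow> a * x \<in> \<I>"
  using ideal.I_l_closed[OF ideal_I] by (simp add: free_algebra_ops)

lemma I_right: "x \<in> \<I> \<Longrightarrow> a \<in> carrier (free_algebra n) \<Longrightarrow> x * a \<in> \<I>"
  using ideal.I_r_closed[OF ideal_I] by (simp add: free_algebra_ops)

lemma I_sum: "(\<And>i. i \<in> S \<Longrightarrow> h i \<in> \<I>) \<Longrightarrow> sum h S \<in> \<I>"
  by (induction S rule: infinite_finite_induct) (auto intro: I_zero I_add)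

section \<open>Matrices over the ideal of relations and over the free algebra\<close>

definition ideal_mat :: "nat \<Rightarrow> 'k free_alg mat \<Rightarrow> bool" where
  "ideal_mat d X \<longleftrightarrow> X \<in> carrier_mat d d \<and> (\<forall>i<d. \<forall>j<d. X $$ (i, j) \<in> \<I>)"

lemma ideal_mat_mult:
  assumes A: "free_mat n d A" and X: "ideal_mat d X"
  shows "ideal_mat d (A * X)" "ideal_mat d (X * A)"
proof -
  have c: "A \<in> carrier_mat d d" "X \<in> carrier_mat d d" using assms by (auto simp: free_mat_def ideal_mat_def)
  show "ideal_mat d (A * X)" unfolding ideal_mat_def
    using assms mult_carrier_mat[OF c] unfolding ideal_mat_def free_mat_def
    by (auto simp: index_mult_sum[OF c] simp del: index_mult_mat(1) intro!: I_sum I_left)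
  show "ideal_mat d (X * A)" unfolding ideal_mat_def
    using assms mult_carrier_mat[OF c(2,1)] unfolding ideal_mat_def free_mat_def
    by (auto simp: index_mult_sum[OF c(2,1)] simp del: index_mult_mat(1) intro!: I_sum I_right)
qed

lemma ideal_mat_kron_left:
  assumes A: "free_mat n d A" and X: "ideal_mat e X"
  shows "ideal_mat (d * e) (kron A X)" "ideal_mat (e * d) (kron X A)"
proof -
  have c: "A \<in> carrier_mat d d" "X \<in> carrier_mat e e" using assms by (auto simp: free_mat_def ideal_mat_def)
  have *: "i div b < a" "i mod b < b" if "i < a * b" for i a b :: nat
  proof -
    have "b > 0" using that by (cases b) auto
    then show "i div b < a" "i mod b < b" using that by (simp_all add: less_mult_imp_div_less)
  qed
  show "ideal_mat (d * e) (kron A X)"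
    unfolding ideal_mat_def
  proof (intro conjI allI impI)
    fix i j assume ij: "i < d * e" "j < d * e"
    then have "kron A X $$ (i, j) = A $$ (i div e, j div e) * X $$ (i mod e, j mod e)"
      using c by (simp add: kron_def)
    also have "\<dots> \<in> \<I>"
      by (rule I_left) (use assms *[OF ij(1)] *[OF ij(2)] in \<open>auto simp: ideal_mat_def free_mat_def\<close>)
    finally show "kron A X $$ (i, j) \<in> \<I>" .
  qed (rule kron_carrier[OF c])
  show "ideal_mat (e * d) (kron X A)"
    unfolding ideal_mat_def
  proof (intro conjI allI impI)
    fix i j assume ij: "i < e * d" "j < e * d"
    then have "kron X A $$ (i, j) = X $$ (i div d, j div d) * A $$ (i mod d, j mod d)"
      using c by (simp add: kron_def)
    also have "\<dots> \<in> \<I>"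
      by (rule I_right) (use assms *[OF ij(1)] *[OF ij(2)] in \<open>auto simp: ideal_mat_def free_mat_def\<close>)
    finally show "kron X A $$ (i, j) \<in> \<I>" .
  qed (rule kron_carrier[OF c(2,1)])
qed

lemma ideal_mat_add: "ideal_mat d X \<Longrightarrow> ideal_mat d Y \<Longrightarrow> ideal_mat d (X + Y)"
  by (auto simp: ideal_mat_def I_add)

lemma ideal_mat_ptrace2: "ideal_mat (d * e) X \<Longrightarrow> ideal_mat d (ptrace2 d e X)"
  by (auto simp: ideal_mat_def ptrace2_index pair_less intro!: I_sum)

lemma free_mat_ptrace2:
  assumes "free_mat n (d * e) X"
  shows "free_mat n d (ptrace2 d e X)"
proof -
  have "(\<Sum>l<m. X $$ (i * e + l, j * e + l)) \<in> carrier (free_algebra n)" if "m \<le> e" "i < d" "j < d" for i j m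
    using that assms by (induction m) (auto simp: free_carrier_simps free_mat_def pair_less)
  then show ?thesis by (auto simp: free_mat_def ptrace2_index)
qed

lemma free_mat_act:
  assumes "free_mat n (n ^ r) X" "1 \<le> i" "i + r \<le> Suc m"
  shows "free_mat n (n ^ m) (act n m i r X)"
proof -
  have "m = (i - 1) + r + (m + 1 - i - r)" using assms by simp
  then have "n ^ m = n ^ (i - 1) * n ^ r * n ^ (m + 1 - i - r)" by (metis power_add)
  then show ?thesis unfolding act_def using free_mat_kron[OF free_mat_kron[OF free_mat_one assms(1)] free_mat_one] by simp
qed

lemma free_mat_M_bar: "1 \<le> i \<Longrightarrow> i \<le> m \<Longrightarrow> free_mat n (n ^ m) (M_bar n F m i)"
proof (induction i)
  case (Suc i)
  show ?case
  proof (cases "i = 0")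
    case True
    then show ?thesis using free_mat_act[of 1 "gen_mat n" 1 m] free_mat_gen[of n] Suc.prems by simp
  next
    case False
    then have i: "1 \<le> i" "i + 2 \<le> Suc m" using Suc.prems by auto
    have "free_mat n (n ^ m) (act n m i 2 (lift_op X))" if "X \<in> carrier_mat (n ^ 2) (n ^ 2)" for X :: "'k mat"
      by (rule free_mat_act[OF free_mat_lift[OF that] i])
    then show ?thesis unfolding M_bar_Suc[OF i(1)]
      using Suc.IH i Suc.prems by (intro free_mat_mult) auto
  qed
qed simp

text \<open>Such elements are stable under multiplication by images of matrices over the carrier
  only, hence the companion \<open>in_free\<close>: the type \<open>free_alg\<close> also contains
  words in letters outside the n^2 generators.\<close>

definition in_ideal :: "nat \<Rightarrow> 'k free_alg seq_endo \<Rightarrow> bool" where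
  "in_ideal N x \<longleftrightarrow> (\<exists>X. ideal_mat N X \<and> x = embed N X)"

definition in_free :: "nat \<Rightarrow> 'k free_alg seq_endo \<Rightarrow> bool" where
  "in_free N x \<longleftrightarrow> (\<exists>X. free_mat n N X \<and> x = embed N X)"

lemma in_free_mult: "in_free N x \<Longrightarrow> in_free N y \<Longrightarrow> in_free N (x * y)"
proof -
  assume "in_free N x" "in_free N y"
  then obtain X Y where X: "free_mat n N X" "x = embed N X" and Y: "free_mat n N Y" "y = embed N Y"
    unfolding in_free_def by blast
  have "X \<in> carrier_mat N N" "Y \<in> carrier_mat N N" using X Y by (auto simp: free_mat_def)
  then show "in_free N (x * y)"
    unfolding in_free_def X(2) Y(2) using embed_mult free_mat_mult[OF X(1) Y(1)] by metis
qed

lemma in_ideal_mult: "in_free N x \<Longrightarrow> in_ideal N y \<Longrightarrow> in_ideal N (x * y)" "in_free N x \<Longrightarrow> in_ideal N y \<Longrightarrow> in_ideal N (y * x)"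
proof -
  assume "in_free N x" "in_ideal N y"
  then obtain X Y where X: "free_mat n N X" "x = embed N X" and Y: "ideal_mat N Y" "y = embed N Y"
    unfolding in_free_def in_ideal_def by blast
  have c: "X \<in> carrier_mat N N" "Y \<in> carrier_mat N N" using X Y by (auto simp: free_mat_def ideal_mat_def)
  show "in_ideal N (x * y)" "in_ideal N (y * x)"
    unfolding in_ideal_def X(2) Y(2) embed_mult[OF c, symmetric] embed_mult[OF c(2,1), symmetric]
    using ideal_mat_mult[OF X(1) Y(1)] by blast+
qed

lemma in_free_one: "N > 0 \<Longrightarrow> in_free N 1"
  unfolding in_free_def using free_mat_one embed_one by metis

lemma in_free_chain: "N > 0 \<Longrightarrow> (\<And>i. a \<le> i \<Longrightarrow> i \<le> b \<Longrightarrow> in_free N (f i)) \<Longrightarrow> in_free N (chain_prod f a b)"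
proof -
  assume N: "N > 0" and f: "\<And>i. a \<le> i \<Longrightarrow> i \<le> b \<Longrightarrow> in_free N (f i)"
  have "in_free N (prod_list (map f xs))" if "\<forall>i\<in>set xs. in_free N (f i)" for xs
    using that by (induction xs) (auto intro: in_free_one N in_free_mult)
  then show ?thesis unfolding chain_prod_def using f by (simp del: upt_Suc)
qed

lemma R''_carrier: "R'' \<in> carrier_mat (n ^ 2) (n ^ 2)"
  by (rule twist_twist_carrier[OF R_carrier])

lemma lift_opr_twist_twist:
  assumes i: "1 \<le> i" "i + 2 \<le> Suc m"
  shows "opr n m i 2 (lift_op R'') = opr n m i 2 (lift_op F) *
    (opr n m i 2 (lift_op F) * opr n m i 2 (lift_op R) * opr n m i 2 (lift_op Fi)) * opr n m i 2 (lift_op Fi)"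
proof -
  have FX: "F * R \<in> carrier_mat (n ^ 2) (n ^ 2)" by (rule mult_carrier_mat[OF F_carrier R_carrier])
  have T: "F * R * Fi \<in> carrier_mat (n ^ 2) (n ^ 2)" by (rule mult_carrier_mat[OF FX Fi_carrier])
  have e: "lift_op R'' = lift_op F * (lift_op F * lift_op R * lift_op Fi) * lift_op Fi"
    unfolding twist_def lift_mult[OF mult_carrier_mat[OF F_carrier T] Fi_carrier] lift_mult[OF F_carrier T]
      lift_mult[OF FX Fi_carrier] lift_mult[OF F_carrier R_carrier] ..
  note L = lift_carrier[OF F_carrier] lift_carrier[OF R_carrier] lift_carrier[OF Fi_carrier]
  note LX = mult_carrier_mat[OF L(1,2)]
  note LT = mult_carrier_mat[OF LX L(3)]
  show ?thesis
    unfolding e opr_mult[OF mult_carrier_mat[OF L(1) LT] L(3) i] opr_mult[OF L(1) LT i]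
      opr_mult[OF LX L(3) i] opr_mult[OF L(1,2) i] ..
qed

section \<open>The quadratic relations in arbitrary neighbouring copies\<close>

lemma relation_matrix:
  "ideal_mat (n ^ 2) (lift_op R * M_bar n F 2 1 * M_bar n F 2 2 - M_bar n F 2 1 * M_bar n F 2 2 * lift_op R'')"
  (is "ideal_mat _ ?X")
proof -
  have M: "M_bar n F 2 i \<in> carrier_mat (n ^ 2) (n ^ 2)" if "i \<in> {1, 2}" for i
    by (rule M_bar_carrier) (use that in auto)
  have "?X \<in> carrier_mat (n ^ 2) (n ^ 2)"
    by (rule minus_carrier_mat[OF mult_carrier_mat[OF mult_carrier_mat[OF M M] lift_carrier[OF R''_carrier]]]) auto
  moreover have "elements_mat ?X \<subseteq> \<I>"
  proof -
    interpret ring "free_algebra n :: 'k free_alg ring" by (rule ring_free_algebra)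
    have "qm_relations n R F \<subseteq> \<I>"
      unfolding qm_ideal_def
      by (rule genideal_self[OF qm_relations_carrier[OF R_carrier F_carrier]]) (use F_yb in \<open>simp add: yang_baxter_def\<close>)
    then show ?thesis by (simp add: qm_relations_def)
  qed
  ultimately show ?thesis
    unfolding ideal_mat_def using elements_matI by blast
qed

text \<open>The first pair of copies is the defining relation. Conjugation by F_i F_{i+1} raises all
  indices in the relation by one, and it preserves membership in the ideal because its entries are
  scalars.\<close>

lemma relation_shifted:
  assumes "1 \<le> i" "i < k"
  shows "in_ideal (n ^ k) (opr n k i 2 (lift_op R) * embed (n ^ k) (M_bar n F k i) * embed (n ^ k) (M_bar n F k (Suc i))
    - embed (n ^ k) (M_bar n F k i) * embed (n ^ k) (M_bar n F k (Suc i)) * opr n k i 2 (lift_op R''))"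
    (is "in_ideal ?N (?rel i)")
  using assms
proof (induction i)
  case (Suc i)
  let ?f = "\<lambda>i. opr n k i 2 (lift_op F)" and ?g = "\<lambda>i. opr n k i 2 (lift_op Fi)"
  let ?r = "\<lambda>i. opr n k i 2 (lift_op R)" and ?r'' = "\<lambda>i. opr n k i 2 (lift_op R'')"
  let ?\<mu> = "\<lambda>i. embed ?N (M_bar n F k i)"
  show ?case
  proof (cases "i = 0")
    case True
    obtain p where k: "k = 2 + p" using Suc.prems True by (metis less_iff_Suc_add One_nat_def Suc_1 add_Suc)
    let ?X = "lift_op R * M_bar n F 2 1 * M_bar n F 2 2 - M_bar n F 2 1 * M_bar n F 2 2 * lift_op R''"
    have b: "(1::nat) \<le> 1" "1 + 2 \<le> Suc k" using k by auto
    have M: "M_bar n F 2 1 \<in> carrier_mat (n ^ 2) (n ^ 2)" "M_bar n F 2 2 \<in> carrier_mat (n ^ 2) (n ^ 2)"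
      by (rule M_bar_carrier; simp)+
    note LR = lift_carrier[OF R_carrier] and LR'' = lift_carrier[OF R''_carrier]
    have Me: "opr n k 1 2 (M_bar n F 2 i) = ?\<mu> i" if "i \<in> {1, 2}" for i
    proof -
      have "M_bar n F 2 i \<in> carrier_mat (n ^ 2) (n ^ 2)" by (rule M_bar_carrier) (use that in auto)
      then have "act n k 1 2 (M_bar n F 2 i) = kron (M_bar n F 2 i) (1\<^sub>m (n ^ p))" by (simp add: act_def k)
      also have "\<dots> = M_bar n F k i" unfolding k by (rule M_bar_extend[symmetric]) (use that in auto)
      finally show ?thesis by (simp add: opr_def)
    qed
    have k': "n ^ k = n ^ 2 * n ^ p" unfolding k by (rule power_add)
    have "act n k 1 2 ?X = kron ?X (1\<^sub>m (n ^ p))"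
    proof -
      have X: "?X \<in> carrier_mat (n ^ 2) (n ^ 2)" using relation_matrix unfolding ideal_mat_def by blast
      then show ?thesis using kron_act_right[OF X, of 1 2 p] unfolding act_full1[OF X] k by simp
    qed
    then have "ideal_mat ?N (act n k 1 2 ?X)"
      unfolding k' using ideal_mat_kron_left(2)[OF free_mat_one relation_matrix] by simp
    moreover have "embed ?N (act n k 1 2 ?X) = ?rel (Suc i)"
      unfolding opr_def[symmetric] True
      opr_diff[OF mult_carrier_mat[OF mult_carrier_mat[OF LR M(1)] M(2)] mult_carrier_mat[OF mult_carrier_mat[OF M] LR''] b]
        opr_mult[OF mult_carrier_mat[OF LR M(1)] M(2) b] opr_mult[OF LR M(1) b]
        opr_mult[OF mult_carrier_mat[OF M] LR'' b] opr_mult[OF M b]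
      using Me[of 1] Me[of 2] by (simp add: numeral_2_eq_2)
    ultimately show ?thesis unfolding in_ideal_def by metis
  next
    case False
    then have i: "1 \<le> i" "i < k" "Suc i < k" using Suc.prems by auto
    interpret B: braided_chain ?f ?g ?\<mu> k by (rule braided_chain_M[OF n_pos])
    interpret Rc: twist_chain ?f ?g ?r ?\<mu> k by (rule twist_chain_M[OF n_pos compat R_carrier])
    \<comment> \<open>The shift must also apply to the double twist on the right-hand side of the
      relation.\<close>
    interpret R2: twist_chain ?f ?g "\<lambda>i. ?f i * (?f i * ?r i * ?g i) * ?g i" ?\<mu> k
      by (rule B.twist_chain_twist) (rule Rc.twist_chain_axioms)
    let ?u = "chain_prod ?f i (Suc i)" and ?v = "?g (Suc i) * ?g i"
    have uf: "?u = ?f i * ?f (Suc i)" by (simp add: chain_prod_Suc chain_prod_single)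
    have u: "?u * ?r i = ?r (Suc i) * ?u" by (rule Rc.r_shift) (use i in auto)
    have u2: "?u * ?r'' i = ?r'' (Suc i) * ?u"
      using R2.r_shift[of i i "Suc i"] i by (simp add: lift_opr_twist_twist)
    have um: "?u * ?\<mu> i = ?\<mu> (Suc i) * ?u" "?u * ?\<mu> (Suc i) = ?\<mu> (Suc (Suc i)) * ?u"
      by (rule B.\<mu>_shift; use i in simp)+
    have uv: "?u * ?v = 1"
    proof -
      have "?u * ?v = ?f i * (?f (Suc i) * ?g (Suc i)) * ?g i" unfolding uf by (simp only: mult.assoc)
      then show ?thesis using B.fg(1)[of i] B.fg(1)[of "Suc i"] i by simp
    qed
    have "?u * (?r i * ?\<mu> i * ?\<mu> (Suc i)) = ?r (Suc i) * (?u * ?\<mu> i) * ?\<mu> (Suc i)"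
      unfolding mult.assoc[symmetric] u ..
    also have "\<dots> = ?r (Suc i) * ?\<mu> (Suc i) * (?u * ?\<mu> (Suc i))" unfolding um(1) by (simp only: mult.assoc)
    also have "\<dots> = ?r (Suc i) * ?\<mu> (Suc i) * ?\<mu> (Suc (Suc i)) * ?u" unfolding um(2) by (simp only: mult.assoc)
    finally have 1: "?u * (?r i * ?\<mu> i * ?\<mu> (Suc i)) = ?r (Suc i) * ?\<mu> (Suc i) * ?\<mu> (Suc (Suc i)) * ?u" .
    have "?u * (?\<mu> i * ?\<mu> (Suc i) * ?r'' i) = ?\<mu> (Suc i) * (?u * ?\<mu> (Suc i)) * ?r'' i"
      unfolding mult.assoc[symmetric] um(1) ..
    also have "\<dots> = ?\<mu> (Suc i) * ?\<mu> (Suc (Suc i)) * (?u * ?r'' i)" unfolding um(2) by (simp only: mult.assoc)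
    also have "\<dots> = ?\<mu> (Suc i) * ?\<mu> (Suc (Suc i)) * ?r'' (Suc i) * ?u" unfolding u2 by (simp only: mult.assoc)
    finally have 2: "?u * (?\<mu> i * ?\<mu> (Suc i) * ?r'' i) = ?\<mu> (Suc i) * ?\<mu> (Suc (Suc i)) * ?r'' (Suc i) * ?u" .
    have "?u * ?rel i * ?v = ?rel (Suc i) * (?u * ?v)"
      unfolding right_diff_distrib 1 2 left_diff_distrib by (simp only: mult.assoc)
    then have eq: "?rel (Suc i) = ?u * ?rel i * ?v" unfolding uv by simp
    have fr: "in_free ?N (opr n k i 2 (lift_op X))" if "X \<in> carrier_mat (n ^ 2) (n ^ 2)" "1 \<le> i" "i < k" for X :: "'k mat" and i
      unfolding in_free_def opr_def using free_mat_act[OF free_mat_lift[OF that(1)], of i k] that by auto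
    show ?thesis
      unfolding eq uf using Suc.IH i by (intro in_ideal_mult in_free_mult fr) auto
  qed
qed simp

text \<open>R_i commutes with the factors before M_i, becomes its double twist on crossing M_i
  M_{i+1}, and in this form commutes with the later factors, where the compatibility of the double
  twist is used.\<close>

lemma relation_M_prod:
  assumes "1 \<le> i" "i < k"
  shows "ideal_mat (n ^ k) (lift_op (act n k i 2 R) * M_prod k - M_prod k * lift_op (act n k i 2 R''))"
proof -
  let ?N = "n ^ k"
  let ?f = "\<lambda>i. opr n k i 2 (lift_op F)" and ?g = "\<lambda>i. opr n k i 2 (lift_op Fi)"
  let ?r = "\<lambda>i. opr n k i 2 (lift_op R)" and ?r'' = "\<lambda>i. opr n k i 2 (lift_op R'')"
  let ?\<mu> = "\<lambda>i. embed ?N (M_bar n F k i)"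
  have N: "?N > 0" using n_pos by simp
  interpret B: braided_chain ?f ?g ?\<mu> k by (rule braided_chain_M[OF n_pos])
  interpret Rc: twist_chain ?f ?g ?r ?\<mu> k by (rule twist_chain_M[OF n_pos compat R_carrier])
  interpret R2: twist_chain ?f ?g "\<lambda>i. ?f i * (?f i * ?r i * ?g i) * ?g i" ?\<mu> k
    by (rule B.twist_chain_twist) (rule Rc.twist_chain_axioms)
  let ?P = "chain_prod ?\<mu> 1 (i - 1)" and ?S = "chain_prod ?\<mu> (Suc (Suc i)) k"
  have MM: "embed ?N (M_prod k) = chain_prod ?\<mu> 1 k"
    by (rule embed_op_prod[OF M_bar_carrier N])
  also have "\<dots> = ?P * chain_prod ?\<mu> i k" using chain_prod_split[of 1 "i - 1" k ?\<mu>] assms by simp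
  also have "chain_prod ?\<mu> i k = ?\<mu> i * chain_prod ?\<mu> (Suc i) k"
    using chain_prod_split[of i i k ?\<mu>] assms by (simp add: chain_prod_single)
  also have "chain_prod ?\<mu> (Suc i) k = ?\<mu> (Suc i) * ?S"
    using chain_prod_split[of "Suc i" "Suc i" k ?\<mu>] assms by (simp add: chain_prod_single)
  finally have M: "embed ?N (M_prod k) = ?P * (?\<mu> i * (?\<mu> (Suc i) * ?S))" .
  have P: "?r i * ?P = ?P * ?r i"
    using assms by (intro chain_prod_commute Rc.r_\<mu>_above) auto
  have S: "?r'' i * ?S = ?S * ?r'' i"
  proof (intro chain_prod_commute)
    fix j assume "Suc (Suc i) \<le> j" "j \<le> k"
    then show "?r'' i * ?\<mu> j = ?\<mu> j * ?r'' i"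
      using R2.r_\<mu>_below[of i j] assms by (simp add: lift_opr_twist_twist)
  qed
  have "?r i * embed ?N (M_prod k) - embed ?N (M_prod k) * ?r'' i
    = (?r i * ?P) * (?\<mu> i * (?\<mu> (Suc i) * ?S)) - ?P * (?\<mu> i * (?\<mu> (Suc i) * (?S * ?r'' i)))"
    unfolding M by (simp only: mult.assoc)
  also have "\<dots> = ?P * (?r i * ?\<mu> i * ?\<mu> (Suc i) - ?\<mu> i * ?\<mu> (Suc i) * ?r'' i) * ?S"
    unfolding P S[symmetric] right_diff_distrib left_diff_distrib by (simp only: mult.assoc)
  finally have eq: "?r i * embed ?N (M_prod k) - embed ?N (M_prod k) * ?r'' i
    = ?P * (?r i * ?\<mu> i * ?\<mu> (Suc i) - ?\<mu> i * ?\<mu> (Suc i) * ?r'' i) * ?S" .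
  have fr: "in_free ?N (?\<mu> j)" if "1 \<le> j" "j \<le> k" for j
    unfolding in_free_def using free_mat_M_bar[OF that] by blast
  have "in_ideal ?N (?r i * embed ?N (M_prod k) - embed ?N (M_prod k) * ?r'' i)"
    unfolding eq using assms by (intro in_ideal_mult in_free_chain N fr relation_shifted) auto
  then obtain X where X: "ideal_mat ?N X" "?r i * embed ?N (M_prod k) - embed ?N (M_prod k) * ?r'' i = embed ?N X"
    unfolding in_ideal_def by blast
  have b: "1 \<le> i" "i + 2 \<le> Suc k" using assms by auto
  have c: "lift_op (act n k i 2 R) \<in> carrier_mat ?N ?N" "lift_op (act n k i 2 R'') \<in> carrier_mat ?N ?N" "M_prod k \<in> carrier_mat ?N ?N"
    by (rule lift_carrier[OF act_carrier[OF R_carrier b]] lift_carrier[OF act_carrier[OF R''_carrier b]] M_prod_carrier; simp)+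
  note d = minus_carrier_mat[OF mult_carrier_mat[OF c(3,2)], of "lift_op (act n k i 2 R) * M_prod k"]
  have "embed ?N (lift_op (act n k i 2 R) * M_prod k - M_prod k * lift_op (act n k i 2 R'')) = embed ?N X"
    unfolding X(2)[symmetric] embed_diff[OF mult_carrier_mat[OF c(1,3)] mult_carrier_mat[OF c(3,2)]]
      embed_mult[OF c(1,3)] embed_mult[OF c(3,2)] opr_def lift_act[symmetric] ..
  then have "lift_op (act n k i 2 R) * M_prod k - M_prod k * lift_op (act n k i 2 R'') = X"
    using iffD1[OF embed_eq_iff[OF d]] X(1) unfolding ideal_mat_def by blast
  then show ?thesis using X(1) by simp
qed

text \<open>Only D_i D_{i+1} is affected, by \<open>DD_intertwine\<close>; the other D's act in
  different copies. The bound 2 <= i ensures that D_i occurs in the product.\<close>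

lemma Dprod_intertwine:
  assumes "2 \<le> i" "i < k"
  shows "Dprod k 2 * act n k i 2 R = act n k i 2 R'' * Dprod k 2"
proof -
  let ?N = "n ^ k" and ?d = "\<lambda>a. opr n k a 1 D" and ?r = "opr n k i 2 R" and ?s = "opr n k i 2 R''"
  have N: "?N > 0" using n_pos by simp
  have D1: "D \<in> carrier_mat (n ^ 1) (n ^ 1)" using D_carrier by simp
  have b: "1 \<le> i" "i + 2 \<le> Suc k" using assms by auto
  have d: "Dprod k 2 \<in> carrier_mat ?N ?N" by (rule Dprod_carrier) simp
  have ed: "embed ?N (Dprod k 2) = chain_prod ?d 2 k"
    unfolding Dprod_def opr_def by (rule embed_op_prod[OF D_act_carrier N]) auto
  let ?P = "chain_prod ?d 2 (i - 1)" and ?S = "chain_prod ?d (Suc (Suc i)) k"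
  have "chain_prod ?d 2 k = ?P * chain_prod ?d i k" using chain_prod_split[of 2 "i - 1" k ?d] assms by simp
  also have "chain_prod ?d i k = ?d i * chain_prod ?d (Suc i) k"
    using chain_prod_split[of i i k ?d] assms by (simp add: chain_prod_single)
  also have "chain_prod ?d (Suc i) k = ?d (Suc i) * ?S"
    using chain_prod_split[of "Suc i" "Suc i" k ?d] assms by (simp add: chain_prod_single)
  finally have split: "chain_prod ?d 2 k = ?P * (?d i * (?d (Suc i) * ?S))" .
  have P: "?s * ?P = ?P * ?s"
    by (intro chain_prod_commute opr_commute[symmetric, OF D1 R''_carrier]) (use assms in auto)
  have S: "?r * ?S = ?S * ?r"
    by (intro chain_prod_commute opr_commute[OF R_carrier D1]) (use assms in auto)
  have dd: "?d i * ?d (Suc i) = opr n k i 2 DD"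
  proof -
    have c: "act n 2 1 1 D \<in> carrier_mat (n ^ 2) (n ^ 2)" "act n 2 2 1 D \<in> carrier_mat (n ^ 2) (n ^ 2)"
      by (rule D_act_carrier; simp)+
    show ?thesis
      unfolding DD_def opr_mult[OF c b] using opr_opr[OF D1, of 1 2 i k] opr_opr[OF D1, of 2 2 i k] b by simp
  qed
  have "opr n k i 2 DD * ?r = ?s * opr n k i 2 DD"
    unfolding opr_mult[OF DD_carrier R_carrier b, symmetric] opr_mult[OF R''_carrier DD_carrier b, symmetric]
      DD_intertwine[OF compat R_carrier] ..
  then have X: "?d i * ?d (Suc i) * ?r = ?s * (?d i * ?d (Suc i))" unfolding dd .
  have "chain_prod ?d 2 k * ?r = ?P * (?d i * ?d (Suc i) * ?r) * ?S"
    unfolding split by (simp only: mult.assoc S[symmetric])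
  also have "\<dots> = (?P * ?s) * (?d i * (?d (Suc i) * ?S))" unfolding X by (simp only: mult.assoc)
  also have "\<dots> = ?s * chain_prod ?d 2 k" unfolding P[symmetric] split by (simp only: mult.assoc)
  finally have "embed ?N (Dprod k 2 * act n k i 2 R) = embed ?N (act n k i 2 R'' * Dprod k 2)"
    unfolding embed_mult[OF d act_carrier[OF R_carrier b]] embed_mult[OF act_carrier[OF R''_carrier b] d] ed
    by (simp only: opr_def)
  then show ?thesis
    by (rule iffD1[OF embed_eq_iff[OF mult_carrier_mat[OF d act_carrier[OF R_carrier b]]
        mult_carrier_mat[OF act_carrier[OF R''_carrier b] d]]])
qed

section \<open>The functional on numerical operators and its cyclicity\<close>

definition \<Phi> :: "nat \<Rightarrow> 'k mat \<Rightarrow> 'k free_alg mat" where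
  "\<Phi> k Y = qtrace_from2 n F k (lift_op Y * M_prod k)"

lemma \<Phi>_eq: "\<Phi> k Y = ptrace2 n (n ^ (k - 1)) (lift_op (Dprod k 2) * (lift_op Y * M_prod k))"
  by (simp add: \<Phi>_def qtrace_from2_def Dprod_def)

lemma \<Phi>_carrier [simp]: "\<Phi> k Y \<in> carrier_mat n n"
  by (simp add: \<Phi>_eq)

lemma M_prod_carrier1: "M_prod k \<in> carrier_mat (n ^ k) (n ^ k)"
  by (rule M_prod_carrier) auto

lemma Dprod_carrier2: "Dprod k 2 \<in> carrier_mat (n ^ k) (n ^ k)"
  by (rule Dprod_carrier) auto

lemma \<Phi>_eq':
  assumes "Y \<in> carrier_mat (n ^ k) (n ^ k)"
  shows "\<Phi> k Y = ptrace2 n (n ^ (k - 1)) (lift_op (Dprod k 2 * Y) * M_prod k)"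
  unfolding \<Phi>_eq lift_mult[OF Dprod_carrier2 assms]
    assoc_mult_mat[OF lift_carrier[OF Dprod_carrier2] lift_carrier[OF assms] M_prod_carrier1] ..

text \<open>Moving R_i through the D's and cycling its double twist is exact. The two values thus
  differ by the trace of D Y (R_i M_1 ... M_k - M_1 ... M_k R''_i), whose entries are sums of scalar
  multiples of elements of the ideal.\<close>

lemma \<Phi>_cyclic:
  assumes Y: "Y \<in> carrier_mat (n ^ k) (n ^ k)" and i: "2 \<le> i" "i < k"
  shows "ideal_mat n (\<Phi> k (Y * act n k i 2 R) - \<Phi> k (act n k i 2 R * Y))"
proof -
  let ?N = "n ^ k" and ?r = "act n k i 2 R" and ?s = "act n k i 2 R''" and ?T = "ptrace2 n (n ^ (k - 1))"
  have N: "?N = n * n ^ (k - 1)" using i by (cases k) auto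
  then have NN: "W \<in> carrier_mat ?N ?N \<Longrightarrow> W \<in> carrier_mat (n * n ^ (k - 1)) (n * n ^ (k - 1))" for W :: "'k free_alg mat"
    by (simp only:)
  have b: "1 \<le> i" "i + 2 \<le> Suc k" using i by auto
  note r = act_carrier[OF R_carrier b] and s = act_carrier[OF R''_carrier b]
  note D = Dprod_carrier2[of k] and M = M_prod_carrier1[of k]
  note DY = mult_carrier_mat[OF D Y]
  note LDY = lift_carrier[OF DY] and Lr = lift_carrier[OF r] and Ls = lift_carrier[OF s]
  define s' where "s' = act n (k - 1) (i - 1) 2 R''"
  have s': "s' \<in> carrier_mat (n ^ (k - 1)) (n ^ (k - 1))"
    unfolding s'_def by (rule act_carrier[OF R''_carrier]) (use i in auto)
  have ss': "lift_op ?s = kron (1\<^sub>m n) (lift_op s')"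
  proof -
    have "?s = kron (1\<^sub>m n) s'"
      using kron_act_left[OF R''_carrier, of "i - 1" "k - 1" 1] i by (simp add: s'_def)
    then show ?thesis by (simp add: lift_kron lift_one)
  qed
  have YR: "\<Phi> k (Y * ?r) = ?T (lift_op (Dprod k 2 * Y) * (lift_op ?r * M_prod k))"
    unfolding \<Phi>_eq'[OF mult_carrier_mat[OF Y r]] assoc_mult_mat[OF D Y r, symmetric] lift_mult[OF DY r]
      assoc_mult_mat[OF LDY Lr M] ..
  have "\<Phi> k (?r * Y) = ?T (lift_op (?s * (Dprod k 2 * Y)) * M_prod k)"
    unfolding \<Phi>_eq'[OF mult_carrier_mat[OF r Y]] assoc_mult_mat[OF D r Y, symmetric] Dprod_intertwine[OF i]
      assoc_mult_mat[OF s D Y] ..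
  also have "\<dots> = ?T (lift_op ?s * (lift_op (Dprod k 2 * Y) * M_prod k))"
    unfolding lift_mult[OF s DY] assoc_mult_mat[OF Ls LDY M] ..
  \<comment> \<open>As i is at least 2, the double twist acts in traced copies only; being
    numerical, it can be cycled past the M's.\<close>
  also have "\<dots> = ?T (lift_op (Dprod k 2 * Y) * M_prod k * lift_op ?s)"
    unfolding ss' by (rule ptrace2_cyclic[OF lift_carrier[OF s'] NN[OF mult_carrier_mat[OF LDY M]] central_mat_lift])
  also have "\<dots> = ?T (lift_op (Dprod k 2 * Y) * (M_prod k * lift_op ?s))"
    unfolding assoc_mult_mat[OF LDY M Ls] ..
  finally have RY: "\<Phi> k (?r * Y) = ?T (lift_op (Dprod k 2 * Y) * (M_prod k * lift_op ?s))" .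
  have "\<Phi> k (Y * ?r) - \<Phi> k (?r * Y)
      = ?T (lift_op (Dprod k 2 * Y) * (lift_op ?r * M_prod k) - lift_op (Dprod k 2 * Y) * (M_prod k * lift_op ?s))"
    unfolding YR RY
    by (rule ptrace2_diff[symmetric, OF NN[OF mult_carrier_mat[OF LDY mult_carrier_mat[OF Lr M]]]
        NN[OF mult_carrier_mat[OF LDY mult_carrier_mat[OF M Ls]]]])
  also have "\<dots> = ?T (lift_op (Dprod k 2 * Y) * (lift_op ?r * M_prod k - M_prod k * lift_op ?s))"
    unfolding mult_minus_distrib_mat[OF LDY mult_carrier_mat[OF Lr M] mult_carrier_mat[OF M Ls]] ..
  also have "ideal_mat n \<dots>"
    by (rule ideal_mat_ptrace2, unfold N[symmetric], rule ideal_mat_mult(1)[OF free_mat_lift[OF DY] relation_M_prod])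
      (use i in auto)
  finally show ?thesis .
qed

lemma smult_mult_left:
  fixes A B :: "'x::semiring_1 mat"
  assumes A: "A \<in> carrier_mat d d" and B: "B \<in> carrier_mat d d"
  shows "(c \<cdot>\<^sub>m A) * B = c \<cdot>\<^sub>m (A * B)"
  by (rule eq_matI) (use assms in \<open>auto simp: index_mult_sum[OF A B] index_mult_sum[OF smult_carrier_mat[OF A] B]
      sum_distrib_left mult.assoc simp del: index_mult_mat(1)\<close>)

lemma lift_smult: "lift_op (c \<cdot>\<^sub>m X) = scal c \<cdot>\<^sub>m lift_op X"
  by (rule eq_matI) (auto simp: ring_hom_scal)

lemma \<Phi>_smult:
  assumes Y: "Y \<in> carrier_mat (n ^ k) (n ^ k)" and k: "k > 0"
  shows "\<Phi> k (c \<cdot>\<^sub>m Y) = scal c \<cdot>\<^sub>m \<Phi> k Y"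
proof -
  have N: "n ^ k = n * n ^ (k - 1)" using k by (cases k) auto
  then have NN: "W \<in> carrier_mat (n ^ k) (n ^ k) \<Longrightarrow> W \<in> carrier_mat (n * n ^ (k - 1)) (n * n ^ (k - 1))" for W :: "'k free_alg mat"
    by (simp only:)
  note DY = mult_carrier_mat[OF Dprod_carrier2 Y]
  note Z = NN[OF mult_carrier_mat[OF lift_carrier[OF DY] M_prod_carrier1]]
  have "lift_op (Dprod k 2 * (c \<cdot>\<^sub>m Y)) * M_prod k = scal c \<cdot>\<^sub>m (lift_op (Dprod k 2 * Y) * M_prod k)"
    unfolding mult_smult_distrib[OF Dprod_carrier2 Y] lift_smult
    by (rule smult_mult_left[OF lift_carrier[OF DY] M_prod_carrier1])
  then show ?thesis
    unfolding \<Phi>_eq'[OF smult_carrier_mat[OF Y]] \<Phi>_eq'[OF Y] using ptrace2_smult[OF Z] by simp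
qed

lemma \<Phi>_diff:
  assumes X: "X \<in> carrier_mat (n ^ k) (n ^ k)" and Y: "Y \<in> carrier_mat (n ^ k) (n ^ k)" and k: "k > 0"
  shows "\<Phi> k (X - Y) = \<Phi> k X - \<Phi> k Y"
proof -
  have N: "n ^ k = n * n ^ (k - 1)" using k by (cases k) auto
  then have NN: "W \<in> carrier_mat (n ^ k) (n ^ k) \<Longrightarrow> W \<in> carrier_mat (n * n ^ (k - 1)) (n * n ^ (k - 1))" for W :: "'k free_alg mat"
    by (simp only:)
  note DX = mult_carrier_mat[OF Dprod_carrier2 X] and DY = mult_carrier_mat[OF Dprod_carrier2 Y]
  note Z = NN[OF mult_carrier_mat[OF lift_carrier[OF DX] M_prod_carrier1]]
    NN[OF mult_carrier_mat[OF lift_carrier[OF DY] M_prod_carrier1]]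
  have scd: "scal (a - b) = scal a - scal b" for a b :: 'k
    using ring_hom_scal(3)[of "a - b" b] by (simp add: algebra_simps)
  have "lift_op (Dprod k 2 * X - Dprod k 2 * Y) = lift_op (Dprod k 2 * X) - lift_op (Dprod k 2 * Y)"
    by (rule eq_matI) (use DX DY carrier_matD[OF DX] carrier_matD[OF DY] in \<open>simp_all add: scd del: index_mult_mat\<close>)
  then have "lift_op (Dprod k 2 * (X - Y)) * M_prod k
      = lift_op (Dprod k 2 * X) * M_prod k - lift_op (Dprod k 2 * Y) * M_prod k"
    unfolding mult_minus_distrib_mat[OF Dprod_carrier2 X Y]
    using minus_mult_distrib_mat[OF lift_carrier[OF DX] lift_carrier[OF DY] M_prod_carrier1] by simp
  then show ?thesis
    unfolding \<Phi>_eq'[OF minus_carrier_mat[OF Y]] \<Phi>_eq'[OF X] \<Phi>_eq'[OF Y] using ptrace2_diff[OF Z] by simp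
qed

end

section \<open>The recursion and its solution\<close>

lemma qm_class_eqI:
  assumes "ideal (qm_ideal n R F) (free_algebra n)" "x \<in> carrier (free_algebra n)" "y \<in> carrier (free_algebra n)"
    and "x - y \<in> qm_ideal n R F"
  shows "qm_class n R F x = qm_class n R F y"
proof -
  interpret ring "free_algebra n :: 'a free_alg ring" by (rule ring_free_algebra)
  have "\<ominus>\<^bsub>free_algebra n\<^esub> y = - y"
    by (rule minus_equality) (simp_all add: free_algebra_ops free_carrier_simps assms(3))
  then have "x \<ominus>\<^bsub>free_algebra n\<^esub> y = x - y"
    by (simp add: a_minus_def free_algebra_ops)
  then show ?thesis
    unfolding qm_class_def using quotient_eq_iff_same_a_r_cos[OF assms(1-3)] assms(4) by simp
qed

context quantum_matrix
begin

text \<open>Quantifying over all Y makes the property pass to products, so it extends from single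
  generators to antisymmetrizers.\<close>

definition cyclic_mod :: "nat \<Rightarrow> 'k mat \<Rightarrow> bool" where
  "cyclic_mod k X \<longleftrightarrow> X \<in> carrier_mat (n ^ k) (n ^ k) \<and>
    (\<forall>Y \<in> carrier_mat (n ^ k) (n ^ k). ideal_mat n (\<Phi> k (Y * X) - \<Phi> k (X * Y)))"

lemma ideal_mat_smult: "ideal_mat d X \<Longrightarrow> ideal_mat d (scal c \<cdot>\<^sub>m X)"
  by (auto simp: ideal_mat_def I_left scal_carrier)

lemma ideal_mat_trans:
  assumes "ideal_mat d (A - B)" "ideal_mat d (B - C)"
    and "A \<in> carrier_mat d d" "B \<in> carrier_mat d d" "C \<in> carrier_mat d d"
  shows "ideal_mat d (A - C)"
proof -
  have "A - C = (A - B) + (B - C)" using assms by (intro eq_matI) auto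
  then show ?thesis using ideal_mat_add[OF assms(1,2)] by simp
qed

text \<open>Two rotations: Y X Z goes to Z Y X and then to X Z Y.\<close>

lemma cyclic_mod_mult:
  assumes "cyclic_mod k X" "cyclic_mod k Z"
  shows "cyclic_mod k (X * Z)"
  unfolding cyclic_mod_def
proof (intro conjI ballI)
  have X: "X \<in> carrier_mat (n ^ k) (n ^ k)" and Z: "Z \<in> carrier_mat (n ^ k) (n ^ k)"
    using assms by (auto simp: cyclic_mod_def)
  show "X * Z \<in> carrier_mat (n ^ k) (n ^ k)" by (rule mult_carrier_mat[OF X Z])
  fix Y :: "'k mat" assume Y: "Y \<in> carrier_mat (n ^ k) (n ^ k)"
  have 1: "ideal_mat n (\<Phi> k (Y * X * Z) - \<Phi> k (Z * (Y * X)))"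
    using assms(2) mult_carrier_mat[OF Y X] unfolding cyclic_mod_def by blast
  have 2: "ideal_mat n (\<Phi> k (Z * Y * X) - \<Phi> k (X * (Z * Y)))"
    using assms(1) mult_carrier_mat[OF Z Y] unfolding cyclic_mod_def by blast
  show "ideal_mat n (\<Phi> k (Y * (X * Z)) - \<Phi> k (X * Z * Y))"
    unfolding assoc_mult_mat[OF X Z Y] assoc_mult_mat[OF Y X Z, symmetric]
    by (rule ideal_mat_trans[OF 1 2[unfolded assoc_mult_mat[OF Z Y X]]]) simp_all
qed

lemma cyclic_mod_smult:
  assumes "cyclic_mod k X" and k: "k > 0"
  shows "cyclic_mod k (c \<cdot>\<^sub>m X)"
  unfolding cyclic_mod_def
proof (intro conjI ballI)
  have X: "X \<in> carrier_mat (n ^ k) (n ^ k)" using assms by (auto simp: cyclic_mod_def)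
  show "c \<cdot>\<^sub>m X \<in> carrier_mat (n ^ k) (n ^ k)" by (rule smult_carrier_mat[OF X])
  fix Y :: "'k mat" assume Y: "Y \<in> carrier_mat (n ^ k) (n ^ k)"
  have "ideal_mat n (scal c \<cdot>\<^sub>m (\<Phi> k (Y * X) - \<Phi> k (X * Y)))"
    by (rule ideal_mat_smult) (use assms(1) Y in \<open>auto simp: cyclic_mod_def\<close>)
  also have "scal c \<cdot>\<^sub>m (\<Phi> k (Y * X) - \<Phi> k (X * Y)) = scal c \<cdot>\<^sub>m \<Phi> k (Y * X) - scal c \<cdot>\<^sub>m \<Phi> k (X * Y)"
    using \<Phi>_carrier[of k "Y * X"] \<Phi>_carrier[of k "X * Y"]
    by (intro eq_matI) (auto simp: right_diff_distrib carrier_matD[OF \<Phi>_carrier])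
  finally show "ideal_mat n (\<Phi> k (Y * (c \<cdot>\<^sub>m X)) - \<Phi> k (c \<cdot>\<^sub>m X * Y))"
    unfolding mult_smult_distrib[OF Y X] smult_mult_left[OF X Y]
      \<Phi>_smult[OF mult_carrier_mat[OF Y X] k] \<Phi>_smult[OF mult_carrier_mat[OF X Y] k] .
qed

lemma cyclic_mod_diff:
  assumes "cyclic_mod k X" "cyclic_mod k Z" and k: "k > 0"
  shows "cyclic_mod k (X - Z)"
  unfolding cyclic_mod_def
proof (intro conjI ballI)
  have X: "X \<in> carrier_mat (n ^ k) (n ^ k)" and Z: "Z \<in> carrier_mat (n ^ k) (n ^ k)"
    using assms by (auto simp: cyclic_mod_def)
  show "X - Z \<in> carrier_mat (n ^ k) (n ^ k)" by (rule minus_carrier_mat[OF Z])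
  fix Y :: "'k mat" assume Y: "Y \<in> carrier_mat (n ^ k) (n ^ k)"
  have 1: "ideal_mat n (\<Phi> k (Y * X) - \<Phi> k (X * Y))" and 2: "ideal_mat n (\<Phi> k (Y * Z) - \<Phi> k (Z * Y))"
    using assms Y unfolding cyclic_mod_def by blast+
  have "ideal_mat n ((\<Phi> k (Y * X) - \<Phi> k (X * Y)) + scal (- 1) \<cdot>\<^sub>m (\<Phi> k (Y * Z) - \<Phi> k (Z * Y)))"
    by (rule ideal_mat_add[OF 1 ideal_mat_smult[OF 2]])
  also have "(\<Phi> k (Y * X) - \<Phi> k (X * Y)) + scal (- 1) \<cdot>\<^sub>m (\<Phi> k (Y * Z) - \<Phi> k (Z * Y))
      = (\<Phi> k (Y * X) - \<Phi> k (Y * Z)) - (\<Phi> k (X * Y) - \<Phi> k (Z * Y))"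
  proof -
    have "scal (- 1) = (- 1 :: 'k free_alg)"
      using ring_hom_scal(3)[of "- 1" "1 :: 'k"] by (simp add: ring_hom_scal eq_neg_iff_add_eq_0)
    then show ?thesis by (intro eq_matI) (auto simp: carrier_matD[OF \<Phi>_carrier] algebra_simps)
  qed
  finally show "ideal_mat n (\<Phi> k (Y * (X - Z)) - \<Phi> k ((X - Z) * Y))"
    unfolding mult_minus_distrib_mat[OF Y X Z] minus_mult_distrib_mat[OF X Z Y]
      \<Phi>_diff[OF mult_carrier_mat[OF Y X] mult_carrier_mat[OF Y Z] k]
      \<Phi>_diff[OF mult_carrier_mat[OF X Y] mult_carrier_mat[OF Z Y] k] .
qed

lemma cyclic_mod_one: "cyclic_mod k (1\<^sub>m (n ^ k))"
proof -
  have "ideal_mat n (\<Phi> k Y - \<Phi> k Y)" for Y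
    by (auto simp: ideal_mat_def I_zero carrier_matD[OF \<Phi>_carrier])
  then show ?thesis unfolding cyclic_mod_def by auto
qed

lemma cyclic_mod_R: "2 \<le> i \<Longrightarrow> i < k \<Longrightarrow> cyclic_mod k (act n k i 2 R)"
  unfolding cyclic_mod_def using \<Phi>_cyclic act_carrier[OF R_carrier, of i k] by auto

section \<open>Antisymmetrizers of blocks of copies and the recursion\<close>

abbreviation "antisymm_at k p j \<equiv> act n k (Suc p) j (antisymm j)"

lemma antisymm_at_carrier: "p + j \<le> k \<Longrightarrow> antisymm_at k p j \<in> carrier_mat (n ^ k) (n ^ k)"
  by (rule act_carrier[OF antisymm_carrier]) auto

lemma embed_antisymm_at:
  "p + j \<le> k \<Longrightarrow> embed (n ^ k) (antisymm_at k p j) = H.asym q (\<lambda>l. opr n k (l + p) 2 R) j"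
  using opr_antisymm[of p j k] unfolding opr_def[of n k "Suc p" j] .

lemma n_pow_pos: "n ^ k > 0"
  using n_pos by simp

lemma antisymm_at_0: "p \<le> k \<Longrightarrow> antisymm_at k p 0 = 1\<^sub>m (n ^ k)"
  using act_one[of "Suc p" 0 k n, where ?'a = 'k] by simp

lemma antisymm_at_1: "p < k \<Longrightarrow> antisymm_at k p 1 = 1\<^sub>m (n ^ k)"
  using act_one[of "Suc p" 1 k n, where ?'a = 'k] by simp

abbreviation "factor k j i \<equiv> q ^ j \<cdot>\<^sub>m 1\<^sub>m (n ^ k) - qnum q j \<cdot>\<^sub>m act n k i 2 R"

lemma factor_carrier: "1 \<le> i \<Longrightarrow> i < k \<Longrightarrow> factor k j i \<in> carrier_mat (n ^ k) (n ^ k)"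
  by (intro minus_carrier_mat smult_carrier_mat act_carrier[OF R_carrier]) auto

lemma embed_factor:
  assumes "1 \<le> i" "i < k"
  shows "embed (n ^ k) (factor k j i) = endo_scale (q ^ j) 1 - endo_scale (qnum q j) (opr n k i 2 R)"
proof -
  have R: "act n k i 2 R \<in> carrier_mat (n ^ k) (n ^ k)" by (rule act_carrier[OF R_carrier]) (use assms in auto)
  show ?thesis
    unfolding embed_diff[OF smult_carrier_mat[OF one_carrier_mat] smult_carrier_mat[OF R]]
      embed_smult[OF one_carrier_mat] embed_smult[OF R] embed_one[OF n_pow_pos] opr_def ..
qed

text \<open>The first form extends the block to the right, as in the definition, and passes
  cyclicity on along the induction. The second extends it to the left, which brings in R_{p+1}, the
  next factor of the product R_1 ... R_p.\<close>

lemma antisymm_at_Suc: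
  assumes "1 \<le> j" "p + Suc j \<le> k"
  shows "antisymm_at k p (Suc j) = (1 / qnum q (Suc j)) \<cdot>\<^sub>m (antisymm_at k p j * factor k j (j + p) * antisymm_at k p j)"
    "qnum q (Suc j) \<cdot>\<^sub>m antisymm_at k p (Suc j) = antisymm_at k (Suc p) j * factor k j (Suc p) * antisymm_at k (Suc p) j"
proof -
  have A: "antisymm_at k p j \<in> carrier_mat (n ^ k) (n ^ k)" "antisymm_at k (Suc p) j \<in> carrier_mat (n ^ k) (n ^ k)"
    "antisymm_at k p (Suc j) \<in> carrier_mat (n ^ k) (n ^ k)"
    using assms by (auto intro: antisymm_at_carrier)
  have B: "factor k j (j + p) \<in> carrier_mat (n ^ k) (n ^ k)" "factor k j (Suc p) \<in> carrier_mat (n ^ k) (n ^ k)"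
    by (rule factor_carrier; use assms in simp)+
  note AB1 = mult_carrier_mat[OF A(1) B(1)] and AB2 = mult_carrier_mat[OF A(2) B(2)]
  have "embed (n ^ k) (antisymm_at k p (Suc j))
      = embed (n ^ k) ((1 / qnum q (Suc j)) \<cdot>\<^sub>m (antisymm_at k p j * factor k j (j + p) * antisymm_at k p j))"
    unfolding embed_smult[OF mult_carrier_mat[OF AB1 A(1)]] embed_mult[OF AB1 A(1)] embed_mult[OF A(1) B(1)]
    using assms by (simp add: embed_antisymm_at embed_factor)
  then show "antisymm_at k p (Suc j) = (1 / qnum q (Suc j)) \<cdot>\<^sub>m (antisymm_at k p j * factor k j (j + p) * antisymm_at k p j)"
    by (rule iffD1[OF embed_eq_iff[OF A(3) smult_carrier_mat[OF mult_carrier_mat[OF AB1 A(1)]]]])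
  have "endo_scale (qnum q (Suc j)) (embed (n ^ k) (antisymm_at k p (Suc j)))
      = embed (n ^ k) (antisymm_at k (Suc p) j) * embed (n ^ k) (factor k j (Suc p)) * embed (n ^ k) (antisymm_at k (Suc p) j)"
    using H.asym_Suc_left[OF hecke_gens_R[OF assms(2)]] assms
      embed_antisymm_at[OF assms(2)] embed_antisymm_at[of "Suc p" j k] embed_factor[of "Suc p" k j]
    by (simp only: add_Suc_right add_Suc) simp
  then have "embed (n ^ k) (qnum q (Suc j) \<cdot>\<^sub>m antisymm_at k p (Suc j))
      = embed (n ^ k) (antisymm_at k (Suc p) j * factor k j (Suc p) * antisymm_at k (Suc p) j)"
    unfolding embed_smult[OF A(3)] embed_mult[OF AB2 A(2)] embed_mult[OF A(2) B(2)] .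
  then show "qnum q (Suc j) \<cdot>\<^sub>m antisymm_at k p (Suc j) = antisymm_at k (Suc p) j * factor k j (Suc p) * antisymm_at k (Suc p) j"
    by (rule iffD1[OF embed_eq_iff[OF smult_carrier_mat[OF A(3)] mult_carrier_mat[OF AB2 A(2)]]])
qed

text \<open>The block starts at copy p + 1 >= 2, so each generator in it acts in traced copies
  only.\<close>

lemma cyclic_mod_antisymm:
  assumes "1 \<le> p" "p + j \<le> k"
  shows "cyclic_mod k (antisymm_at k p j)"
  using assms(2)
proof (induction j)
  case 0
  then show ?case using cyclic_mod_one[of k] antisymm_at_0[of p k] by simp
next
  case (Suc j)
  show ?case
  proof (cases "j = 0")
    case True
    then show ?thesis using cyclic_mod_one[of k] antisymm_at_1[of p k] Suc.prems by simp
  next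
    case False
    then have j: "1 \<le> j" and k: "k > 0" using Suc.prems by auto
    show ?thesis
      unfolding antisymm_at_Suc(1)[OF j Suc.prems]
      by (intro cyclic_mod_smult cyclic_mod_mult cyclic_mod_diff cyclic_mod_one cyclic_mod_R k Suc.IH)
        (use assms(1) j Suc.prems in auto)
  qed
qed

lemma antisymm_at_idem:
  assumes "p + j \<le> k"
  shows "antisymm_at k p j * antisymm_at k p j = antisymm_at k p j"
proof -
  note A = antisymm_at_carrier[OF assms]
  have "embed (n ^ k) (antisymm_at k p j * antisymm_at k p j) = embed (n ^ k) (antisymm_at k p j)"
    unfolding embed_mult[OF A A] embed_antisymm_at[OF assms] by (rule H.asym_idem[OF hecke_gens_R[OF assms]])
  then show ?thesis by (rule iffD1[OF embed_eq_iff[OF mult_carrier_mat[OF A A] A]])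
qed

text \<open>The product acts in copies 1, ..., p + 1, and the block begins at copy p + 2.\<close>

lemma R_prod_antisymm_commute:
  assumes "k = Suc (p + j)"
  shows "R_prod k p * antisymm_at k (Suc p) j = antisymm_at k (Suc p) j * R_prod k p"
proof -
  let ?N = "n ^ k" and ?r = "\<lambda>i. opr n k i 2 R"
  have A: "antisymm_at k (Suc p) j \<in> carrier_mat ?N ?N" by (rule antisymm_at_carrier) (use assms in simp)
  have Rp: "R_prod k p \<in> carrier_mat ?N ?N" by (rule R_prod_carrier) (use assms in simp)
  have eR: "embed ?N (R_prod k p) = chain_prod ?r 1 p"
    unfolding opr_def by (rule embed_op_prod[OF act_carrier[OF R_carrier] n_pow_pos]) (use assms in auto)
  have "chain_prod ?r 1 p * H.asym q (\<lambda>l. ?r (l + Suc p)) j = H.asym q (\<lambda>l. ?r (l + Suc p)) j * chain_prod ?r 1 p"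
  proof (rule H.asym_intertwine)
    fix i assume "1 \<le> i" "i < j"
    then show "chain_prod ?r 1 p * ?r (i + Suc p) = ?r (i + Suc p) * chain_prod ?r 1 p"
      by (intro chain_prod_commute[symmetric] opr_commute[symmetric, OF R_carrier R_carrier]) (use assms in auto)
  qed
  then have "embed ?N (R_prod k p * antisymm_at k (Suc p) j) = embed ?N (antisymm_at k (Suc p) j * R_prod k p)"
    unfolding embed_mult[OF Rp A] embed_mult[OF A Rp] eR using embed_antisymm_at[of "Suc p" j k] assms by simp
  then show ?thesis by (rule iffD1[OF embed_eq_iff[OF mult_carrier_mat[OF Rp A] mult_carrier_mat[OF A Rp]]])
qed

text \<open>Of the two antisymmetrizers around q^j - j_q R_{p+1}, the left one commutes with R_1 ...
  R_p and so reaches the front; cyclicity takes it to the end, where the other absorbs it. The two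
  terms of the factor then give the two terms on the right.\<close>

lemma \<Phi>_recursion:
  assumes k: "k = Suc (p + j)"
  shows "ideal_mat n (scal (qnum q (Suc j)) \<cdot>\<^sub>m \<Phi> k (R_prod k p * antisymm_at k p (Suc j))
    - (scal (q ^ j) \<cdot>\<^sub>m \<Phi> k (R_prod k p * antisymm_at k (Suc p) j)
      - scal (qnum q j) \<cdot>\<^sub>m \<Phi> k (R_prod k (Suc p) * antisymm_at k (Suc p) j)))"
\<comment> \<open>For j = 0 the operator R_{p+1} = R_k would leave the k copies; its coefficient is
  0_q = 0, and the antisymmetrizers are trivial.\<close>
proof (cases "j = 0")
  case True
  have "antisymm_at k p (Suc j) = 1\<^sub>m (n ^ k)" "antisymm_at k (Suc p) j = 1\<^sub>m (n ^ k)"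
    unfolding True using antisymm_at_1[of p k] antisymm_at_0[of "Suc p" k] k by simp_all
  moreover have "qnum q j = 0" "qnum q (Suc j) = 1" using H.qnum_1 by (simp_all add: True qnum_def)
  ultimately show ?thesis
    by (auto simp: ideal_mat_def I_zero ring_hom_scal True carrier_matD[OF \<Phi>_carrier])
next
  case False
  then have j: "1 \<le> j" and pj: "p + Suc j \<le> k" "Suc p + j \<le> k" and k0: "k > 0" using k by auto
  let ?N = "n ^ k" and ?A = "antisymm_at k (Suc p) j" and ?A' = "antisymm_at k p (Suc j)"
  let ?Rp = "R_prod k p" and ?R = "act n k (Suc p) 2 R" and ?B = "factor k j (Suc p)"
  have A: "?A \<in> carrier_mat ?N ?N" and A': "?A' \<in> carrier_mat ?N ?N"
    by (rule antisymm_at_carrier; use pj in simp)+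
  have Rp: "?Rp \<in> carrier_mat ?N ?N" by (rule R_prod_carrier) (use k in simp)
  have R: "?R \<in> carrier_mat ?N ?N" by (rule act_carrier[OF R_carrier]) (use pj j in auto)
  have B: "?B \<in> carrier_mat ?N ?N" by (rule factor_carrier) (use pj j in auto)
  note RpA = mult_carrier_mat[OF Rp A] and BA = mult_carrier_mat[OF B A]
  note RBA = mult_carrier_mat[OF Rp BA]
  have "scal (qnum q (Suc j)) \<cdot>\<^sub>m \<Phi> k (?Rp * ?A') = \<Phi> k (?Rp * (qnum q (Suc j) \<cdot>\<^sub>m ?A'))"
    unfolding mult_smult_distrib[OF Rp A'] by (rule \<Phi>_smult[OF mult_carrier_mat[OF Rp A'] k0, symmetric])
  also have "?Rp * (qnum q (Suc j) \<cdot>\<^sub>m ?A') = ?Rp * ?A * (?B * ?A)"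
    unfolding antisymm_at_Suc(2)[OF j pj(1)] assoc_mult_mat[OF A B A] assoc_mult_mat[OF Rp A BA] ..
  also have "\<dots> = ?A * (?Rp * (?B * ?A))"
    unfolding R_prod_antisymm_commute[OF k] assoc_mult_mat[OF A Rp BA] ..
  finally have L: "scal (qnum q (Suc j)) \<cdot>\<^sub>m \<Phi> k (?Rp * ?A') = \<Phi> k (?A * (?Rp * (?B * ?A)))" .
  have RS_eq: "R_prod k (Suc p) = ?Rp * ?R"
    by (rule op_prod_Suc, rule act_carrier[OF R_carrier]) (use pj j in auto)
  have BA_eq: "?B * ?A = q ^ j \<cdot>\<^sub>m ?A - qnum q j \<cdot>\<^sub>m (?R * ?A)"
    unfolding minus_mult_distrib_mat[OF smult_carrier_mat[OF one_carrier_mat] smult_carrier_mat[OF R] A]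
      smult_mult_left[OF one_carrier_mat A] smult_mult_left[OF R A] left_mult_one_mat[OF A] ..
  have "?Rp * (?B * ?A) = q ^ j \<cdot>\<^sub>m (?Rp * ?A) - qnum q j \<cdot>\<^sub>m (R_prod k (Suc p) * ?A)"
    unfolding BA_eq RS_eq
      mult_minus_distrib_mat[OF Rp smult_carrier_mat[OF A] smult_carrier_mat[OF mult_carrier_mat[OF R A]]]
      mult_smult_distrib[OF Rp A] mult_smult_distrib[OF Rp mult_carrier_mat[OF R A]] assoc_mult_mat[OF Rp R A] ..
  moreover have "?Rp * (?B * ?A) * ?A = ?Rp * (?B * ?A)"
    unfolding assoc_mult_mat[OF Rp BA A] assoc_mult_mat[OF B A A] antisymm_at_idem[OF pj(2)] ..
  ultimately have e: "?Rp * (?B * ?A) * ?A = q ^ j \<cdot>\<^sub>m (?Rp * ?A) - qnum q j \<cdot>\<^sub>m (R_prod k (Suc p) * ?A)" by simp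
  have RS: "R_prod k (Suc p) \<in> carrier_mat ?N ?N" by (rule R_prod_carrier) (use pj j in auto)
  note RSA = mult_carrier_mat[OF RS A]
  have r: "\<Phi> k (?Rp * (?B * ?A) * ?A) = scal (q ^ j) \<cdot>\<^sub>m \<Phi> k (?Rp * ?A) - scal (qnum q j) \<cdot>\<^sub>m \<Phi> k (R_prod k (Suc p) * ?A)"
    unfolding e \<Phi>_diff[OF smult_carrier_mat[OF RpA] smult_carrier_mat[OF RSA] k0] \<Phi>_smult[OF RpA k0] \<Phi>_smult[OF RSA k0] ..
  have "ideal_mat n (\<Phi> k (?Rp * (?B * ?A) * ?A) - \<Phi> k (?A * (?Rp * (?B * ?A))))"
    using cyclic_mod_antisymm[of "Suc p" j k] pj RBA unfolding cyclic_mod_def by auto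
  then have "ideal_mat n (scal (- 1) \<cdot>\<^sub>m (\<Phi> k (?Rp * (?B * ?A) * ?A) - \<Phi> k (?A * (?Rp * (?B * ?A)))))"
    by (rule ideal_mat_smult)
  also have "scal (- 1) \<cdot>\<^sub>m (\<Phi> k (?Rp * (?B * ?A) * ?A) - \<Phi> k (?A * (?Rp * (?B * ?A))))
      = \<Phi> k (?A * (?Rp * (?B * ?A))) - \<Phi> k (?Rp * (?B * ?A) * ?A)"
  proof -
    have "scal (- 1) = (- 1 :: 'k free_alg)"
      using ring_hom_scal(3)[of "- 1" "1 :: 'k"] by (simp add: ring_hom_scal eq_neg_iff_add_eq_0)
    then show ?thesis by (intro eq_matI) (auto simp: carrier_matD[OF \<Phi>_carrier])
  qed
  finally show ?thesis unfolding L r .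
qed

lemma free_mat_\<Phi>:
  assumes "Y \<in> carrier_mat (n ^ k) (n ^ k)" "k > 0"
  shows "free_mat n n (\<Phi> k Y)"
proof -
  have N: "n ^ k = n * n ^ (k - 1)" using assms(2) by (cases k) auto
  have "free_mat n (n ^ k) (M_prod k)"
  proof -
    have "free_mat n (n ^ k) (foldr (\<lambda>i X. M_bar n F k i * X) xs (1\<^sub>m (n ^ k)))" if "\<forall>i\<in>set xs. 1 \<le> i \<and> i \<le> k" for xs
      using that by (induction xs) (auto intro!: free_mat_one free_mat_mult free_mat_M_bar)
    then show ?thesis unfolding op_prod_def by (simp del: upt_Suc)
  qed
  then have "free_mat n (n ^ k) (lift_op (Dprod k 2 * Y) * M_prod k)"
    by (intro free_mat_mult free_mat_lift mult_carrier_mat[OF Dprod_carrier2 assms(1)])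
  then show ?thesis unfolding \<Phi>_eq'[OF assms(1)] by (intro free_mat_ptrace2) (simp only: N)
qed

lemma \<Phi>_M_pow_sigma:
  assumes "k = Suc (p + j)" "a < n" "b < n"
  shows "\<Phi> k (R_prod k p * antisymm_at k (Suc p) j) $$ (a, b) = M_pow n R F (Suc p) $$ (a, b) * sigma n q R F j"
proof -
  have M: "M_pow n R F (Suc p) \<in> carrier_mat n n" by (simp add: M_pow_def qtrace_from2_def)
  have "(M_pow n R F (Suc p) * (sigma n q R F j \<cdot>\<^sub>m 1\<^sub>m n)) $$ (a, b)
      = (\<Sum>l<n. if l = b then M_pow n R F (Suc p) $$ (a, b) * sigma n q R F j else 0)"
    unfolding index_mult_sum[OF M smult_carrier_mat[OF one_carrier_mat] assms(2,3)]
    using assms by (intro sum.cong) auto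
  then show ?thesis unfolding \<Phi>_def M_pow_sigma[OF assms(1)] using assms by simp
qed

lemma \<Phi>_M_wedge: "k > 0 \<Longrightarrow> \<Phi> k (R_prod k 0 * antisymm_at k 0 k) = M_wedge n q R F k"
  unfolding \<Phi>_def M_wedge_def using act_full1[OF antisymm_carrier[of k]] left_mult_one_mat[OF antisymm_carrier[of k]]
  by (simp add: op_prod_empty)

text \<open>Multiplied by (-1)^j, the recursion says that v_j = (-1)^(j+1) j_q u_j grows by exactly
  (-q)^j t_j from j to j + 1; with v_0 = 0 it telescopes. At j = k the product of R's is empty and
  u_k is the wedge power.\<close>

lemma newton_partial:
  assumes ab: "a < n" "b < n" and "j \<le> k" "k > 0"
  shows "scal (- ((- 1) ^ j * qnum q j)) * \<Phi> k (R_prod k (k - j) * antisymm_at k (k - j) j) $$ (a, b)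
    - (\<Sum>i<j. scal ((- q) ^ i) * M_pow n R F (k - i) $$ (a, b) * sigma n q R F i) \<in> \<I>"
  using assms(3)
proof (induction j)
  case 0
  have "qnum q 0 = 0" by (simp add: qnum_def)
  then show ?case by (simp add: ring_hom_scal I_zero)
next
  case (Suc j)
  define p where "p = k - Suc j"
  have k: "k = Suc (p + j)" "k - Suc j = p" "k - j = Suc p" using Suc.prems by (auto simp: p_def)
  let ?u' = "\<Phi> k (R_prod k p * antisymm_at k p (Suc j))" and ?t = "\<Phi> k (R_prod k p * antisymm_at k (Suc p) j)"
    and ?u = "\<Phi> k (R_prod k (Suc p) * antisymm_at k (Suc p) j)"
  let ?s = "(- 1) ^ j :: 'k" and ?S = "\<Sum>i<j. scal ((- q) ^ i) * M_pow n R F (k - i) $$ (a, b) * sigma n q R F i"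
  have "scal (qnum q (Suc j)) * ?u' $$ (a, b) - (scal (q ^ j) * ?t $$ (a, b) - scal (qnum q j) * ?u $$ (a, b)) \<in> \<I>"
    using \<Phi>_recursion[OF k(1)] ab unfolding ideal_mat_def by (auto simp: carrier_matD[OF \<Phi>_carrier])
  then have 1: "scal ?s * (scal (qnum q (Suc j)) * ?u' $$ (a, b) - (scal (q ^ j) * ?t $$ (a, b) - scal (qnum q j) * ?u $$ (a, b))) \<in> \<I>"
    by (rule I_left[OF _ scal_carrier])
  have 2: "scal (- (?s * qnum q j)) * ?u $$ (a, b) - ?S \<in> \<I>" using Suc unfolding k(3) by simp
  have neg: "scal (- c) = - scal c" for c :: 'k
    using ring_hom_scal(3)[of "- c" c] by (simp add: ring_hom_scal eq_neg_iff_add_eq_0)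
  have "scal (- ((- 1) ^ Suc j * qnum q (Suc j))) * ?u' $$ (a, b) - (?S + scal ((- q) ^ j) * ?t $$ (a, b))
    = scal ?s * (scal (qnum q (Suc j)) * ?u' $$ (a, b) - (scal (q ^ j) * ?t $$ (a, b) - scal (qnum q j) * ?u $$ (a, b)))
      + (scal (- (?s * qnum q j)) * ?u $$ (a, b) - ?S)"
    by (simp add: neg ring_hom_scal right_diff_distrib mult.assoc[symmetric] power_minus[of q])
  also have "\<dots> \<in> \<I>" by (rule I_add[OF 1 2])
  also have "?S + scal ((- q) ^ j) * ?t $$ (a, b) = (\<Sum>i<Suc j. scal ((- q) ^ i) * M_pow n R F (k - i) $$ (a, b) * sigma n q R F i)"
    using \<Phi>_M_pow_sigma[OF k(1) ab] by (simp add: k mult.assoc)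
  finally show ?case unfolding k(2) .
qed

lemma newton:
  assumes "a < n" "b < n" and k: "k > 0"
  shows "scal ((- 1) ^ (k - 1) * qnum q k) * M_wedge n q R F k $$ (a, b)
    - (\<Sum>j = 0..k - 1. scal ((- q) ^ j) * M_pow n R F (k - j) $$ (a, b) * sigma n q R F j) \<in> \<I>"
proof -
  have "{0..k - 1} = {..<k}" using k by auto
  moreover have "- ((- 1) ^ k * qnum q k) = (- 1) ^ (k - 1) * qnum q k" using k by (cases k) auto
  ultimately show ?thesis using newton_partial[OF assms(1,2) le_refl k] \<Phi>_M_wedge[OF k] by simp
qed

lemma newton_matrix:
  assumes k: "k > 0"
  shows "map_mat (qm_class n R F) (scal ((-1) ^ (k - 1) * qnum q k) \<cdot>\<^sub>m M_wedge n q R F k) =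
    map_mat (qm_class n R F) (mat n n (\<lambda>(a, b).
      \<Sum>j = 0..k - 1. scal ((- q) ^ j) * M_pow n R F (k - j) $$ (a, b) * sigma n q R F j))"
proof (rule eq_matI)
  have W: "M_wedge n q R F k \<in> carrier_mat n n" by (simp add: M_wedge_def qtrace_from2_def)
  let ?x = "\<lambda>a b. scal ((-1) ^ (k - 1) * qnum q k) * M_wedge n q R F k $$ (a, b)"
  let ?y = "\<lambda>a b. \<Sum>j = 0..k - 1. scal ((- q) ^ j) * M_pow n R F (k - j) $$ (a, b) * sigma n q R F j"
  fix a b assume "a < dim_row (map_mat (qm_class n R F) (mat n n (\<lambda>(a, b). ?y a b)))"
    "b < dim_col (map_mat (qm_class n R F) (mat n n (\<lambda>(a, b). ?y a b)))"
  then have ab: "a < n" "b < n" by auto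
  have "antisymm_at k 0 k \<in> carrier_mat (n ^ k) (n ^ k)" "R_prod k 0 \<in> carrier_mat (n ^ k) (n ^ k)"
    using antisymm_at_carrier[of 0 k k] by (simp_all add: op_prod_empty)
  then have "free_mat n n (M_wedge n q R F k)"
    unfolding \<Phi>_M_wedge[OF k, symmetric] by (intro free_mat_\<Phi> k mult_carrier_mat[of _ "n ^ k" "n ^ k"])
  then have x: "?x a b \<in> carrier (free_algebra n)"
    using ab unfolding free_mat_def by (intro free_carrier_simps(4) scal_carrier) auto
  \<comment> \<open>The right-hand side lies in the carrier because it is the left-hand side minus
    an element of the ideal.\<close>
  have "?x a b - (?x a b - ?y a b) \<in> carrier (free_algebra n)"
    by (rule free_carrier_simps(6)[OF x I_subset[OF newton[OF ab k]]])
  then have y: "?y a b \<in> carrier (free_algebra n)" by simp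
  have "qm_class n R F (?x a b) = qm_class n R F (?y a b)"
    by (rule qm_class_eqI[OF ideal_I x y newton[OF ab k]])
  then show "map_mat (qm_class n R F) (scal ((-1) ^ (k - 1) * qnum q k) \<cdot>\<^sub>m M_wedge n q R F k) $$ (a, b)
      = map_mat (qm_class n R F) (mat n n (\<lambda>(a, b). ?y a b)) $$ (a, b)"
    using ab W by simp
qed (simp_all add: M_wedge_def qtrace_from2_def ptrace2_def)

end

theorem mainTheorem6:
  fixes n k :: nat and q :: "'k::field" and R F :: "'k mat"
  assumes "q \<noteq> 0" and "\<forall>m>0. q ^ m \<noteq> 1"
    and "yang_baxter n R" and "hecke_type n q R"
    and "yang_baxter n F" and "\<exists>!D. is_D n F D"
    and "compatible_pair n R F"
    and "k \<ge> 1"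
  shows "map_mat (qm_class n R F) (scal ((-1) ^ (k - 1) * qnum q k) \<cdot>\<^sub>m M_wedge n q R F k) =
    map_mat (qm_class n R F) (mat n n (\<lambda>(a, b).
      \<Sum>j = 0..k - 1. scal ((- q) ^ j) * M_pow n R F (k - j) $$ (a, b) * sigma n q R F j))"
\<comment> \<open>In dimension zero both sides are empty matrices.\<close>
proof (cases "n = 0")
  case True
  then show ?thesis
    by (intro empty_mat_eq) (simp_all add: M_wedge_def qtrace_from2_def ptrace2_def)
next
  case False
  interpret quantum_matrix n F R q
    by unfold_locales (use assms False in auto)
  show ?thesis
    by (rule newton_matrix) (use assms(8) in simp)
qed

end
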